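(* Let $k$ be a fixed positive integer. There exists a randomized algorithm running in $\tilde{O}(mn + n^{k/2 + 1})$ time that, with high probability, computes a $\left(2 - \frac{1}{2k-1}, 1 - \frac{1}{2k-1}\right)$-approximation to the $k$-center of any unweighted, undirected graph with $n$ vertices and $m$ edges.
   Context: $G=(V,E)$ is an undirected unweighted graph with $n$ vertices and $m\ge n-1$ edges, $d$ its shortest-path distance. $R_k(G)=\min_{C\subseteq V,|C|=k}\max_{v\in V} d(v,C)$ with $d(v,C)=\min_{c\in C}d(v,c)$ (the $k$-radius). An $(\alpha,\beta)$-approximation to the $k$-center is a value $\tilde R$ (witnessed by $k$ vertices covering all vertices within distance $\tilde R$) with $R_k(G)\le \tilde R\le \alpha R_k(G)+\beta$. $\tilde O$ hides polylogarithmic factors; "with high probability" means with probability at least $1-1/n^{c}$ for a constant $c>0$. *)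

theory Defs
  imports "HOL-Probability.Probability" "HOL-Library.Log_Nat"
begin

section \<open>Graphs and the k-center problem\<close>

text \<open>Graphs have vertex set \<open>{..<n}\<close>; they need not be connected, so distances are extended
  naturals, with \<open>\<infinity>\<close> (the infimum of the empty set) between different components.\<close>

definition simple_graph :: "nat \<Rightarrow> nat set set \<Rightarrow> bool" where
  "simple_graph n E \<longleftrightarrow> (\<forall>e\<in>E. \<exists>u v. e = {u, v} \<and> u \<noteq> v \<and> u < n \<and> v < n)"

definition walk :: "nat set set \<Rightarrow> nat list \<Rightarrow> bool" where
  "walk E p \<longleftrightarrow> p \<noteq> [] \<and> successively (\<lambda>u v. {u, v} \<in> E) p"

definition gdist :: "nat set set \<Rightarrow> nat \<Rightarrow> nat \<Rightarrow> enat" where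
  "gdist E u v = (INF p\<in>{p. walk E p \<and> hd p = u \<and> last p = v}. enat (length p - 1))"

definition set_gdist :: "nat set set \<Rightarrow> nat \<Rightarrow> nat set \<Rightarrow> enat" where
  "set_gdist E v C = (INF c\<in>C. gdist E v c)"

definition k_radius :: "nat \<Rightarrow> nat set set \<Rightarrow> nat \<Rightarrow> enat" where
  "k_radius n E k = (INF C\<in>{C. C \<subseteq> {..<n} \<and> card C = k}. SUP v\<in>{..<n}. set_gdist E v C)"

definition k_center_approx ::
  "real \<Rightarrow> real \<Rightarrow> nat \<Rightarrow> nat set set \<Rightarrow> nat \<Rightarrow> enat \<Rightarrow> nat set \<Rightarrow> bool" where
  "k_center_approx \<alpha> \<beta> n E k R C \<longleftrightarrow>
     C \<subseteq> {..<n} \<and> card C = k \<and> (\<forall>v<n. set_gdist E v C \<le> R) \<and>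
     k_radius n E k \<le> R \<and>
     ereal_of_enat R \<le> ereal \<alpha> * ereal_of_enat (k_radius n E k) + ereal \<beta>"

section \<open>Randomized word RAM\<close>

text \<open>Programs act on registers and on a random-access memory, both holding \<open>w\<close>-bit words;
  arithmetic is modulo \<open>2 ^ w\<close>. Every instruction, and every evaluation of a branch or loop
  condition (register nonzero), takes one step.\<close>

datatype binop = OpAdd | OpSub | OpMul | OpDiv | OpMod | OpLess | OpEq

datatype instr =
    Const nat nat
  | Move nat nat
  | Bin binop nat nat nat
  | Load nat nat
  | Store nat nat
  | Rand nat
  | Cond nat "instr list" "instr list"
  | While nat "instr list"

record ram_state =
  reg :: "nat \<Rightarrow> nat"
  mem :: "nat \<Rightarrow> nat"

text \<open>A configuration consists of the instructions still to be executed and the state.\<close>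

type_synonym config = "instr list \<times> ram_state"

fun eval_op :: "nat \<Rightarrow> binop \<Rightarrow> nat \<Rightarrow> nat \<Rightarrow> nat" where
  "eval_op w OpAdd a b = (a + b) mod 2 ^ w"
| "eval_op w OpSub a b = nat ((int a - int b) mod 2 ^ w)"
| "eval_op w OpMul a b = (a * b) mod 2 ^ w"
| "eval_op w OpDiv a b = a div b"
| "eval_op w OpMod a b = a mod b"
| "eval_op w OpLess a b = of_bool (a < b)"
| "eval_op w OpEq a b = of_bool (a = b)"

definition set_reg :: "nat \<Rightarrow> nat \<Rightarrow> ram_state \<Rightarrow> ram_state" where
  "set_reg x a s = s\<lparr>reg := (reg s)(x := a)\<rparr>"

definition set_mem :: "nat \<Rightarrow> nat \<Rightarrow> ram_state \<Rightarrow> ram_state" where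
  "set_mem i a s = s\<lparr>mem := (mem s)(i := a)\<rparr>"

fun step :: "nat \<Rightarrow> config \<Rightarrow> config pmf" where
  "step w ([], s) = return_pmf ([], s)"
| "step w (Const x a # K, s) = return_pmf (K, set_reg x (a mod 2 ^ w) s)"
| "step w (Move x y # K, s) = return_pmf (K, set_reg x (reg s y) s)"
| "step w (Bin f x y z # K, s) = return_pmf (K, set_reg x (eval_op w f (reg s y) (reg s z)) s)"
| "step w (Load x y # K, s) = return_pmf (K, set_reg x (mem s (reg s y)) s)"
| "step w (Store x y # K, s) = return_pmf (K, set_mem (reg s x) (reg s y) s)"
| "step w (Rand x # K, s) = map_pmf (\<lambda>a. (K, set_reg x a s)) (pmf_of_set {..<2 ^ w})"
| "step w (Cond x A B # K, s) = return_pmf ((if reg s x \<noteq> 0 then A else B) @ K, s)"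
| "step w (While x A # K, s) = return_pmf (if reg s x \<noteq> 0 then A @ While x A # K else K, s)"

definition run :: "nat \<Rightarrow> nat \<Rightarrow> config \<Rightarrow> config pmf" where
  "run w t c = ((\<lambda>p. bind_pmf p (step w)) ^^ t) (return_pmf c)"

definition halted :: "config \<Rightarrow> bool" where
  "halted c \<longleftrightarrow> fst c = []"

section \<open>Input, output and running time\<close>

text \<open>The input is an arbitrary listing of the edges, each once and in arbitrary orientation.\<close>

definition edge_listing :: "nat set set \<Rightarrow> (nat \<times> nat) list \<Rightarrow> bool" where
  "edge_listing E es \<longleftrightarrow>
     distinct (map (\<lambda>(u, v). {u, v}) es) \<and> set (map (\<lambda>(u, v). {u, v}) es) = E"

definition input_state :: "nat \<Rightarrow> (nat \<times> nat) list \<Rightarrow> ram_state" where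
  "input_state n es =
     \<lparr>reg = (\<lambda>_. 0)(0 := n, 1 := length es),
      mem = (\<lambda>i. if i < 2 * length es
                  then (if even i then fst (es ! (i div 2)) else snd (es ! (i div 2))) else 0)\<rparr>"

text \<open>The output value is read off register 0, where the word \<open>0\<close> stands for \<open>\<infinity>\<close> and
  \<open>r + 1\<close> stands for \<open>r\<close>; the centers are read off the first \<open>k\<close> memory cells.\<close>

definition output_value :: "config \<Rightarrow> enat" where
  "output_value c = (case reg (snd c) 0 of 0 \<Rightarrow> \<infinity> | Suc r \<Rightarrow> enat r)"

definition output_centers :: "nat \<Rightarrow> config \<Rightarrow> nat set" where
  "output_centers k c = mem (snd c) ` {..<k}"

text \<open>The polylogarithmic factor is a power of \<open>1 + log 2 n\<close>, so that it does not vanish at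
  \<open>n = 1\<close>.\<close>

definition soft_O :: "(nat \<Rightarrow> nat \<Rightarrow> real) \<Rightarrow> (nat \<Rightarrow> nat \<Rightarrow> nat) set" where
  "soft_O f = {T. \<exists>a b::nat. \<forall>n\<ge>1. \<forall>m.
     real (T n m) \<le> real a * f n m * (1 + log 2 (real n)) ^ b}"

text \<open>The word length is \<open>\<kappa>\<close> times the bit length of \<open>n\<close>; for \<open>\<kappa> \<ge> 2\<close> all input
  words and input addresses fit. The time bound holds for every outcome of the random choices.\<close>

definition solves_k_center_whp ::
  "instr list \<Rightarrow> nat \<Rightarrow> (nat \<Rightarrow> nat \<Rightarrow> nat) \<Rightarrow> real \<Rightarrow> nat \<Rightarrow> real \<Rightarrow> real \<Rightarrow> bool" where
  "solves_k_center_whp P \<kappa> T c k \<alpha> \<beta> \<longleftrightarrow>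
     (\<forall>n E es. simple_graph n E \<and> k \<le> n \<and> n \<le> card E + 1 \<and> edge_listing E es \<longrightarrow>
        (let D = run (\<kappa> * floorlog 2 n) (T n (card E)) (P, input_state n es) in
           (\<forall>cf\<in>set_pmf D. halted cf) \<and>
           measure_pmf.prob D
             {cf. k_center_approx \<alpha> \<beta> n E k (output_value cf) (output_centers k cf)}
             \<ge> 1 - 1 / real n powr c))"

end

theory Submission imports Defs "HOL-Library.Countable" begin

text \<open>
The program is deterministic. It computes all distances by breadth-first search and keeps, for every
vertex \<open>v\<close>, the row \<open>N v\<close> of its \<open>q\<close> nearest vertices, where \<open>q\<close> is about \<open>sqrt n\<close>. A greedy set \<open>S\<close> of
about \<open>(n / q) * ln n\<close> vertices hits all these rows; hence a vertex \<open>v\<close> at distance more than \<open>r\<close> from \<open>S\<close> has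
its whole ball of radius \<open>r\<close> inside \<open>N v\<close>.

Binary search guesses the optimal radius \<open>R\<close>. Let \<open>h = R div (2 * k - 1)\<close> and \<open>D = 2 * R - h\<close>, the radius aimed at.
Centers are chosen one after the other. If the optimal centers that are still needed all lie
within \<open>R - h\<close> of \<open>S\<close>, they may be replaced by elements of \<open>S\<close>. Otherwise let \<open>c\<close> be one that does not, covering a
vertex \<open>v\<close> at distance more than \<open>D\<close> from the \<open>i\<close> vertices chosen so far. The point at distance \<open>2 * i * h\<close>
from \<open>c\<close> on the way to \<open>v\<close> is not covered by the optimal centers already approximated,
  and it is still far from \<open>S\<close>.
So the vertex \<open>w\<close> that is farthest from \<open>S\<close> among the vertices at distance more than \<open>R + (2 * i - 1) * h\<close> from the
chosen ones is covered by a new optimal center \<open>c'\<close>, and \<open>N w\<close> contains a vertex within \<open>(2 * i + 1) * h\<close> of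
\<open>c'\<close>. In both cases \<open>S \<union> N w\<close>, of size about \<open>sqrt n\<close>, contains a suitable next choice.

The last center is found in time about \<open>n * sqrt n\<close>. If some uncovered \<open>w\<close> is at distance more than
\<open>rho = (R - h) div 2\<close> from \<open>S\<close>, then \<open>N w\<close> contains a good choice. Otherwise each uncovered vertex has a
representative in \<open>S\<close> within \<open>rho\<close>, and it suffices to test, for all vertices \<open>u\<close>, whether \<open>u\<close> is within
\<open>R + rho\<close> of these representatives.
\<close>

text \<open>Time bounds would otherwise be turned from numerals into successor form.\<close>

declare One_nat_def [simp del]

section \<open>Deterministic runs\<close>

definition reaches :: "nat \<Rightarrow> nat \<Rightarrow> config \<Rightarrow> config \<Rightarrow> bool" where
  "reaches w t c c' \<longleftrightarrow> run w t c = return_pmf c'"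

lemma run_add: "run w (a + b) c = bind_pmf (run w a c) (run w b)"
proof (induction b)
  case 0
  then show ?case by (simp add: run_def bind_return_pmf')
next
  case (Suc b)
  have "run w (Suc b) = (\<lambda>x. bind_pmf (run w b x) (step w))"
    by (simp add: run_def fun_eq_iff)
  then show ?case
    using Suc by (simp add: run_def bind_assoc_pmf)
qed

lemma reaches_0 [simp]: "reaches w 0 c c' \<longleftrightarrow> c = c'"
  by (simp add: reaches_def run_def)

lemma reaches_trans: "reaches w s c c' \<Longrightarrow> reaches w t c' c'' \<Longrightarrow> reaches w (s + t) c c''"
  by (simp add: reaches_def run_add bind_return_pmf)

lemma reaches_step:
  assumes "step w c = return_pmf c'" "0 < t"
  shows "reaches w t c c'' \<longleftrightarrow> reaches w (t - 1) c' c''"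
proof -
  have "run w t c = bind_pmf (step w c) (run w (t - 1))"
    using run_add[of w 1 "t - 1" c] assms(2) by (simp add: run_def bind_return_pmf One_nat_def)
  then show ?thesis using assms(1) by (simp add: reaches_def bind_return_pmf)
qed

lemma reaches_halted: "reaches w t ([], s) ([], s)"
  by (induction t) (simp_all add: reaches_step)

lemmas reaches_instr =
  step.simps(2-6,8,9)[THEN reaches_step]

section \<open>Structured programs\<close>

text \<open>Programs work on named variables and named matrices; vectors are matrices of which only row
  \<open>0\<close> is used.\<close>

datatype ('v, 'a) expr =
    Lit nat
  | Var 'v
  | Cell 'a "('v, 'a) expr" "('v, 'a) expr"
  | Opr binop "('v, 'a) expr" "('v, 'a) expr"

datatype ('v, 'a) com =
    Skip
  | Assign 'v "('v, 'a) expr" (infix "::=" 62)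
  | Put 'a "('v, 'a) expr" "('v, 'a) expr" "('v, 'a) expr"
  | Seq "('v, 'a) com" "('v, 'a) com" (infixr ";;" 60)
  | Branch "('v, 'a) expr" "('v, 'a) com" "('v, 'a) com"
  | Loop "('v, 'a) expr" "('v, 'a) com"

abbreviation add_expr (infixl "\<oplus>" 65) where "a \<oplus> b \<equiv> Opr OpAdd a b"
abbreviation sub_expr (infixl "\<ominus>" 65) where "a \<ominus> b \<equiv> Opr OpSub a b"
abbreviation mul_expr (infixl "\<otimes>" 70) where "a \<otimes> b \<equiv> Opr OpMul a b"
abbreviation div_expr (infixl "\<oslash>" 70) where "a \<oslash> b \<equiv> Opr OpDiv a b"
abbreviation less_expr (infix "\<prec>" 63) where "a \<prec> b \<equiv> Opr OpLess a b"
abbreviation eq_expr (infix "\<doteq>" 63) where "a \<doteq> b \<equiv> Opr OpEq a b"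
abbreviation Elem :: "'a \<Rightarrow> ('v, 'a) expr \<Rightarrow> ('v, 'a) expr" where "Elem a \<equiv> Cell a (Lit 0)"
abbreviation Put_Elem :: "'a \<Rightarrow> ('v, 'a) expr \<Rightarrow> ('v, 'a) expr \<Rightarrow> ('v, 'a) com" where
  "Put_Elem a \<equiv> Put a (Lit 0)"

fun apply_op :: "binop \<Rightarrow> nat \<Rightarrow> nat \<Rightarrow> nat" where
  "apply_op OpAdd a b = a + b"
| "apply_op OpSub a b = a - b"
| "apply_op OpMul a b = a * b"
| "apply_op OpDiv a b = a div b"
| "apply_op OpMod a b = a mod b"
| "apply_op OpLess a b = of_bool (a < b)"
| "apply_op OpEq a b = of_bool (a = b)"

fun op_fits :: "nat \<Rightarrow> binop \<Rightarrow> nat \<Rightarrow> nat \<Rightarrow> bool" where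
  "op_fits w OpAdd a b \<longleftrightarrow> a + b < 2 ^ w"
| "op_fits w OpSub a b \<longleftrightarrow> b \<le> a \<and> a < 2 ^ w"
| "op_fits w OpMul a b \<longleftrightarrow> a * b < 2 ^ w"
| "op_fits w _ a b \<longleftrightarrow> True"

lemma eval_op_fits:
  assumes "op_fits w f a b"
  shows "eval_op w f a b = apply_op f a b"
proof (cases f)
  case OpSub
  then have "b \<le> a" "a < 2 ^ w" using assms by auto
  then have diff: "int a - int b = int (a - b)" and "a - b < 2 ^ w" by auto
  then have "int (a - b) < 2 ^ w" by (metis of_nat_less_iff of_nat_numeral of_nat_power)
  then show ?thesis by (simp add: OpSub diff del: of_nat_diff)
qed (use assms in simp_all)

fun val :: "('v, 'a) expr \<Rightarrow> ('v \<Rightarrow> nat) \<Rightarrow> ('a \<Rightarrow> nat \<Rightarrow> nat \<Rightarrow> nat) \<Rightarrow> nat" where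
  "val (Lit a) \<sigma> \<mu> = a"
| "val (Var x) \<sigma> \<mu> = \<sigma> x"
| "val (Cell a i j) \<sigma> \<mu> = \<mu> a (val i \<sigma> \<mu>) (val j \<sigma> \<mu>)"
| "val (Opr f e e') \<sigma> \<mu> = apply_op f (val e \<sigma> \<mu>) (val e' \<sigma> \<mu>)"

definition put :: "'a \<Rightarrow> nat \<Rightarrow> nat \<Rightarrow> nat \<Rightarrow> ('a \<Rightarrow> nat \<Rightarrow> nat \<Rightarrow> nat) \<Rightarrow> 'a \<Rightarrow> nat \<Rightarrow> nat \<Rightarrow> nat" where
  "put a i j v \<mu> = \<mu>(a := (\<mu> a)(i := (\<mu> a i)(j := v)))"

lemma put_simps [simp]:
  "put a i j v \<mu> a = (\<mu> a)(i := (\<mu> a i)(j := v))"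
  "b \<noteq> a \<Longrightarrow> put a i j v \<mu> b = \<mu> b"
  by (simp_all add: put_def)

text \<open>The sizes count the machine instructions; addressing a matrix cell takes five of them.\<close>

fun expr_cost :: "('v, 'a) expr \<Rightarrow> nat" where
  "expr_cost (Lit a) = 1"
| "expr_cost (Var x) = 1"
| "expr_cost (Cell a i j) = expr_cost i + expr_cost j + 6"
| "expr_cost (Opr f e e') = expr_cost e + expr_cost e' + 1"

fun cost :: "('v, 'a) com \<Rightarrow> nat" where
  "cost Skip = 0"
| "cost (x ::= e) = expr_cost e + 1"
| "cost (Put a i j e) = expr_cost i + expr_cost j + expr_cost e + 6"
| "cost (c;; c') = cost c + cost c'"
| "cost (Branch e c c') = expr_cost e + 1 + max (cost c) (cost c')"
| "cost (Loop e c) = 0"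

fun writes :: "('v, 'a) com \<Rightarrow> 'v set" where
  "writes Skip = {}"
| "writes (x ::= e) = {x}"
| "writes (Put a i j e) = {}"
| "writes (c;; c') = writes c \<union> writes c'"
| "writes (Branch e c c') = writes c \<union> writes c'"
| "writes (Loop e c) = writes c"

fun stores :: "('v, 'a) com \<Rightarrow> 'a set" where
  "stores Skip = {}"
| "stores (x ::= e) = {}"
| "stores (Put a i j e) = {a}"
| "stores (c;; c') = stores c \<union> stores c'"
| "stores (Branch e c c') = stores c \<union> stores c'"
| "stores (Loop e c) = stores c"

definition unchanged :: "('v, 'a) com \<Rightarrow> ('v \<Rightarrow> nat) \<Rightarrow> ('a \<Rightarrow> nat \<Rightarrow> nat \<Rightarrow> nat) \<Rightarrow>
    ('v \<Rightarrow> nat) \<Rightarrow> ('a \<Rightarrow> nat \<Rightarrow> nat \<Rightarrow> nat) \<Rightarrow> bool" where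
  "unchanged c \<sigma> \<mu> \<sigma>' \<mu>' \<longleftrightarrow> (\<forall>x. x \<notin> writes c \<longrightarrow> \<sigma>' x = \<sigma> x) \<and> (\<forall>a. a \<notin> stores c \<longrightarrow> \<mu>' a = \<mu> a)"

lemma unchangedD:
  assumes "unchanged c \<sigma> \<mu> \<sigma>' \<mu>'"
  shows "x \<notin> writes c \<Longrightarrow> \<sigma>' x = \<sigma> x" "a \<notin> stores c \<Longrightarrow> \<mu>' a = \<mu> a"
  using assms by (simp_all add: unchanged_def)

lemma unchanged_trans:
  assumes "unchanged c \<sigma> \<mu> \<sigma>' \<mu>'" "unchanged c \<sigma>' \<mu>' \<sigma>'' \<mu>''"
  shows "unchanged c \<sigma> \<mu> \<sigma>'' \<mu>''"
  using assms by (simp add: unchanged_def)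

definition for_range :: "'v \<Rightarrow> 'v \<Rightarrow> ('v, 'a) com \<Rightarrow> ('v, 'a) com" where
  "for_range x h c = (x ::= Lit 0;; Loop (Var x \<prec> Var h) (c;; x ::= Var x \<oplus> Lit 1))"

lemma for_range_effects [simp]:
  "writes (for_range x h c) = insert x (writes c)" "stores (for_range x h c) = stores c"
  by (auto simp: for_range_def)

definition fill :: "'a \<Rightarrow> ('v, 'a) expr \<Rightarrow> 'v \<Rightarrow> 'v \<Rightarrow> ('v, 'a) expr \<Rightarrow> ('v, 'a) com" where
  "fill a i x h e = for_range x h (Put a i (Var x) e)"

lemma fill_effects [simp]: "writes (fill a i x h e) = {x}" "stores (fill a i x h e) = {a}"
  by (simp_all add: fill_def)

definition is_argmax :: "nat \<Rightarrow> (nat \<Rightarrow> bool) \<Rightarrow> (nat \<Rightarrow> nat) \<Rightarrow> nat \<Rightarrow> nat \<Rightarrow> bool" where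
  "is_argmax N P f b a \<longleftrightarrow> (\<forall>j<N. P j \<longrightarrow> f j \<le> b) \<and> (if b = 0 then a = 0 else a < N \<and> P a \<and> f a = b)"

definition argmax :: "'v \<Rightarrow> 'v \<Rightarrow> ('v, 'a) expr \<Rightarrow> ('v, 'a) expr \<Rightarrow> 'v \<Rightarrow> 'v \<Rightarrow> ('v, 'a) com" where
  "argmax x h b e best arg = (best ::= Lit 0;; arg ::= Lit 0);;
     for_range x h (Branch (b \<otimes> (Var best \<prec> e)) (best ::= e;; arg ::= Var x) Skip)"

lemma argmax_effects [simp]:
  "writes (argmax x h b e best arg) = {x, best, arg}" "stores (argmax x h b e best arg) = {}"
  by (auto simp: argmax_def)

definition check_all :: "'v \<Rightarrow> 'v \<Rightarrow> 'v \<Rightarrow> ('v, 'a) expr \<Rightarrow> ('v, 'a) com" where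
  "check_all flag x h b = flag ::= Lit 1;; for_range x h (Branch b (flag ::= Lit 0) Skip)"

lemma check_all_effects [simp]:
  "writes (check_all flag x h b) = {flag, x}" "stores (check_all flag x h b) = {}"
  by (auto simp: check_all_def)

section \<open>Total correctness with a time bound\<close>

locale bounded_memory =
  fixes w :: nat and fits :: "'a \<Rightarrow> nat \<Rightarrow> nat \<Rightarrow> bool"
begin

fun safe :: "('v, 'a) expr \<Rightarrow> ('v \<Rightarrow> nat) \<Rightarrow> ('a \<Rightarrow> nat \<Rightarrow> nat \<Rightarrow> nat) \<Rightarrow> bool" where
  "safe (Lit a) \<sigma> \<mu> \<longleftrightarrow> a < 2 ^ w"
| "safe (Var x) \<sigma> \<mu> \<longleftrightarrow> True"
| "safe (Cell a i j) \<sigma> \<mu> \<longleftrightarrow> safe i \<sigma> \<mu> \<and> safe j \<sigma> \<mu> \<and> fits a (val i \<sigma> \<mu>) (val j \<sigma> \<mu>)"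
| "safe (Opr f e e') \<sigma> \<mu> \<longleftrightarrow> safe e \<sigma> \<mu> \<and> safe e' \<sigma> \<mu> \<and> op_fits w f (val e \<sigma> \<mu>) (val e' \<sigma> \<mu>)"

inductive exec :: "('v, 'a) com \<Rightarrow> ('v \<Rightarrow> nat) \<Rightarrow> ('a \<Rightarrow> nat \<Rightarrow> nat \<Rightarrow> nat) \<Rightarrow> nat \<Rightarrow>
    ('v \<Rightarrow> nat) \<Rightarrow> ('a \<Rightarrow> nat \<Rightarrow> nat \<Rightarrow> nat) \<Rightarrow> bool" where
  exec_Skip: "exec Skip \<sigma> \<mu> 0 \<sigma> \<mu>"
| exec_Assign: "safe e \<sigma> \<mu> \<Longrightarrow> exec (x ::= e) \<sigma> \<mu> (expr_cost e + 1) (\<sigma>(x := val e \<sigma> \<mu>)) \<mu>"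
| exec_Put: "safe (Cell a i j) \<sigma> \<mu> \<Longrightarrow> safe e \<sigma> \<mu> \<Longrightarrow>
    exec (Put a i j e) \<sigma> \<mu> (expr_cost i + expr_cost j + expr_cost e + 6)
      \<sigma> (put a (val i \<sigma> \<mu>) (val j \<sigma> \<mu>) (val e \<sigma> \<mu>) \<mu>)"
| exec_Seq: "exec c \<sigma> \<mu> t \<sigma>' \<mu>' \<Longrightarrow> exec c' \<sigma>' \<mu>' t' \<sigma>'' \<mu>'' \<Longrightarrow> exec (c;; c') \<sigma> \<mu> (t + t') \<sigma>'' \<mu>''"
| exec_Branch: "safe e \<sigma> \<mu> \<Longrightarrow> exec (if val e \<sigma> \<mu> \<noteq> 0 then c else c') \<sigma> \<mu> t \<sigma>' \<mu>' \<Longrightarrow>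
    exec (Branch e c c') \<sigma> \<mu> (expr_cost e + 1 + t) \<sigma>' \<mu>'"
| exec_Loop_end: "safe e \<sigma> \<mu> \<Longrightarrow> val e \<sigma> \<mu> = 0 \<Longrightarrow> exec (Loop e c) \<sigma> \<mu> (expr_cost e + 1) \<sigma> \<mu>"
| exec_Loop_step: "safe e \<sigma> \<mu> \<Longrightarrow> val e \<sigma> \<mu> \<noteq> 0 \<Longrightarrow> exec c \<sigma> \<mu> t \<sigma>' \<mu>' \<Longrightarrow>
    exec (Loop e c) \<sigma>' \<mu>' t' \<sigma>'' \<mu>'' \<Longrightarrow> exec (Loop e c) \<sigma> \<mu> (expr_cost e + 1 + t + t') \<sigma>'' \<mu>''"

lemma exec_unchanged: "exec c \<sigma> \<mu> t \<sigma>' \<mu>' \<Longrightarrow> unchanged c \<sigma> \<mu> \<sigma>' \<mu>'"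
  by (induction rule: exec.induct) (auto simp: unchanged_def split: if_splits)

definition runs :: "('v, 'a) com \<Rightarrow> ('v \<Rightarrow> nat) \<Rightarrow> ('a \<Rightarrow> nat \<Rightarrow> nat \<Rightarrow> nat) \<Rightarrow> nat \<Rightarrow>
    (('v \<Rightarrow> nat) \<Rightarrow> ('a \<Rightarrow> nat \<Rightarrow> nat \<Rightarrow> nat) \<Rightarrow> bool) \<Rightarrow> bool" where
  "runs c \<sigma> \<mu> T Q \<longleftrightarrow> (\<exists>t \<sigma>' \<mu>'. exec c \<sigma> \<mu> t \<sigma>' \<mu>' \<and> t \<le> T \<and> Q \<sigma>' \<mu>')"

lemma runs_weaken:
  assumes "runs c \<sigma> \<mu> T Q" "T \<le> T'"
    and "\<And>\<sigma>' \<mu>'. unchanged c \<sigma> \<mu> \<sigma>' \<mu>' \<Longrightarrow> Q \<sigma>' \<mu>' \<Longrightarrow> Q' \<sigma>' \<mu>'"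
  shows "runs c \<sigma> \<mu> T' Q'"
  using assms exec_unchanged unfolding runs_def by (meson le_trans)

lemma runs_Seq:
  assumes "runs c \<sigma> \<mu> T Q" "T + T' \<le> B"
    and "\<And>\<sigma>' \<mu>'. unchanged c \<sigma> \<mu> \<sigma>' \<mu>' \<Longrightarrow> Q \<sigma>' \<mu>' \<Longrightarrow> runs c' \<sigma>' \<mu>' T' Q'"
  shows "runs (c;; c') \<sigma> \<mu> B Q'"
proof -
  obtain t \<sigma>' \<mu>' where c: "exec c \<sigma> \<mu> t \<sigma>' \<mu>'" "t \<le> T" "Q \<sigma>' \<mu>'"
    using assms(1) by (auto simp: runs_def)
  then obtain t' \<sigma>'' \<mu>'' where "exec c' \<sigma>' \<mu>' t' \<sigma>'' \<mu>''" "t' \<le> T'" "Q' \<sigma>'' \<mu>''"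
    using assms(3) exec_unchanged unfolding runs_def by blast
  then show ?thesis
    using c assms(2) by (auto simp: runs_def intro!: exI exec_Seq)
qed

lemma runs_Branch:
  assumes "safe e \<sigma> \<mu>" "T + expr_cost e + 1 \<le> B"
    and "val e \<sigma> \<mu> \<noteq> 0 \<Longrightarrow> runs c \<sigma> \<mu> T Q" "val e \<sigma> \<mu> = 0 \<Longrightarrow> runs c' \<sigma> \<mu> T Q"
  shows "runs (Branch e c c') \<sigma> \<mu> B Q"
proof -
  have "runs (if val e \<sigma> \<mu> \<noteq> 0 then c else c') \<sigma> \<mu> T Q"
    using assms(3,4) by simp
  then obtain t \<sigma>' \<mu>' where "exec (if val e \<sigma> \<mu> \<noteq> 0 then c else c') \<sigma> \<mu> t \<sigma>' \<mu>'" "t \<le> T" "Q \<sigma>' \<mu>'"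
    by (auto simp only: runs_def)
  moreover from this(2) have "expr_cost e + 1 + t \<le> B" using assms(2) by simp
  ultimately show ?thesis
    unfolding runs_def using exec_Branch[OF assms(1)] by blast
qed

fun wp :: "('v, 'a) com \<Rightarrow> (('v \<Rightarrow> nat) \<Rightarrow> ('a \<Rightarrow> nat \<Rightarrow> nat \<Rightarrow> nat) \<Rightarrow> bool) \<Rightarrow>
    ('v \<Rightarrow> nat) \<Rightarrow> ('a \<Rightarrow> nat \<Rightarrow> nat \<Rightarrow> nat) \<Rightarrow> bool" where
  "wp Skip Q \<sigma> \<mu> \<longleftrightarrow> Q \<sigma> \<mu>"
| "wp (x ::= e) Q \<sigma> \<mu> \<longleftrightarrow> safe e \<sigma> \<mu> \<and> Q (\<sigma>(x := val e \<sigma> \<mu>)) \<mu>"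
| "wp (Put a i j e) Q \<sigma> \<mu> \<longleftrightarrow> safe (Cell a i j) \<sigma> \<mu> \<and> safe e \<sigma> \<mu> \<and>
     Q \<sigma> (put a (val i \<sigma> \<mu>) (val j \<sigma> \<mu>) (val e \<sigma> \<mu>) \<mu>)"
| "wp (c;; c') Q \<sigma> \<mu> \<longleftrightarrow> wp c (wp c' Q) \<sigma> \<mu>"
| "wp (Branch e c c') Q \<sigma> \<mu> \<longleftrightarrow> safe e \<sigma> \<mu> \<and> (if val e \<sigma> \<mu> \<noteq> 0 then wp c Q \<sigma> \<mu> else wp c' Q \<sigma> \<mu>)"
| "wp (Loop e c) Q \<sigma> \<mu> \<longleftrightarrow> False"

lemma runs_wp: "wp c Q \<sigma> \<mu> \<Longrightarrow> runs c \<sigma> \<mu> (cost c) Q"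
proof (induction c arbitrary: Q \<sigma> \<mu>)
  case (Seq c c')
  then have "runs c \<sigma> \<mu> (cost c) (wp c' Q)" by simp
  then show ?case by (rule runs_Seq[where T' = "cost c'"]) (use Seq.IH(2) in auto)
next
  case (Branch e c c')
  then show ?case
    by (intro runs_Branch[where T = "max (cost c) (cost c')"])
      (auto intro: runs_weaken[OF Branch.IH(1)] runs_weaken[OF Branch.IH(2)])
next
  case (Assign x e)
  then show ?case using exec_Assign[of e \<sigma> \<mu> x] by (auto simp: runs_def)
next
  case (Put a i j e)
  then show ?case using exec_Put[of a i j \<sigma> \<mu> e] by (auto simp: runs_def)
qed (auto simp: runs_def intro: exec_Skip)

lemma runs_straight: "wp c Q \<sigma> \<mu> \<Longrightarrow> cost c \<le> T \<Longrightarrow> runs c \<sigma> \<mu> T Q"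
  by (rule runs_weaken[OF runs_wp])

text \<open>The potential \<open>\<Phi>\<close> pays for the iterations and so bounds their number.\<close>

lemma runs_Loop:
  assumes init: "I \<sigma> \<mu>" and time: "\<Phi> \<sigma> \<mu> + expr_cost e + 1 \<le> T"
    and safe: "\<And>\<sigma>' \<mu>'. unchanged c \<sigma> \<mu> \<sigma>' \<mu>' \<Longrightarrow> I \<sigma>' \<mu>' \<Longrightarrow> safe e \<sigma>' \<mu>'"
    and body: "\<And>\<sigma>' \<mu>'. unchanged c \<sigma> \<mu> \<sigma>' \<mu>' \<Longrightarrow> I \<sigma>' \<mu>' \<Longrightarrow> val e \<sigma>' \<mu>' \<noteq> 0 \<Longrightarrow>
      runs c \<sigma>' \<mu>' (C \<sigma>' \<mu>') (\<lambda>\<sigma>'' \<mu>''. I \<sigma>'' \<mu>'' \<and> \<Phi> \<sigma>'' \<mu>'' + C \<sigma>' \<mu>' + expr_cost e + 1 \<le> \<Phi> \<sigma>' \<mu>')"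
    and exit: "\<And>\<sigma>' \<mu>'. unchanged c \<sigma> \<mu> \<sigma>' \<mu>' \<Longrightarrow> I \<sigma>' \<mu>' \<Longrightarrow> val e \<sigma>' \<mu>' = 0 \<Longrightarrow> Q \<sigma>' \<mu>'"
  shows "runs (Loop e c) \<sigma> \<mu> T Q"
proof -
  have "\<exists>t \<sigma>'' \<mu>''. exec (Loop e c) \<sigma>' \<mu>' t \<sigma>'' \<mu>'' \<and> t \<le> \<Phi> \<sigma>' \<mu>' + expr_cost e + 1 \<and> Q \<sigma>'' \<mu>''"
    if "unchanged c \<sigma> \<mu> \<sigma>' \<mu>'" "I \<sigma>' \<mu>'" for \<sigma>' \<mu>'
    using that
  proof (induction "\<Phi> \<sigma>' \<mu>'" arbitrary: \<sigma>' \<mu>' rule: less_induct)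
    case less
    show ?case
    proof (cases "val e \<sigma>' \<mu>' = 0")
      case True
      then show ?thesis
        using exec_Loop_end[of e \<sigma>' \<mu>' c] safe[OF less.prems] exit[OF less.prems] by fastforce
    next
      case False
      then obtain t \<sigma>'' \<mu>'' where c: "exec c \<sigma>' \<mu>' t \<sigma>'' \<mu>''" "t \<le> C \<sigma>' \<mu>'" "I \<sigma>'' \<mu>''"
        "\<Phi> \<sigma>'' \<mu>'' + C \<sigma>' \<mu>' + expr_cost e + 1 \<le> \<Phi> \<sigma>' \<mu>'"
        using body[OF less.prems] by (auto simp: runs_def)
      have "\<Phi> \<sigma>'' \<mu>'' < \<Phi> \<sigma>' \<mu>'" using c(4) by simp
      then obtain t' \<sigma>3 \<mu>3 where rest: "exec (Loop e c) \<sigma>'' \<mu>'' t' \<sigma>3 \<mu>3"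
        "t' \<le> \<Phi> \<sigma>'' \<mu>'' + expr_cost e + 1" "Q \<sigma>3 \<mu>3"
        using less.hyps c(3) unchanged_trans[OF less.prems(1) exec_unchanged[OF c(1)]] by blast
      have "exec (Loop e c) \<sigma>' \<mu>' (expr_cost e + 1 + t + t') \<sigma>3 \<mu>3"
        using safe[OF less.prems] False c(1) rest(1) by (intro exec_Loop_step) auto
      then show ?thesis using c(2,4) rest(2,3) by (intro exI conjI) auto
    qed
  qed
  from this[of \<sigma> \<mu>] init time show ?thesis
    unfolding runs_def unchanged_def by (meson le_trans)
qed

lemma runs_for_range:
  assumes bound: "\<sigma> h = N" "N < 2 ^ w" "x \<noteq> h" "x \<notin> writes c" "h \<notin> writes c"
    and time: "N * (C + 8) + 6 \<le> T"
    and init: "I 0 (\<sigma>(x := 0)) \<mu>"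
    and step: "\<And>j \<sigma>' \<mu>'. j < N \<Longrightarrow> \<sigma>' x = j \<Longrightarrow> unchanged (for_range x h c) \<sigma> \<mu> \<sigma>' \<mu>' \<Longrightarrow>
      I j \<sigma>' \<mu>' \<Longrightarrow> runs c \<sigma>' \<mu>' C (\<lambda>\<sigma>'' \<mu>''. I (Suc j) (\<sigma>''(x := Suc j)) \<mu>'')"
  shows "runs (for_range x h c) \<sigma> \<mu> T (I N)"
  unfolding for_range_def
proof (rule runs_Seq[OF runs_wp])
  show "wp (x ::= Lit 0) (\<lambda>\<sigma>' \<mu>'. \<sigma>' = \<sigma>(x := 0) \<and> \<mu>' = \<mu>) \<sigma> \<mu>" by simp
  show "cost (x ::= Lit 0) + (N * (C + 8) + 4) \<le> T" using time by simp
  fix \<sigma>0 \<mu>0 assume "\<sigma>0 = \<sigma>(x := 0) \<and> \<mu>0 = \<mu>"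
  then have start: "\<sigma>0 = \<sigma>(x := 0)" "\<mu>0 = \<mu>" by auto
  let ?body = "c;; x ::= Var x \<oplus> Lit 1"
  show "runs (Loop (Var x \<prec> Var h) ?body) \<sigma>0 \<mu>0 (N * (C + 8) + 4) (I N)"
  proof (rule runs_Loop[where I = "\<lambda>\<sigma>' \<mu>'. \<sigma>' x \<le> N \<and> I (\<sigma>' x) \<sigma>' \<mu>'"
        and \<Phi> = "\<lambda>\<sigma>' \<mu>'. (N - \<sigma>' x) * (C + 8)" and C = "\<lambda>_ _. C + 4"])
    fix \<sigma>1 \<mu>1 assume body_unchanged: "unchanged ?body \<sigma>0 \<mu>0 \<sigma>1 \<mu>1" and inv: "\<sigma>1 x \<le> N \<and> I (\<sigma>1 x) \<sigma>1 \<mu>1"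
    have h_eq: "\<sigma>1 h = N" using unchangedD(1)[OF body_unchanged, of h] bound start by auto
    have loop_unchanged: "unchanged (for_range x h c) \<sigma> \<mu> \<sigma>1 \<mu>1"
      using body_unchanged start by (auto simp: unchanged_def)
    show "safe (Var x \<prec> Var h) \<sigma>1 \<mu>1" by simp
    show "I N \<sigma>1 \<mu>1" if "val (Var x \<prec> Var h) \<sigma>1 \<mu>1 = 0"
    proof -
      have "\<sigma>1 x = N" using that inv h_eq by simp
      then show ?thesis using inv by simp
    qed
    show "runs ?body \<sigma>1 \<mu>1 (C + 4) (\<lambda>\<sigma>2 \<mu>2. (\<sigma>2 x \<le> N \<and> I (\<sigma>2 x) \<sigma>2 \<mu>2) \<and>
        (N - \<sigma>2 x) * (C + 8) + (C + 4) + expr_cost (Var x \<prec> Var h) + 1 \<le> (N - \<sigma>1 x) * (C + 8))"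
      if "val (Var x \<prec> Var h) \<sigma>1 \<mu>1 \<noteq> 0"
    proof -
      have less: "\<sigma>1 x < N" using that h_eq by simp
      then have "N - \<sigma>1 x = Suc (N - Suc (\<sigma>1 x))" by simp
      then have split: "(N - \<sigma>1 x) * (C + 8) = (N - Suc (\<sigma>1 x)) * (C + 8) + (C + 8)" by simp
      show ?thesis
      proof (rule runs_Seq[OF step[OF less refl loop_unchanged]])
        fix \<sigma>2 \<mu>2 assume "unchanged c \<sigma>1 \<mu>1 \<sigma>2 \<mu>2" "I (Suc (\<sigma>1 x)) (\<sigma>2(x := Suc (\<sigma>1 x))) \<mu>2"
        then show "runs (x ::= Var x \<oplus> Lit 1) \<sigma>2 \<mu>2 4 (\<lambda>\<sigma>2 \<mu>2. (\<sigma>2 x \<le> N \<and> I (\<sigma>2 x) \<sigma>2 \<mu>2) \<and>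
            (N - \<sigma>2 x) * (C + 8) + (C + 4) + expr_cost (Var x \<prec> Var h) + 1 \<le> (N - \<sigma>1 x) * (C + 8))"
          using less bound split by (intro runs_straight) (auto simp: unchanged_def Suc_eq_plus1)
      qed (use inv in auto)
    qed
  qed (use start init in auto)
qed

lemma runs_Seq_straight:
  assumes "wp c (\<lambda>\<sigma>' \<mu>'. runs c' \<sigma>' \<mu>' T Q) \<sigma> \<mu>" "cost c + T \<le> B"
  shows "runs (c;; c') \<sigma> \<mu> B Q"
  by (rule runs_Seq[OF runs_wp[OF assms(1)] assms(2)])

lemma runs_fill:
  assumes "\<sigma> h = N" "N < 2 ^ w" "x \<noteq> h"
    and exprs: "\<And>\<sigma>' \<mu>'. unchanged (fill a i x h e) \<sigma> \<mu> \<sigma>' \<mu>' \<Longrightarrow>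
      safe i \<sigma>' \<mu>' \<and> val i \<sigma>' \<mu>' = r \<and> safe e \<sigma>' \<mu>' \<and> val e \<sigma>' \<mu>' = v"
    and "\<And>j. j < N \<Longrightarrow> fits a r j" and "N * (expr_cost i + expr_cost e + 15) + 6 \<le> T"
  shows "runs (fill a i x h e) \<sigma> \<mu> T (\<lambda>\<sigma>' \<mu>'. (\<forall>j<N. \<mu>' a r j = v) \<and> (\<forall>r'. r' \<noteq> r \<longrightarrow> \<mu>' a r' = \<mu> a r'))"
  unfolding fill_def
proof (rule runs_for_range[where C = "expr_cost i + expr_cost e + 7"
      and I = "\<lambda>j \<sigma>' \<mu>'. (\<forall>j'<j. \<mu>' a r j' = v) \<and> (\<forall>r'. r' \<noteq> r \<longrightarrow> \<mu>' a r' = \<mu> a r')"])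
  fix j \<sigma>' \<mu>'
  assume "j < N" "\<sigma>' x = j" "unchanged (for_range x h (Put a i (Var x) e)) \<sigma> \<mu> \<sigma>' \<mu>'"
    "(\<forall>j'<j. \<mu>' a r j' = v) \<and> (\<forall>r'. r' \<noteq> r \<longrightarrow> \<mu>' a r' = \<mu> a r')"
  then show "runs (Put a i (Var x) e) \<sigma>' \<mu>' (expr_cost i + expr_cost e + 7)
      (\<lambda>\<sigma>'' \<mu>''. (\<forall>j'<Suc j. \<mu>'' a r j' = v) \<and> (\<forall>r'. r' \<noteq> r \<longrightarrow> \<mu>'' a r' = \<mu> a r'))"
    using exprs[of \<sigma>' \<mu>'] assms(5) by (intro runs_straight) (auto simp: fill_def less_Suc_eq)
qed (use assms in \<open>auto simp: ac_simps\<close>)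

lemma runs_argmax:
  assumes bound: "\<sigma> h = N" "N < 2 ^ w" "distinct [x, h, best, arg]" and "1 < (2::nat) ^ w"
    and exprs: "\<And>j \<sigma>'. j < N \<Longrightarrow> \<sigma>' x = j \<Longrightarrow> (\<And>y. y \<notin> {x, best, arg} \<Longrightarrow> \<sigma>' y = \<sigma> y) \<Longrightarrow>
      safe b \<sigma>' \<mu> \<and> val b \<sigma>' \<mu> = of_bool (P j) \<and> safe e \<sigma>' \<mu> \<and> val e \<sigma>' \<mu> = f j"
    and time: "N * (expr_cost b + 2 * expr_cost e + 15) + 10 \<le> T"
  shows "runs (argmax x h b e best arg) \<sigma> \<mu> T (\<lambda>\<sigma>' \<mu>'. is_argmax N P f (\<sigma>' best) (\<sigma>' arg))"
proof -
  let ?body = "Branch (b \<otimes> (Var best \<prec> e)) (best ::= e;; arg ::= Var x) Skip"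
  let ?\<sigma> = "\<sigma>(best := 0, arg := 0)"
  have "runs (for_range x h ?body) ?\<sigma> \<mu> (N * (expr_cost b + 2 * expr_cost e + 15) + 6)
      (\<lambda>\<sigma>' \<mu>'. is_argmax N P f (\<sigma>' best) (\<sigma>' arg))"
  proof (rule runs_for_range[where C = "expr_cost b + 2 * expr_cost e + 7"
        and I = "\<lambda>j \<sigma>' \<mu>'. is_argmax j P f (\<sigma>' best) (\<sigma>' arg)"])
    fix j \<sigma>1 \<mu>1
    assume j: "j < N" "\<sigma>1 x = j" and same: "unchanged (for_range x h ?body) ?\<sigma> \<mu> \<sigma>1 \<mu>1"
      and inv: "is_argmax j P f (\<sigma>1 best) (\<sigma>1 arg)"
    have "\<mu>1 = \<mu>" using same by (auto simp: unchanged_def)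
    have eval: "safe b \<sigma>1 \<mu>" "val b \<sigma>1 \<mu> = of_bool (P j)" "safe e \<sigma>1 \<mu>" "val e \<sigma>1 \<mu> = f j"
      using exprs[of j \<sigma>1] j same by (auto simp: unchanged_def)
    have "is_argmax (Suc j) P f (f j) j" if "P j" "\<sigma>1 best < f j"
      using inv that by (force simp: is_argmax_def less_Suc_eq)
    moreover have "is_argmax (Suc j) P f (\<sigma>1 best) (\<sigma>1 arg)" if "\<not> (P j \<and> \<sigma>1 best < f j)"
      using inv that by (auto simp: is_argmax_def less_Suc_eq split: if_splits)
    ultimately show "runs ?body \<sigma>1 \<mu>1 (expr_cost b + 2 * expr_cost e + 7)
        (\<lambda>\<sigma>2 \<mu>2. is_argmax (Suc j) P f ((\<sigma>2(x := Suc j)) best) ((\<sigma>2(x := Suc j)) arg))"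
      using eval assms(3,4) j \<open>\<mu>1 = \<mu>\<close> by (intro runs_straight) (auto simp: of_bool_def)
  qed (use bound in \<open>auto simp: is_argmax_def\<close>)
  then show ?thesis
    unfolding argmax_def using time
    by (intro runs_Seq_straight[where T = "N * (expr_cost b + 2 * expr_cost e + 15) + 6"]) simp_all
qed

lemma runs_check_all:
  assumes bound: "\<sigma> h = N" "N < 2 ^ w" "distinct [x, h, flag]" and "1 < (2::nat) ^ w"
    and exprs: "\<And>j \<sigma>'. j < N \<Longrightarrow> \<sigma>' x = j \<Longrightarrow> (\<And>y. y \<notin> {x, flag} \<Longrightarrow> \<sigma>' y = \<sigma> y) \<Longrightarrow>
      safe b \<sigma>' \<mu> \<and> (val b \<sigma>' \<mu> \<noteq> 0 \<longleftrightarrow> P j)"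
    and time: "N * (expr_cost b + 11) + 8 \<le> T"
  shows "runs (check_all flag x h b) \<sigma> \<mu> T (\<lambda>\<sigma>' \<mu>'. \<sigma>' flag = of_bool (\<forall>j<N. \<not> P j))"
proof -
  let ?body = "Branch b (flag ::= Lit 0) Skip"
  have "runs (for_range x h ?body) (\<sigma>(flag := 1)) \<mu> (N * (expr_cost b + 11) + 6)
      (\<lambda>\<sigma>' \<mu>'. \<sigma>' flag = of_bool (\<forall>j<N. \<not> P j))"
  proof (rule runs_for_range[where C = "expr_cost b + 3" and I = "\<lambda>i \<sigma>' \<mu>'. \<sigma>' flag = of_bool (\<forall>j<i. \<not> P j)"])
    fix i \<sigma>1 \<mu>1
    assume i: "i < N" "\<sigma>1 x = i" and same: "unchanged (for_range x h ?body) (\<sigma>(flag := 1)) \<mu> \<sigma>1 \<mu>1"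
      and inv: "\<sigma>1 flag = of_bool (\<forall>j<i. \<not> P j)"
    have "\<mu>1 = \<mu>" using same by (auto simp: unchanged_def)
    moreover have "safe b \<sigma>1 \<mu>" "val b \<sigma>1 \<mu> \<noteq> 0 \<longleftrightarrow> P i"
      using exprs[of i \<sigma>1] i same by (auto simp: unchanged_def)
    ultimately show "runs ?body \<sigma>1 \<mu>1 (expr_cost b + 3)
      (\<lambda>\<sigma>2 \<mu>2. (\<sigma>2(x := Suc i)) flag = of_bool (\<forall>j<Suc i. \<not> P j))"
      using inv bound by (intro runs_straight) (auto simp: less_Suc_eq)
  qed (use bound in auto)
  then show ?thesis
    unfolding check_all_def using time assms(4)
    by (intro runs_Seq_straight[where T = "N * (expr_cost b + 11) + 6"]) simp_all
qed

end

section \<open>Compilation\<close>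

class slotted =
  fixes slot :: "'a \<Rightarrow> nat"
  assumes slot_eq_iff: "slot a = slot b \<longleftrightarrow> a = b"

text \<open>Register \<open>0\<close> holds the row length common to all matrices and register \<open>1\<close> the amount of memory
  set aside for each matrix. The odd registers from \<open>3\<close> on form a stack for the evaluation of
  expressions.\<close>

definition var_reg :: "'v::countable \<Rightarrow> nat" where "var_reg x = 2 * to_nat x + 2"
definition tmp_reg :: "nat \<Rightarrow> nat" where "tmp_reg d = 2 * d + 3"

lemma reg_eq_iff [simp]: "var_reg x = var_reg y \<longleftrightarrow> x = y" "tmp_reg d = tmp_reg d' \<longleftrightarrow> d = d'"
  by (auto simp: var_reg_def tmp_reg_def)

lemma reg_distinct [simp]:
  "var_reg x \<noteq> tmp_reg d" "tmp_reg d \<noteq> var_reg x"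
  "var_reg x \<noteq> 0" "var_reg x \<noteq> 1" "0 \<noteq> var_reg x" "1 \<noteq> var_reg x"
  "tmp_reg d \<noteq> 0" "tmp_reg d \<noteq> 1" "0 \<noteq> tmp_reg d" "1 \<noteq> tmp_reg d"
  by (simp_all add: var_reg_def tmp_reg_def) presburger+

definition address_code :: "'a::slotted \<Rightarrow> nat \<Rightarrow> instr list" where
  "address_code a d =
    [Bin OpMul (tmp_reg d) (tmp_reg d) 0, Bin OpAdd (tmp_reg d) (tmp_reg d) (tmp_reg (Suc d)),
     Const (tmp_reg (Suc d)) (slot a), Bin OpMul (tmp_reg (Suc d)) (tmp_reg (Suc d)) 1,
     Bin OpAdd (tmp_reg d) (tmp_reg d) (tmp_reg (Suc d))]"

fun compile_expr :: "('v::countable, 'a::slotted) expr \<Rightarrow> nat \<Rightarrow> instr list" where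
  "compile_expr (Lit a) d = [Const (tmp_reg d) a]"
| "compile_expr (Var x) d = [Move (tmp_reg d) (var_reg x)]"
| "compile_expr (Cell a i j) d =
    compile_expr i d @ compile_expr j (Suc d) @ address_code a d @ [Load (tmp_reg d) (tmp_reg d)]"
| "compile_expr (Opr f e e') d =
    compile_expr e d @ compile_expr e' (Suc d) @ [Bin f (tmp_reg d) (tmp_reg d) (tmp_reg (Suc d))]"

fun compile :: "('v::countable, 'a::slotted) com \<Rightarrow> instr list" where
  "compile Skip = []"
| "compile (x ::= e) = compile_expr e 0 @ [Move (var_reg x) (tmp_reg 0)]"
| "compile (Put a i j e) = compile_expr i 0 @ compile_expr j 1 @ address_code a 0 @
     compile_expr e 1 @ [Store (tmp_reg 0) (tmp_reg 1)]"
| "compile (c;; c') = compile c @ compile c'"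
| "compile (Branch e c c') = compile_expr e 0 @ [Cond (tmp_reg 0) (compile c) (compile c')]"
| "compile (Loop e c) = compile_expr e 0 @ [While (tmp_reg 0) (compile c @ compile_expr e 0)]"

definition address :: "nat \<Rightarrow> nat \<Rightarrow> 'a::slotted \<Rightarrow> nat \<Rightarrow> nat \<Rightarrow> nat" where
  "address n S a i j = i * n + j + slot a * S"

locale memory_layout = bounded_memory w fits
  for w and fits :: "'a::slotted \<Rightarrow> nat \<Rightarrow> nat \<Rightarrow> bool" +
  fixes row_length slot_size :: nat
  assumes slot_size_pos: "0 < slot_size"
    and address_less: "fits a i j \<Longrightarrow> address row_length slot_size a i j < 2 ^ w"
    and address_inject: "fits a i j \<Longrightarrow> fits a' i' j' \<Longrightarrow>
      address row_length slot_size a i j = address row_length slot_size a' i' j' \<Longrightarrow> a = a' \<and> i = i' \<and> j = j'"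
begin

definition represents :: "ram_state \<Rightarrow> ('v::countable \<Rightarrow> nat) \<Rightarrow> ('a \<Rightarrow> nat \<Rightarrow> nat \<Rightarrow> nat) \<Rightarrow> bool" where
  "represents r \<sigma> \<mu> \<longleftrightarrow> reg r 0 = row_length \<and> reg r 1 = slot_size \<and> (\<forall>x. reg r (var_reg x) = \<sigma> x) \<and>
     (\<forall>a i j. fits a i j \<longrightarrow> mem r (address row_length slot_size a i j) = \<mu> a i j)"

lemma represents_var: "represents r \<sigma> \<mu> \<Longrightarrow> reg r (var_reg x) = \<sigma> x"
  by (simp add: represents_def)

lemma represents_set_tmp: "represents r \<sigma> \<mu> \<Longrightarrow> represents (set_reg (tmp_reg d) a r) \<sigma> \<mu>"
  by (simp add: represents_def set_reg_def)

lemma represents_set_var: "represents r \<sigma> \<mu> \<Longrightarrow> represents (set_reg (var_reg x) a r) (\<sigma>(x := a)) \<mu>"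
  by (simp add: represents_def set_reg_def)

lemma represents_set_mem:
  assumes "represents r \<sigma> \<mu>" "fits a i j"
  shows "represents (set_mem (address row_length slot_size a i j) v r) \<sigma> (put a i j v \<mu>)"
proof -
  have "mem (set_mem (address row_length slot_size a i j) v r) (address row_length slot_size a' i' j') =
      put a i j v \<mu> a' i' j'" if "fits a' i' j'" for a' i' j'
    using assms address_inject[OF that assms(2)] that
    by (auto simp: represents_def set_mem_def put_def)
  then show ?thesis using assms(1) by (simp add: represents_def set_mem_def)
qed

definition evaluates :: "instr list \<Rightarrow> nat \<Rightarrow> nat \<Rightarrow> nat \<Rightarrow> ('v::countable \<Rightarrow> nat) \<Rightarrow>
    ('a \<Rightarrow> nat \<Rightarrow> nat \<Rightarrow> nat) \<Rightarrow> ram_state \<Rightarrow> bool" where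
  "evaluates P t d v \<sigma> \<mu> r \<longleftrightarrow> (\<forall>K. \<exists>r'. represents r' \<sigma> \<mu> \<and> reg r' (tmp_reg d) = v \<and>
     (\<forall>d'<d. reg r' (tmp_reg d') = reg r (tmp_reg d')) \<and> reaches w t (P @ K, r) (K, r'))"

lemma address_code_evaluates:
  assumes r: "represents r \<sigma> \<mu>" "reg r (tmp_reg d) = i" "reg r (tmp_reg (Suc d)) = j" and fit: "fits a i j"
  shows "evaluates (address_code a d) 5 d (address row_length slot_size a i j) \<sigma> \<mu> r"
  unfolding evaluates_def
proof
  fix K
  have bounds: "i * row_length + j + slot a * slot_size < 2 ^ w"
    using address_less[OF fit] by (simp add: address_def)
  moreover have "slot a \<le> slot a * slot_size" using slot_size_pos by simp
  ultimately have "i * row_length < 2 ^ w" "i * row_length + j < 2 ^ w" "slot a * slot_size < 2 ^ w"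
    "slot a < 2 ^ w"
    by linarith+
  with bounds r show "\<exists>r'. represents r' \<sigma> \<mu> \<and> reg r' (tmp_reg d) = address row_length slot_size a i j \<and>
      (\<forall>d'<d. reg r' (tmp_reg d') = reg r (tmp_reg d')) \<and> reaches w 5 (address_code a d @ K, r) (K, r')"
    by (auto simp: address_code_def reaches_instr represents_def address_def set_reg_def)
qed

lemma evaluates_append:
  assumes first: "evaluates P t d' v \<sigma> \<mu> r" and level: "d \<le> d'"
    and second: "\<And>r'. represents r' \<sigma> \<mu> \<Longrightarrow> reg r' (tmp_reg d') = v \<Longrightarrow>
      (\<And>l. l < d' \<Longrightarrow> reg r' (tmp_reg l) = reg r (tmp_reg l)) \<Longrightarrow> evaluates P' t' d v' \<sigma> \<mu> r'"
  shows "evaluates (P @ P') (t + t') d v' \<sigma> \<mu> r"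
  unfolding evaluates_def
proof
  fix K
  obtain r' where r': "represents r' \<sigma> \<mu>" "reg r' (tmp_reg d') = v"
    "\<And>l. l < d' \<Longrightarrow> reg r' (tmp_reg l) = reg r (tmp_reg l)" "reaches w t (P @ P' @ K, r) (P' @ K, r')"
    using first unfolding evaluates_def by meson
  obtain r'' where "represents r'' \<sigma> \<mu>" "reg r'' (tmp_reg d) = v'"
    "\<And>l. l < d \<Longrightarrow> reg r'' (tmp_reg l) = reg r' (tmp_reg l)" "reaches w t' (P' @ K, r') (K, r'')"
    using second[OF r'(1-3)] unfolding evaluates_def by meson
  then show "\<exists>r''. represents r'' \<sigma> \<mu> \<and> reg r'' (tmp_reg d) = v' \<and>
      (\<forall>l<d. reg r'' (tmp_reg l) = reg r (tmp_reg l)) \<and> reaches w (t + t') ((P @ P') @ K, r) (K, r'')"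
    using r'(3) level reaches_trans[OF r'(4)] by (intro exI[of _ r'']) auto
qed

lemma instr_evaluates:
  assumes "represents r \<sigma> \<mu>" "\<And>K. step w (I # K, r) = return_pmf (K, set_reg (tmp_reg d) v r)"
  shows "evaluates [I] 1 d v \<sigma> \<mu> r"
  unfolding evaluates_def using assms represents_set_tmp[OF assms(1)]
  by (auto simp: reaches_step set_reg_def)

lemma cell_address_evaluates:
  assumes i: "\<And>r. represents r \<sigma> \<mu> \<Longrightarrow> evaluates (compile_expr i d) (expr_cost i) d (val i \<sigma> \<mu>) \<sigma> \<mu> r"
    and j: "\<And>r. represents r \<sigma> \<mu> \<Longrightarrow>
      evaluates (compile_expr j (Suc d)) (expr_cost j) (Suc d) (val j \<sigma> \<mu>) \<sigma> \<mu> r"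
    and r: "represents r \<sigma> \<mu>" and fit: "fits a (val i \<sigma> \<mu>) (val j \<sigma> \<mu>)"
  shows "evaluates (compile_expr i d @ compile_expr j (Suc d) @ address_code a d) (expr_cost i + (expr_cost j + 5)) d
    (address row_length slot_size a (val i \<sigma> \<mu>) (val j \<sigma> \<mu>)) \<sigma> \<mu> r"
proof (rule evaluates_append[OF i[OF r] le_refl])
  fix r' assume r': "represents r' \<sigma> \<mu>" "reg r' (tmp_reg d) = val i \<sigma> \<mu>"
  show "evaluates (compile_expr j (Suc d) @ address_code a d) (expr_cost j + 5) d
      (address row_length slot_size a (val i \<sigma> \<mu>) (val j \<sigma> \<mu>)) \<sigma> \<mu> r'"
    by (rule evaluates_append[OF j[OF r'(1)]]) (use r' in \<open>auto intro: address_code_evaluates fit\<close>)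
qed

lemma compile_expr_evaluates:
  assumes "represents r \<sigma> \<mu>" "safe e \<sigma> \<mu>"
  shows "evaluates (compile_expr e d) (expr_cost e) d (val e \<sigma> \<mu>) \<sigma> \<mu> r"
  using assms
proof (induction e arbitrary: r d)
  case (Lit a)
  then show ?case by (auto intro!: instr_evaluates)
next
  case (Var x)
  then show ?case by (auto intro!: instr_evaluates simp: represents_var)
next
  case (Cell a i j)
  then have "evaluates
      ((compile_expr i d @ compile_expr j (Suc d) @ address_code a d) @ [Load (tmp_reg d) (tmp_reg d)])
      (expr_cost i + (expr_cost j + 5) + 1) d (val (Cell a i j) \<sigma> \<mu>) \<sigma> \<mu> r"
    by (intro evaluates_append[OF cell_address_evaluates] instr_evaluates) (auto simp: represents_def)
  then show ?case by (simp add: add.assoc)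
next
  case (Opr f e e')
  have "evaluates (compile_expr e d @ compile_expr e' (Suc d) @ [Bin f (tmp_reg d) (tmp_reg d) (tmp_reg (Suc d))])
      (expr_cost e + (expr_cost e' + 1)) d (val (Opr f e e') \<sigma> \<mu>) \<sigma> \<mu> r"
    using Opr.prems by (intro evaluates_append[OF Opr.IH(1) le_refl] evaluates_append[OF Opr.IH(2)] instr_evaluates)
      (auto simp: eval_op_fits)
  then show ?case by (simp add: add.assoc)
qed

lemma compile_expr_reaches:
  assumes "represents r \<sigma> \<mu>" "safe e \<sigma> \<mu>"
  obtains r' where "represents r' \<sigma> \<mu>" "reg r' (tmp_reg d) = val e \<sigma> \<mu>"
    "\<And>l. l < d \<Longrightarrow> reg r' (tmp_reg l) = reg r (tmp_reg l)"
    "reaches w (expr_cost e) (compile_expr e d @ K, r) (K, r')"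
  using compile_expr_evaluates[OF assms, of d] unfolding evaluates_def by meson

lemma compile_expr_step:
  assumes r: "represents r \<sigma> \<mu>" and e: "safe e \<sigma> \<mu>"
    and step: "\<And>r'. reg r' (tmp_reg 0) = val e \<sigma> \<mu> \<Longrightarrow> step w (I # K, r') = return_pmf (K', f r')"
  obtains r' where "represents r' \<sigma> \<mu>" "reaches w (expr_cost e + 1) (compile_expr e 0 @ I # K, r) (K', f r')"
proof -
  obtain r' where r': "represents r' \<sigma> \<mu>" "reg r' (tmp_reg 0) = val e \<sigma> \<mu>"
    "reaches w (expr_cost e) (compile_expr e 0 @ I # K, r) (I # K, r')"
    using compile_expr_reaches[OF r e, of 0 "I # K"] by blast
  have "reaches w 1 (I # K, r') (K', f r')"
    using step[OF r'(2)] by (simp add: reaches_step)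
  then show thesis using that[OF r'(1)] reaches_trans[OF r'(3)] by blast
qed

lemma compile_Put_reaches:
  assumes r: "represents r \<sigma> \<mu>" and safe: "safe (Cell a i j) \<sigma> \<mu>" "safe e \<sigma> \<mu>"
  shows "\<exists>r'. represents r' \<sigma> (put a (val i \<sigma> \<mu>) (val j \<sigma> \<mu>) (val e \<sigma> \<mu>) \<mu>) \<and>
    reaches w (expr_cost i + expr_cost j + expr_cost e + 6) (compile (Put a i j e) @ K, r) (K, r')"
proof -
  let ?addr = "address row_length slot_size a (val i \<sigma> \<mu>) (val j \<sigma> \<mu>)"
  have fit: "fits a (val i \<sigma> \<mu>) (val j \<sigma> \<mu>)" using safe(1) by simp
  define P where "P = compile_expr e 1 @ Store (tmp_reg 0) (tmp_reg 1) # K"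
  have "evaluates (compile_expr i 0 @ compile_expr j 1 @ address_code a 0) (expr_cost i + (expr_cost j + 5)) 0
      ?addr \<sigma> \<mu> r"
    unfolding One_nat_def by (rule cell_address_evaluates) (use safe r compile_expr_evaluates in auto)
  then obtain r1 where r1: "represents r1 \<sigma> \<mu>" "reg r1 (tmp_reg 0) = ?addr"
    "reaches w (expr_cost i + (expr_cost j + 5)) (compile (Put a i j e) @ K, r) (P, r1)"
    unfolding evaluates_def P_def by auto
  obtain r2 where r2: "represents r2 \<sigma> \<mu>" "reg r2 (tmp_reg 1) = val e \<sigma> \<mu>" "reg r2 (tmp_reg 0) = ?addr"
    "reaches w (expr_cost e) (P, r1) (Store (tmp_reg 0) (tmp_reg 1) # K, r2)"
    using compile_expr_reaches[OF r1(1) safe(2), of 1] r1(2) unfolding P_def by (metis less_numeral_extra(1))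
  have "reaches w 1 (Store (tmp_reg 0) (tmp_reg 1) # K, r2) (K, set_mem ?addr (val e \<sigma> \<mu>) r2)"
    using r2 by (simp add: reaches_instr)
  from reaches_trans[OF r1(3) reaches_trans[OF r2(4) this]]
  show ?thesis using represents_set_mem[OF r2(1) fit] by (auto simp: ac_simps)
qed

lemma compile_Branch_reaches:
  assumes "represents r \<sigma> \<mu>" "safe e \<sigma> \<mu>"
  obtains r' where "represents r' \<sigma> \<mu>"
    "reaches w (expr_cost e + 1) (compile (Branch e c c') @ K, r) (compile (if val e \<sigma> \<mu> \<noteq> 0 then c else c') @ K, r')"
proof (rule compile_expr_step[OF assms])
  fix r' :: ram_state assume "reg r' (tmp_reg 0) = val e \<sigma> \<mu>"
  then show "step w (Cond (tmp_reg 0) (compile c) (compile c') # K, r') =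
      return_pmf (compile (if val e \<sigma> \<mu> \<noteq> 0 then c else c') @ K, id r')"
    by simp
qed (use that in simp)

lemma compile_Loop_reaches:
  assumes "represents r \<sigma> \<mu>" "safe e \<sigma> \<mu>"
  obtains r' where "represents r' \<sigma> \<mu>"
    "reaches w (expr_cost e + 1) (compile (Loop e c) @ K, r)
       ((if val e \<sigma> \<mu> \<noteq> 0 then compile (c;; Loop e c) else []) @ K, r')"
proof (rule compile_expr_step[OF assms])
  let ?body = "compile c @ compile_expr e 0"
  fix r' :: ram_state assume "reg r' (tmp_reg 0) = val e \<sigma> \<mu>"
  then show "step w (While (tmp_reg 0) ?body # K, r') =
      return_pmf ((if val e \<sigma> \<mu> \<noteq> 0 then compile (c;; Loop e c) else []) @ K, id r')"
    by simp
qed (use that in simp)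

theorem compile_reaches:
  assumes "exec c \<sigma> \<mu> t \<sigma>' \<mu>'" "represents r \<sigma> \<mu>"
  shows "\<exists>r'. represents r' \<sigma>' \<mu>' \<and> reaches w t (compile c @ K, r) (K, r')"
  using assms
proof (induction arbitrary: r K)
  case (exec_Skip \<sigma> \<mu>)
  then show ?case by auto
next
  case (exec_Assign e \<sigma> \<mu> x)
  then obtain r' where "represents r' \<sigma> \<mu>"
    "reaches w (expr_cost e + 1) (compile (x ::= e) @ K, r) (K, set_reg (var_reg x) (val e \<sigma> \<mu>) r')"
    using compile_expr_step[of r \<sigma> \<mu> e "Move (var_reg x) (tmp_reg 0)" K K "set_reg (var_reg x) (val e \<sigma> \<mu>)"]
    by auto
  then show ?case using represents_set_var by blast
next
  case (exec_Put a i j \<sigma> \<mu> e)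
  then show ?case by (intro compile_Put_reaches)
next
  case (exec_Seq c \<sigma> \<mu> t \<sigma>' \<mu>' c' t' \<sigma>'' \<mu>'')
  obtain r' where r': "represents r' \<sigma>' \<mu>'" "reaches w t (compile c @ compile c' @ K, r) (compile c' @ K, r')"
    using exec_Seq by blast
  with exec_Seq.IH(2)[OF r'(1), of K] show ?case using reaches_trans by fastforce
next
  case (exec_Branch e \<sigma> \<mu> c c' t \<sigma>' \<mu>')
  let ?c = "if val e \<sigma> \<mu> \<noteq> 0 then c else c'"
  obtain r' where r': "represents r' \<sigma> \<mu>"
    "reaches w (expr_cost e + 1) (compile (Branch e c c') @ K, r) (compile ?c @ K, r')"
    using compile_Branch_reaches[OF exec_Branch.prems exec_Branch.hyps(1)] by blast
  with exec_Branch.IH[OF r'(1), of K] show ?case using reaches_trans by blast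
next
  case (exec_Loop_end e \<sigma> \<mu> c)
  show ?case
    using compile_Loop_reaches[OF exec_Loop_end.prems exec_Loop_end.hyps(1), of c K] exec_Loop_end.hyps(2)
    by auto
next
  case (exec_Loop_step e \<sigma> \<mu> c t \<sigma>' \<mu>' t' \<sigma>'' \<mu>'')
  let ?loop = "compile (Loop e c)"
  obtain r1 where r1: "represents r1 \<sigma> \<mu>"
    "reaches w (expr_cost e + 1) (?loop @ K, r) (compile c @ ?loop @ K, r1)"
    using compile_Loop_reaches[OF exec_Loop_step.prems exec_Loop_step.hyps(1), of c K] exec_Loop_step.hyps(2)
    by auto
  obtain r2 where r2: "represents r2 \<sigma>' \<mu>'" "reaches w t (compile c @ ?loop @ K, r1) (?loop @ K, r2)"
    using exec_Loop_step.IH(1)[OF r1(1)] by blast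
  obtain r3 where "represents r3 \<sigma>'' \<mu>''" "reaches w t' (?loop @ K, r2) (K, r3)"
    using exec_Loop_step.IH(2)[OF r2(1)] by blast
  then show ?case using reaches_trans[OF reaches_trans[OF r1(2) r2(2)]] by blast
qed

end

section \<open>Graph distances\<close>

lemma gdist_attained:
  assumes "gdist E u v = enat r"
  obtains p where "walk E p" "hd p = u" "last p = v" "length p = Suc r"
proof -
  let ?lengths = "(\<lambda>p. enat (length p - 1)) ` {p. walk E p \<and> hd p = u \<and> last p = v}"
  have inf: "Inf ?lengths = enat r" using assms by (simp add: gdist_def)
  then have "?lengths \<noteq> {}" unfolding Inf_enat_def by (metis enat.distinct(1))
  then have "Inf ?lengths \<in> ?lengths"
    unfolding Inf_enat_def by (metis (mono_tags, lifting) LeastI ex_in_conv)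
  then obtain p where p: "walk E p" "hd p = u" "last p = v" "length p - 1 = r"
    using inf by auto
  then have "length p = Suc r" by (cases p) (auto simp: walk_def)
  with p that show thesis by blast
qed

lemma gdist_le_walk: "walk E p \<Longrightarrow> hd p = u \<Longrightarrow> last p = v \<Longrightarrow> gdist E u v \<le> enat (length p - 1)"
  unfolding gdist_def by (rule INF_lower) auto

lemma gdist_refl [simp]: "gdist E u u = 0"
  using gdist_le_walk[of E "[u]" u u] by (simp add: walk_def flip: zero_enat_def)

lemma gdist_commute_le: "gdist E u v \<le> gdist E v u"
proof (cases "gdist E v u")
  case (enat r)
  then obtain p where p: "walk E p" "hd p = v" "last p = u" "length p = Suc r"
    by (rule gdist_attained)
  have "walk E (rev p)"
    using p(1) by (auto simp: walk_def successively_rev insert_commute)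
  then show ?thesis
    using gdist_le_walk[of E "rev p" u v] p enat by (simp add: hd_rev last_rev walk_def)
qed simp

lemma gdist_commute: "gdist E u v = gdist E v u"
  by (rule antisym; rule gdist_commute_le)

lemma gdist_triangle: "gdist E u x \<le> gdist E u v + gdist E v x"
proof (cases "gdist E u v = \<infinity> \<or> gdist E v x = \<infinity>")
  case False
  then obtain a b where dist: "gdist E u v = enat a" "gdist E v x = enat b" by auto
  obtain p where p: "walk E p" "hd p = u" "last p = v" "length p = Suc a"
    using dist(1) by (rule gdist_attained)
  obtain p' where p': "walk E p'" "hd p' = v" "last p' = x" "length p' = Suc b"
    using dist(2) by (rule gdist_attained)
  obtain rest where rest: "p' = v # rest" using p' by (cases p') (auto simp: walk_def)
  have "walk E (p @ rest)" "hd (p @ rest) = u" "last (p @ rest) = x"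
    using p p' by (auto simp: rest walk_def successively_append_iff successively_Cons split: if_splits)
  then show ?thesis
    using gdist_le_walk[of E "p @ rest" u x] p p' dist by (simp add: rest)
qed auto

lemma gdist_edge: "{u, v} \<in> E \<Longrightarrow> gdist E u v \<le> 1"
  using gdist_le_walk[of E "[u, v]" u v] by (simp add: walk_def one_enat_def One_nat_def)

lemma gdist_eq_0D: "gdist E u v = enat 0 \<Longrightarrow> u = v"
  by (elim gdist_attained) (auto simp: length_Suc_conv)

lemma gdist_eq_1D:
  assumes "gdist E u v = enat 1"
  shows "{u, v} \<in> E"
proof -
  obtain p where p: "walk E p" "hd p = u" "last p = v" "length p = Suc (Suc 0)"
    using gdist_attained[OF assms] by (auto simp: One_nat_def)
  then obtain a b where "p = [a, b]" by (auto simp: length_Suc_conv)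
  with p show ?thesis by (simp add: walk_def)
qed

lemma gdist_walk_nth:
  assumes p: "walk E p" "hd p = u" "last p = v" and y: "y < length p"
  shows "gdist E u (p ! y) \<le> enat y" "gdist E (p ! y) v \<le> enat (length p - 1 - y)"
proof -
  have ne: "p \<noteq> []" using y by auto
  have "walk E (take (Suc y) p)" "walk E (drop y p)"
    using p(1) y by (auto simp: walk_def successively_conv_nth)
  moreover have "hd (take (Suc y) p) = u" "last (take (Suc y) p) = p ! y"
    using p(2) ne y by (simp_all add: take_Suc_conv_app_nth hd_append hd_conv_nth)
  moreover have "hd (drop y p) = p ! y" "last (drop y p) = v"
    using p(3) y by (simp_all add: hd_drop_conv_nth last_drop)
  moreover have "length (take (Suc y) p) - 1 = y" "length (drop y p) - 1 = length p - 1 - y"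
    using y by (auto simp: min_def)
  ultimately show "gdist E u (p ! y) \<le> enat y" "gdist E (p ! y) v \<le> enat (length p - 1 - y)"
    using gdist_le_walk[of E "take (Suc y) p" u "p ! y"] gdist_le_walk[of E "drop y p" "p ! y" v] by simp_all
qed

locale graph =
  fixes n :: nat and E :: "nat set set"
  assumes simple: "simple_graph n E" and n_pos: "1 \<le> n"
begin

lemma edge_less: "{u, v} \<in> E \<Longrightarrow> u < n" "{u, v} \<in> E \<Longrightarrow> v < n"
  using simple by (auto simp: simple_graph_def doubleton_eq_iff)

lemma walk_nth_less:
  assumes "walk E p" "hd p < n" "y < length p"
  shows "p ! y < n"
proof (cases y)
  case 0
  then show ?thesis using assms by (simp add: hd_conv_nth flip: length_greater_0_conv)
next
  case (Suc j)
  then have "{p ! j, p ! y} \<in> E"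
    using assms(1,3) unfolding walk_def successively_conv_nth by auto
  then show ?thesis by (rule edge_less)
qed

lemma gdist_geodesic:
  assumes "u < n" "gdist E u v = enat r" "y \<le> r"
  obtains x where "x < n" "gdist E u x = enat y" "gdist E x v = enat (r - y)"
proof -
  obtain p where p: "walk E p" "hd p = u" "last p = v" "length p = Suc r"
    using assms by (elim gdist_attained)
  have near: "gdist E u (p ! y) \<le> enat y" "gdist E (p ! y) v \<le> enat (r - y)"
    using gdist_walk_nth[OF p(1-3), of y] p(4) assms(3) by simp_all
  then obtain a b where ab: "gdist E u (p ! y) = enat a" "gdist E (p ! y) v = enat b"
    by (metis enat_ile)
  have "enat r \<le> gdist E u (p ! y) + gdist E (p ! y) v"
    using gdist_triangle[of E u v "p ! y"] assms(2) by simp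
  then have "a = y" "b = r - y" using near ab assms(3) by auto
  then show thesis
    using ab walk_nth_less[OF p(1)] p assms by (intro that[of "p ! y"]) auto
qed

lemma gdist_finite_less:
  assumes "u < n" "gdist E u v = enat r"
  shows "r < n"
proof -
  have "\<forall>y\<in>{..r}. \<exists>x. x < n \<and> gdist E u x = enat y"
    using assms by (auto elim: gdist_geodesic)
  then obtain f where f: "\<And>y. y \<le> r \<Longrightarrow> f y < n \<and> gdist E u (f y) = enat y"
    by (metis atMost_iff)
  have "inj_on f {..r}"
    by (rule inj_onI) (metis f atMost_iff enat.inject)
  moreover have "f ` {..r} \<subseteq> {..<n}" using f by auto
  ultimately have "card {..r} \<le> card {..<n}" by (metis card_inj_on_le finite_lessThan)
  then show ?thesis by simp
qed

text \<open>The value \<open>2 * n\<close> stands for \<open>\<infinity>\<close>; it is large enough to keep the triangle inequality.\<close>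

definition d :: "nat \<Rightarrow> nat \<Rightarrow> nat" where
  "d u v = (case gdist E u v of enat r \<Rightarrow> r | \<infinity> \<Rightarrow> 2 * n)"

lemma d_self [simp]: "d u u = 0"
  by (simp add: d_def zero_enat_def)

lemma d_commute: "d u v = d v u"
  by (simp add: d_def gdist_commute)

lemma d_less_or_infinite: "u < n \<Longrightarrow> d u v < n \<or> d u v = 2 * n"
  by (cases "gdist E u v") (auto simp: d_def dest: gdist_finite_less)

lemma d_le_infinite: "u < n \<Longrightarrow> d u v \<le> 2 * n"
  using d_less_or_infinite[of u v] by auto

lemma d_triangle: "u < n \<Longrightarrow> d u x \<le> d u v + d v x"
  using gdist_triangle[of E u x v] d_le_infinite[of u x]
  by (auto simp: d_def split: enat.splits)

lemma d_le_iff_gdist_le: "r < 2 * n \<Longrightarrow> d u v \<le> r \<longleftrightarrow> gdist E u v \<le> enat r"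
  by (auto simp: d_def split: enat.splits)

lemma d_geodesic:
  assumes "u < n" "d u v < 2 * n" "y \<le> d u v"
  obtains x where "x < n" "d u x = y" "d x v = d u v - y"
proof (cases "gdist E u v")
  case (enat r)
  then have "y \<le> r" using assms(3) by (simp add: d_def)
  from gdist_geodesic[OF assms(1) enat this] obtain x
    where "x < n" "gdist E u x = enat y" "gdist E x v = enat (r - y)" .
  then show thesis using enat that[of x] by (simp add: d_def)
qed (use assms in \<open>simp add: d_def\<close>)

lemma d_edge: "{u, v} \<in> E \<Longrightarrow> d u v \<le> 1"
  using gdist_edge[of u v E] by (auto simp: d_def one_enat_def split: enat.splits)

lemma d_eq_0_iff: "d u v = 0 \<longleftrightarrow> u = v"
  using n_pos gdist_eq_0D[of E u v] by (auto simp: d_def zero_enat_def split: enat.splits)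

lemma d_predecessor:
  assumes "u < n" "d u v = Suc r" "Suc r < 2 * n"
  obtains x where "x < n" "d u x = r" "{x, v} \<in> E"
proof -
  have "r \<le> d u v" "d u v - r = 1" "d u v < 2 * n" using assms by simp_all
  then obtain x where x: "x < n" "d u x = r" "d x v = 1"
    using d_geodesic[OF assms(1), of v r] by metis
  have "gdist E x v = enat 1"
    using x d_less_or_infinite[OF x(1), of v] by (cases "gdist E x v") (auto simp: d_def)
  then show thesis using that x gdist_eq_1D by blast
qed

end

section \<open>Replacing optimal centers one by one\<close>

definition approx_radius :: "nat \<Rightarrow> nat \<Rightarrow> nat" where
  "approx_radius k R = 2 * R - R div (2 * k - 1)"

text \<open>\<open>S\<close> is the hitting set, \<open>N v\<close> the table row of vertices near \<open>v\<close>, and \<open>dS\<close> the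
  distance to \<open>S\<close>.\<close>

locale radius_guess = graph +
  fixes k :: nat and S :: "nat set" and N :: "nat \<Rightarrow> nat set" and dS :: "nat \<Rightarrow> nat" and R :: nat
  assumes k_pos: "1 \<le> k" and R_less: "R < n"
    and S_less: "\<And>s. s \<in> S \<Longrightarrow> s < n"
    and N_less: "\<And>v x. v < n \<Longrightarrow> x \<in> N v \<Longrightarrow> x < n"
    and N_nonempty: "\<And>v. v < n \<Longrightarrow> N v \<noteq> {}"
    and dS_le: "\<And>v s. v < n \<Longrightarrow> s \<in> S \<Longrightarrow> dS v \<le> d v s"
    and dS_le_infinite: "\<And>v. v < n \<Longrightarrow> dS v \<le> 2 * n"
    and dS_attained: "\<And>v. v < n \<Longrightarrow> dS v < 2 * n \<Longrightarrow> \<exists>s\<in>S. d v s = dS v"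
    and ball_subset_N: "\<And>v r x. v < n \<Longrightarrow> r < 2 * n \<Longrightarrow> r < dS v \<Longrightarrow> x < n \<Longrightarrow> d v x \<le> r \<Longrightarrow> x \<in> N v"
    and dS_eq_0: "\<And>v. v < n \<Longrightarrow> k = 1 \<Longrightarrow> dS v = 0"
begin

definition h :: nat where "h = R div (2 * k - 1)"
definition D :: nat where "D = approx_radius k R"
definition \<rho> :: nat where "\<rho> = (R - h) div 2"

lemma D_eq: "D = 2 * R - h"
  by (simp add: D_def h_def approx_radius_def)

lemma odd_multiple_h_le:
  assumes "i < k"
  shows "2 * i * h + h \<le> R"
proof -
  have "(2 * i + 1) * h \<le> (2 * k - 1) * h" using assms by (intro mult_le_mono1) simp
  also have "\<dots> \<le> R" by (simp add: h_def)
  finally show ?thesis by (simp add: algebra_simps)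
qed

lemma h_le: "h \<le> R"
  using odd_multiple_h_le[of 0] k_pos by simp

definition beyond :: "nat \<Rightarrow> nat set \<Rightarrow> nat set" where
  "beyond t A = {v. v < n \<and> (\<forall>x\<in>A. t < d x v)}"

lemma beyond_anti_mono: "t \<le> t' \<Longrightarrow> beyond t' A \<subseteq> beyond t A"
  by (auto simp: beyond_def)

definition covers :: "nat set \<Rightarrow> nat set \<Rightarrow> bool" where
  "covers C V \<longleftrightarrow> (\<forall>v\<in>V. \<exists>c\<in>C. d v c \<le> R)"

lemma covers_mono: "covers C V \<Longrightarrow> C \<subseteq> C' \<Longrightarrow> V' \<subseteq> V \<Longrightarrow> covers C' V'"
  unfolding covers_def by blast

lemma covers_Diff_replaced:
  assumes C: "covers C (beyond t A)" and x: "x < n" "d x c \<le> e" and t: "t \<le> t'" "R + e \<le> t'"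
  shows "covers (C - {c}) (beyond t' (insert x A))"
  unfolding covers_def
proof
  fix v assume v: "v \<in> beyond t' (insert x A)"
  then have "v \<in> beyond t A" using t(1) by (auto simp: beyond_def)
  then obtain c' where c': "c' \<in> C" "d v c' \<le> R" using C by (auto simp: covers_def)
  have "d x v \<le> d x c' + d c' v" by (rule d_triangle[OF x(1)])
  moreover have "R + e < d x v" using v t(2) by (auto simp: beyond_def)
  ultimately have "c' \<noteq> c" using c' x(2) d_commute[of v c'] by auto
  then show "\<exists>c\<in>C - {c}. d v c \<le> R" using c' by blast
qed

text \<open>When \<open>i\<close> vertices \<open>A\<close> have been chosen, they can be completed to \<open>k\<close> centers within radius \<open>D\<close>:
  in the first case the missing centers need only be looked up in \<open>S\<close>, in the second they are still
  arbitrary.\<close>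

definition near_completable :: "nat \<Rightarrow> nat set \<Rightarrow> bool" where
  "near_completable i A \<longleftrightarrow> (\<exists>C\<subseteq>{..<n}. card C \<le> k - i \<and> covers C (beyond D A) \<and>
     (Suc i < k \<longrightarrow> (\<forall>c\<in>C. dS c \<le> R - h)))"

definition far_completable :: "nat \<Rightarrow> nat set \<Rightarrow> bool" where
  "far_completable i A \<longleftrightarrow> (\<exists>C\<subseteq>{..<n}. card C \<le> k - i \<and> covers C (beyond (R + 2 * i * h - h) A))"

definition completable :: "nat \<Rightarrow> nat set \<Rightarrow> bool" where
  "completable i A \<longleftrightarrow> near_completable i A \<or> far_completable i A"

lemma card_Diff_singleton_le: "card C \<le> k - i \<Longrightarrow> c \<in> C \<Longrightarrow> C \<subseteq> {..<n} \<Longrightarrow> card (C - {c}) \<le> k - Suc i"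
  using finite_subset[of C "{..<n}"] by simp

lemma near_completable_step:
  assumes "near_completable i A" "Suc i < k" "w < n"
  shows "\<exists>x\<in>S \<union> N w. near_completable (Suc i) (insert x A)"
proof -
  obtain C where C: "C \<subseteq> {..<n}" "card C \<le> k - i" "covers C (beyond D A)" "\<forall>c\<in>C. dS c \<le> R - h"
    using assms(1,2) unfolding near_completable_def by blast
  show ?thesis
  proof (cases "C = {}")
    case True
    obtain x where "x \<in> N w" using N_nonempty assms(3) by blast
    moreover have "near_completable (Suc i) (insert x A)"
      unfolding near_completable_def using C(3) True
      by (intro exI[of _ "{}"]) (auto simp: covers_def beyond_def)
    ultimately show ?thesis by blast
  next
    case False
    then obtain c where c: "c \<in> C" by blast
    then have "c < n" "dS c \<le> R - h" using C by auto
    then obtain s where s: "s \<in> S" "d c s = dS c" using dS_attained R_less by fastforce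
    have "s < n" using S_less s(1) by blast
    then have "covers (C - {c}) (beyond D (insert s A))"
      using C(3) \<open>dS c \<le> R - h\<close> s(2) h_le
      by (intro covers_Diff_replaced[where e = "R - h"]) (auto simp: D_eq d_commute[of s c])
    then have "near_completable (Suc i) (insert s A)"
      unfolding near_completable_def using C c card_Diff_singleton_le
      by (intro exI[of _ "C - {c}"]) auto
    then show ?thesis using s(1) by blast
  qed
qed

lemma far_completable_cases:
  assumes "far_completable i A" "Suc i < k"
  obtains "near_completable i A"
  | c v where "c < n" "R - h < dS c" "v \<in> beyond D A" "d v c \<le> R"
proof -
  obtain C where C: "C \<subseteq> {..<n}" "card C \<le> k - i" "covers C (beyond (R + 2 * i * h - h) A)"
    using assms(1) unfolding far_completable_def by blast
  \<comment> \<open>Centers that cover nothing new can be dropped.\<close>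
  define C' where "C' = {c\<in>C. \<exists>v\<in>beyond D A. d v c \<le> R}"
  show thesis
  proof (cases "\<forall>c\<in>C'. dS c \<le> R - h")
    case True
    have "R + 2 * i * h - h \<le> D"
      using odd_multiple_h_le[of i] assms(2) by (simp add: D_eq)
    then have "covers C' (beyond D A)"
      using C(3) beyond_anti_mono[of _ D A] unfolding covers_def C'_def by blast
    moreover have "C' \<subseteq> C" "card C' \<le> card C"
      using C(1) finite_subset[of C "{..<n}"] by (auto simp: C'_def intro: card_mono)
    ultimately have "near_completable i A"
      unfolding near_completable_def using True C by (intro exI[of _ C']) auto
    then show thesis by (rule that(1))
  next
    case False
    then show thesis using that(2) C(1) by (auto simp: C'_def not_le)
  qed
qed

lemma dS_le_d_plus:
  assumes "u < n" "v < n"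
  shows "dS u \<le> d u v + dS v"
proof (cases "dS v < 2 * n")
  case True
  then obtain s where "s \<in> S" "d v s = dS v" using dS_attained assms(2) by blast
  then show ?thesis using dS_le[OF assms(1)] d_triangle[OF assms(1), of s v] by fastforce
next
  case False
  then show ?thesis using dS_le_infinite[OF assms(1)] by simp
qed

text \<open>A point on the way from a far optimal center to a vertex it covers is far both from the
  chosen vertices and from \<open>S\<close>.\<close>

lemma uncovered_far_vertex:
  assumes i: "i < k" and A: "A \<subseteq> {..<n}"
    and c: "c < n" "R - h < dS c" and v: "v \<in> beyond D A" "d v c \<le> R"
  shows "\<exists>x\<in>beyond (R + 2 * i * h - h) A. R - h < 2 * i * h + dS x"
proof -
  have "d c v < 2 * n" using v(2) R_less by (simp add: d_commute)
  then obtain x where x: "x < n" "d c x = min (2 * i * h) (d c v)" "d x v = d c v - min (2 * i * h) (d c v)"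
    using d_geodesic[OF c(1), of v "min (2 * i * h) (d c v)"] by auto
  have "R + 2 * i * h - h < d a x" if "a \<in> A" for a
  proof -
    have "D < d a x + d x v"
      using v(1) that A d_triangle[of a v x] by (fastforce simp: beyond_def)
    then show ?thesis
      using x v(2) odd_multiple_h_le[OF i] h_le by (auto simp: D_eq d_commute[of v c] min_def split: if_splits)
  qed
  then have "x \<in> beyond (R + 2 * i * h - h) A" using x by (simp add: beyond_def)
  moreover have "R - h < 2 * i * h + dS x"
    using c(2) x dS_le_d_plus[OF c(1) x(1)] by simp
  ultimately show ?thesis by blast
qed

lemma far_completable_extend:
  assumes "far_completable i A" "Suc i < k" "w \<in> beyond (R + 2 * i * h - h) A" "R - h < 2 * i * h + dS w"
  shows "\<exists>x\<in>N w. far_completable (Suc i) (insert x A)"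
proof -
  have bounds: "2 * Suc i * h + h \<le> R" "2 * i * h + h \<le> R"
    using odd_multiple_h_le[of "Suc i"] odd_multiple_h_le[of i] assms(2) by simp_all
  obtain C where C: "C \<subseteq> {..<n}" "card C \<le> k - i" "covers C (beyond (R + 2 * i * h - h) A)"
    using assms(1) unfolding far_completable_def by blast
  have w: "w < n" using assms(3) by (simp add: beyond_def)
  obtain c where c: "c \<in> C" "d w c \<le> R" using C(3) assms(3) by (auto simp: covers_def)
  let ?y = "min (R - h - 2 * i * h) (d w c)"
  obtain x where x: "x < n" "d w x = ?y" "d x c = d w c - ?y"
    using d_geodesic[OF w, of c ?y] c R_less by auto
  have "R - h - 2 * i * h < dS w" using assms(4) bounds(2) by linarith
  then have "x \<in> N w"
    using x(2) R_less by (intro ball_subset_N[OF w _ _ x(1), where r = "R - h - 2 * i * h"]) auto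
  have "d x c \<le> 2 * i * h + h" using x(3) c(2) bounds by (auto simp: min_def)
  then have "covers (C - {c}) (beyond (R + 2 * Suc i * h - h) (insert x A))"
    using C(3) x(1) by (intro covers_Diff_replaced[where e = "2 * i * h + h"]) auto
  then have "far_completable (Suc i) (insert x A)"
    unfolding far_completable_def using C c(1) card_Diff_singleton_le by (intro exI[of _ "C - {c}"]) auto
  then show ?thesis using \<open>x \<in> N w\<close> by blast
qed

lemma completable_step:
  assumes "completable i A" "Suc i < k" "A \<subseteq> {..<n}" "w < n"
    and farthest: "\<And>x. x \<in> beyond (R + 2 * i * h - h) A \<Longrightarrow> w \<in> beyond (R + 2 * i * h - h) A \<and> dS x \<le> dS w"
  shows "\<exists>x\<in>S \<union> N w. completable (Suc i) (insert x A)"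
proof (cases "near_completable i A")
  case True
  from near_completable_step[OF this assms(2,4)] show ?thesis by (auto simp: completable_def)
next
  case False
  then have far: "far_completable i A" using assms(1) by (simp add: completable_def)
  then obtain c v where "c < n" "R - h < dS c" "v \<in> beyond D A" "d v c \<le> R"
    using far_completable_cases[OF far assms(2)] False by blast
  then obtain x where "x \<in> beyond (R + 2 * i * h - h) A" "R - h < 2 * i * h + dS x"
    using uncovered_far_vertex[of i A c v] assms(2,3) by auto
  then have "w \<in> beyond (R + 2 * i * h - h) A" "R - h < 2 * i * h + dS w"
    using farthest[of x] by auto
  from far_completable_extend[OF far assms(2) this] show ?thesis
    by (auto simp: completable_def)
qed

lemma completable_last:
  assumes "completable i A" "Suc i = k"
  shows "\<exists>c<n. covers {c} (beyond D A)"
proof -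
  have "R + 2 * i * h - h \<le> D" using odd_multiple_h_le[of i] assms(2) by (simp add: D_eq)
  then have "beyond D A \<subseteq> beyond (R + 2 * i * h - h) A" by (rule beyond_anti_mono)
  moreover have "k - i = 1" using assms(2) by simp
  ultimately have "\<exists>C\<subseteq>{..<n}. card C \<le> 1 \<and> covers C (beyond D A)"
    using assms(1) covers_mono[OF _ order_refl]
    unfolding completable_def near_completable_def far_completable_def by metis
  then obtain C where C: "C \<subseteq> {..<n}" "card C \<le> 1" "covers C (beyond D A)" by blast
  then obtain c where "c < n" "C \<subseteq> {c}"
    using n_pos finite_subset[OF C(1)] by (cases "C = {}") (auto simp: card_le_Suc0_iff_eq One_nat_def)
  then show ?thesis using covers_mono[OF C(3)] by blast
qed

lemma covers_singleton: "covers {c} V \<longleftrightarrow> (\<forall>v\<in>V. d v c \<le> R)"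
  by (simp add: covers_def)

lemma last_center_near_complete:
  assumes "c < n" "covers {c} (beyond D A)" "z \<in> beyond D A" "d z s \<le> \<rho>"
  shows "d c s \<le> R + \<rho>"
  using d_triangle[OF assms(1), of s z] assms by (auto simp: covers_singleton d_commute[of c z])

lemma last_center_near_sound:
  assumes "u < n" "d z s \<le> \<rho>" "d u s \<le> R + \<rho>"
  shows "d u z \<le> D"
  using d_triangle[OF assms(1), of z s] assms h_le
  by (auto simp: D_eq \<rho>_def d_commute[of s z])

lemma last_center_far:
  assumes c: "c < n" "covers {c} (beyond D A)" and w: "w \<in> beyond D A" "\<rho> < dS w"
  shows "\<exists>u\<in>N w. \<forall>z\<in>beyond D A. d u z \<le> D"
proof -
  have w': "w < n" "d w c \<le> R" using c w by (auto simp: beyond_def covers_singleton)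
  then have "k \<noteq> 1" using dS_eq_0[of w] w(2) by auto
  then have "h \<le> \<rho>" using odd_multiple_h_le[of 1] k_pos by (simp add: \<rho>_def)
  obtain u where u: "u < n" "d w u = min \<rho> (d w c)" "d u c = d w c - min \<rho> (d w c)"
    using d_geodesic[OF w'(1), of c "min \<rho> (d w c)"] w' R_less by auto
  have "\<rho> < 2 * n" using R_less by (simp add: \<rho>_def)
  then have "u \<in> N w" using u w' w by (intro ball_subset_N[where r = \<rho> and v = w]) auto
  moreover have "d u z \<le> D" if "z \<in> beyond D A" for z
    using d_triangle[OF u(1), of z c] c(2) that u(3) w'(2) \<open>h \<le> \<rho>\<close> h_le
    by (auto simp: D_eq covers_singleton d_commute[of c z] min_def split: if_splits)
  ultimately show ?thesis by blast
qed

lemma completable_empty: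
  assumes "k_radius n E k \<le> enat R"
  shows "completable 0 {}"
proof -
  have "k_radius n E k < enat (Suc R)" using assms by (simp add: order_le_less_trans)
  then obtain C where C: "C \<subseteq> {..<n}" "card C = k" "(SUP v\<in>{..<n}. set_gdist E v C) < enat (Suc R)"
    unfolding k_radius_def INF_less_iff by blast
  have "\<exists>c\<in>C. d v c \<le> R" if "v < n" for v
  proof -
    have "set_gdist E v C \<le> (SUP v\<in>{..<n}. set_gdist E v C)" using that by (intro SUP_upper) simp
    then have "set_gdist E v C < enat (Suc R)" using C(3) by (rule le_less_trans)
    then obtain c where c: "c \<in> C" "gdist E v c < enat (Suc R)"
      unfolding set_gdist_def INF_less_iff by blast
    then have "gdist E v c \<le> enat R" by (cases "gdist E v c") auto
    then show ?thesis using c d_le_iff_gdist_le[of R v c] R_less by auto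
  qed
  then have "far_completable 0 {}"
    unfolding far_completable_def using C by (intro exI[of _ C]) (auto simp: covers_def beyond_def)
  then show ?thesis by (simp add: completable_def)
qed

end

section \<open>Breadth-first search\<close>

context graph begin

text \<open>\<open>Q\<close> is the queue with write position \<open>t\<close> and \<open>L\<close> the array of distance labels.\<close>

definition bfs_queue :: "nat \<Rightarrow> nat \<Rightarrow> (nat \<Rightarrow> nat) \<Rightarrow> (nat \<Rightarrow> nat) \<Rightarrow> bool" where
  "bfs_queue s t Q L \<longleftrightarrow> 1 \<le> t \<and> inj_on Q {..<t} \<and> (\<forall>i<t. Q i < n \<and> d s (Q i) < 2 * n) \<and> Q 0 = s \<and>
     (\<forall>i j. i < j \<longrightarrow> j < t \<longrightarrow> d s (Q i) \<le> d s (Q j)) \<and>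
     (\<forall>u<n. L u = (if u \<in> Q ` {..<t} then d s u else 2 * n))"

definition bfs_frontier :: "nat \<Rightarrow> nat \<Rightarrow> nat \<Rightarrow> (nat \<Rightarrow> nat) \<Rightarrow> bool" where
  "bfs_frontier s h t Q \<longleftrightarrow> (\<forall>i<h. \<forall>u. {Q i, u} \<in> E \<longrightarrow> u \<in> Q ` {..<t}) \<and>
     (h < t \<longrightarrow> (\<forall>i<t. d s (Q i) \<le> d s (Q h) + 1) \<and> (\<forall>x<n. d s x \<le> d s (Q h) \<longrightarrow> x \<in> Q ` {..<t}))"

lemma bfs_queue_length_le:
  assumes "bfs_queue s t Q L"
  shows "t \<le> n"
proof -
  have "inj_on Q {..<t}" "Q ` {..<t} \<subseteq> {..<n}" using assms by (auto simp: bfs_queue_def)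
  then have "card {..<t} \<le> card {..<n}" by (rule card_inj_on_le) simp
  then show ?thesis by simp
qed

lemma bfs_queue_init: "s < n \<Longrightarrow> Q 0 = s \<Longrightarrow> (\<And>u. u < n \<Longrightarrow> L u = (if u = s then 0 else 2 * n)) \<Longrightarrow> bfs_queue s 1 Q L"
  by (auto simp: bfs_queue_def One_nat_def lessThan_Suc)

lemma bfs_frontier_init: "Q 0 = s \<Longrightarrow> bfs_frontier s 0 1 Q"
  by (auto simp: bfs_frontier_def d_eq_0_iff One_nat_def lessThan_Suc)

lemma bfs_push_label:
  assumes "bfs_frontier s h t Q" "h < t" "s < n" "{Q h, u} \<in> E" "u \<notin> Q ` {..<t}"
  shows "d s u = d s (Q h) + 1"
proof -
  have "u < n" using assms(4) edge_less by blast
  then have "\<not> d s u \<le> d s (Q h)" using assms by (auto simp: bfs_frontier_def)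
  moreover have "d s u \<le> d s (Q h) + 1"
    using d_triangle[OF assms(3), of u "Q h"] d_edge[OF assms(4)] by simp
  ultimately show ?thesis by simp
qed

lemma image_upd_lessThan_Suc: "(Q(t := u)) ` {..<Suc t} = insert u (Q ` {..<t})"
  by (auto simp: lessThan_Suc)

lemma bfs_queue_push:
  assumes queue: "bfs_queue s t Q L" "bfs_frontier s h t Q" "h < t" "s < n"
    and u: "{Q h, u} \<in> E" "u \<notin> Q ` {..<t}"
  shows "bfs_queue s (Suc t) (Q(t := u)) (L(u := d s (Q h) + 1))"
proof -
  have label: "d s u = d s (Q h) + 1" by (rule bfs_push_label[OF queue(2-4) u])
  have "inj_on (Q(t := u)) {..<Suc t}"
    using queue(1) u by (auto simp: bfs_queue_def inj_on_def less_Suc_eq)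
  moreover have "d s (Q h) < n" using queue d_less_or_infinite[of s "Q h"] by (auto simp: bfs_queue_def)
  moreover have "\<forall>i<t. d s (Q i) \<le> d s (Q h) + 1" using queue by (auto simp: bfs_frontier_def)
  moreover have "u < n" using u edge_less by blast
  ultimately show ?thesis
    unfolding bfs_queue_def image_upd_lessThan_Suc
    using queue(1,3) label by (auto simp: bfs_queue_def less_Suc_eq)
qed

lemma bfs_frontier_push:
  assumes "bfs_frontier s h t Q" "h < t" "s < n" "{Q h, u} \<in> E" "u \<notin> Q ` {..<t}"
  shows "bfs_frontier s h (Suc t) (Q(t := u))"
  unfolding bfs_frontier_def image_upd_lessThan_Suc
  using assms(1,2) bfs_push_label[OF assms] by (auto simp: bfs_frontier_def less_Suc_eq)

lemma bfs_frontier_advance_level: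
  assumes queue: "bfs_queue s t Q L" "bfs_frontier s h t Q" "Suc h < t" "s < n"
    and closed: "\<And>i u. i \<le> h \<Longrightarrow> {Q i, u} \<in> E \<Longrightarrow> u \<in> Q ` {..<t}"
    and x: "x < n" "d s x \<le> d s (Q (Suc h))"
  shows "x \<in> Q ` {..<t}"
proof (cases "d s x \<le> d s (Q h)")
  case True
  then show ?thesis using queue(2,3) x by (auto simp: bfs_frontier_def)
next
  case False
  have "d s (Q (Suc h)) \<le> d s (Q h) + 1" using queue(2,3) by (auto simp: bfs_frontier_def)
  then have level: "d s x = Suc (d s (Q h))" "d s (Q (Suc h)) = Suc (d s (Q h))" using False x by auto
  have "d s (Q (Suc h)) < 2 * n" using queue(1,3) by (auto simp: bfs_queue_def)
  then obtain y where y: "y < n" "d s y = d s (Q h)" "{y, x} \<in> E"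
    using d_predecessor[OF queue(4) level(1)] level by auto
  then have "y \<in> Q ` {..<t}" using queue(2,3) by (auto simp: bfs_frontier_def)
  then obtain i where i: "i < t" "y = Q i" by auto
  have "d s (Q (Suc h)) \<le> d s (Q i)" if "Suc h \<le> i"
    using queue(1) i(1) that by (cases "Suc h = i") (auto simp: bfs_queue_def)
  then have "i \<le> h" using y i level by (metis not_less_eq_eq Suc_n_not_le_n)
  then show ?thesis using closed y i by blast
qed

lemma bfs_frontier_advance:
  assumes queue: "bfs_queue s t Q L" "bfs_frontier s h t Q" "h < t" "s < n"
    and neighbours: "\<And>u. {Q h, u} \<in> E \<Longrightarrow> u \<in> Q ` {..<t}"
  shows "bfs_frontier s (Suc h) t Q"
proof -
  have closed: "u \<in> Q ` {..<t}" if "i \<le> h" "{Q i, u} \<in> E" for i u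
    using queue(2) neighbours that by (cases "i = h") (auto simp: bfs_frontier_def le_less)
  have "d s (Q i) \<le> d s (Q (Suc h)) + 1" if "Suc h < t" "i < t" for i
  proof -
    have "d s (Q h) \<le> d s (Q (Suc h))" using queue(1) that(1) by (auto simp: bfs_queue_def)
    moreover have "d s (Q i) \<le> d s (Q h) + 1" using queue(2,3) that(2) by (auto simp: bfs_frontier_def)
    ultimately show ?thesis by simp
  qed
  moreover have "x \<in> Q ` {..<t}" if "Suc h < t" "x < n" "d s x \<le> d s (Q (Suc h))" for x
    using bfs_frontier_advance_level[OF queue(1,2) that(1) queue(4) closed that(2,3)] .
  ultimately show ?thesis
    unfolding bfs_frontier_def using closed by (auto simp: less_Suc_eq_le)
qed

lemma bfs_complete:
  assumes queue: "bfs_queue s t Q L" "bfs_frontier s t t Q" "s < n"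
    and u: "u < n" "d s u < 2 * n"
  shows "u \<in> Q ` {..<t}"
  using u
proof (induction "d s u" arbitrary: u)
  case 0
  then have "u = s" using d_eq_0_iff[of s u] by simp
  then show ?case using queue(1) by (auto simp: bfs_queue_def)
next
  case (Suc r)
  then obtain x where x: "x < n" "d s x = r" "{x, u} \<in> E"
    using d_predecessor[OF queue(3), of u r] by metis
  then have "x \<in> Q ` {..<t}" using Suc by auto
  then show ?case using queue(2) x by (auto simp: bfs_frontier_def)
qed

lemma bfs_labels:
  assumes "bfs_queue s t Q L" "bfs_frontier s t t Q" "s < n" and u: "u < n"
  shows "L u = d s u"
proof (cases "d s u < 2 * n")
  case True
  then show ?thesis using bfs_complete[OF assms] assms(1) u by (auto simp: bfs_queue_def)
next
  case False
  then have "d s u = 2 * n" using d_le_infinite[OF assms(3), of u] by simp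
  then show ?thesis using assms(1) u by (auto simp: bfs_queue_def)
qed

text \<open>The flag \<open>full\<close> tells whether \<open>s\<close> reaches at least \<open>q\<close> vertices; otherwise later entries are junk.\<close>

definition nearest_row :: "nat \<Rightarrow> nat \<Rightarrow> (nat \<Rightarrow> nat) \<Rightarrow> bool \<Rightarrow> bool" where
  "nearest_row q s Q full \<longleftrightarrow> (full \<longrightarrow> inj_on Q {..<q}) \<and> (q = 1 \<longrightarrow> full \<and> Q 0 = s) \<and>
     (\<forall>r<2 * n. (\<forall>x<n. d s x \<le> r \<longrightarrow> x \<in> Q ` {..<q}) \<or> (full \<and> (\<forall>i<q. d s (Q i) \<le> r)))"

lemma bfs_queue_prefix_ball:
  assumes queue: "bfs_queue s t Q L" "bfs_frontier s t t Q" "s < n"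
    and r: "r < 2 * n" and i: "i < q" "i < t" "r < d s (Q i)" and x: "x < n" "d s x \<le> r"
  shows "x \<in> Q ` {..<q}"
proof -
  obtain j where j: "j < t" "x = Q j" using bfs_complete[OF queue x(1)] x r by auto
  have "d s (Q i) \<le> d s (Q j)" if "i < j" using queue(1) j(1) that by (auto simp: bfs_queue_def)
  then have "j \<le> i" using i j x by force
  then show ?thesis using j i by auto
qed

lemma bfs_nearest_row:
  assumes queue: "bfs_queue s t Q L" "bfs_frontier s t t Q" "s < n"
  shows "nearest_row q s Q (q \<le> t)"
proof -
  have "inj_on Q {..<q}" if "q \<le> t"
    using queue(1) inj_on_subset[of Q "{..<t}" "{..<q}"] that by (auto simp: bfs_queue_def)
  moreover have "x \<in> Q ` {..<q}" if "t < q" "x < n" "d s x \<le> r" "r < 2 * n" for x r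
    using bfs_complete[OF queue that(2)] that by auto
  moreover have "x \<in> Q ` {..<q}" if "q \<le> t" "i < q" "\<not> d s (Q i) \<le> r" "r < 2 * n" "x < n" "d s x \<le> r" for i x r
    using bfs_queue_prefix_ball[OF queue] that by (meson not_le order_less_le_trans)
  moreover have "1 \<le> t" "Q 0 = s" using queue(1) by (auto simp: bfs_queue_def)
  ultimately show ?thesis unfolding nearest_row_def by (meson not_le)
qed

end

section \<open>Adjacency lists of half-edges\<close>

text \<open>\<open>last_out ep j v\<close> is one more than the last half-edge before \<open>j\<close> that leaves \<open>v\<close>, and \<open>0\<close> if there
  is none.\<close>

fun last_out :: "(nat \<Rightarrow> nat) \<Rightarrow> nat \<Rightarrow> nat \<Rightarrow> nat" where
  "last_out ep 0 v = 0"
| "last_out ep (Suc j) v = (if ep j = v then Suc j else last_out ep j v)"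

fun out_degree :: "(nat \<Rightarrow> nat) \<Rightarrow> nat \<Rightarrow> nat \<Rightarrow> nat" where
  "out_degree ep 0 v = 0"
| "out_degree ep (Suc j) v = out_degree ep j v + of_bool (ep j = v)"

lemma last_out_le: "last_out ep j v \<le> j"
  by (induction j) auto

lemma out_degree_last_out: "out_degree ep (last_out ep j v) v = out_degree ep j v"
  by (induction j) auto

lemma last_out_leaves: "last_out ep j v = Suc e \<Longrightarrow> ep e = v"
  by (induction j) (auto split: if_splits)

lemma after_last_out: "last_out ep j v \<le> e \<Longrightarrow> e < j \<Longrightarrow> ep e \<noteq> v"
  by (induction j) (auto simp: less_Suc_eq split: if_splits)

lemma sum_out_degree:
  assumes "\<And>e. e < j \<Longrightarrow> ep e < n"
  shows "(\<Sum>v<n. out_degree ep j v) = j"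
  using assms
proof (induction j)
  case (Suc j)
  have "(\<Sum>v<n. of_bool (ep j = v)) = (1::nat)"
    using Suc.prems[of j] by (simp add: of_bool_def)
  then show ?case using Suc by (simp add: sum.distrib)
qed simp

section \<open>Greedy hitting sets\<close>

lemma card_mult_le_if_hits_le:
  fixes row :: "'a \<Rightarrow> nat set"
  assumes U: "finite U" "\<And>v. v \<in> U \<Longrightarrow> row v \<subseteq> {..<n}" "\<And>v. v \<in> U \<Longrightarrow> card (row v) = q"
    and hits: "\<And>u. u < n \<Longrightarrow> card {v\<in>U. u \<in> row v} \<le> b"
  shows "card U * q \<le> n * b"
proof -
  have "card {u\<in>{..<n}. u \<in> row v} = q" if "v \<in> U" for v
    using U(2,3)[OF that] by (metis Collect_mem_eq Int_absorb1 Int_def)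
  then have "(\<Sum>u<n. card {v\<in>U. u \<in> row v}) = card U * q"
    using sum_multicount_gen[OF finite_lessThan U(1), of n "\<lambda>u v. u \<in> row v" "\<lambda>_. q"] by simp
  moreover have "(\<Sum>u<n. card {v\<in>U. u \<in> row v}) \<le> (\<Sum>u<n. b)"
    by (intro sum_mono hits) simp
  ultimately show ?thesis by simp
qed

text \<open>Each greedy choice shrinks the number of unhit rows by the factor \<open>1 - q / n\<close>.\<close>

definition greedy_potential :: "nat \<Rightarrow> nat \<Rightarrow> nat \<Rightarrow> real" where
  "greedy_potential n q u = (if u = 0 then 0 else real n / real q * (1 + ln (real u)))"

lemma greedy_potential_nonneg: "0 \<le> greedy_potential n q u"
  by (auto simp: greedy_potential_def)

lemma greedy_potential_mono:
  assumes "u \<le> v"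
  shows "greedy_potential n q u \<le> greedy_potential n q v"
proof (cases "u = 0")
  case True
  then show ?thesis using greedy_potential_nonneg by (simp add: greedy_potential_def)
next
  case False
  then have "real n / real q * (1 + ln (real u)) \<le> real n / real q * (1 + ln (real v))"
    using assms by (intro mult_left_mono add_left_mono ln_mono) auto
  then show ?thesis using False assms by (simp add: greedy_potential_def)
qed

lemma ln_diff_le:
  fixes u b r :: real
  assumes "0 \<le> b" "b < u" "r \<le> b / u"
  shows "ln (u - b) \<le> ln u - r"
proof -
  have "ln (u - b) - ln u = ln ((u - b) / u)" using assms by (simp add: ln_div)
  also have "\<dots> \<le> (u - b) / u - 1" using assms by (intro ln_le_minus_one) auto
  also have "\<dots> = - (b / u)" using assms by (simp add: diff_divide_distrib)
  finally show ?thesis using assms(3) by simp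
qed

lemma greedy_potential_step:
  assumes "1 \<le> q" "q \<le> n" "1 \<le> u" "b \<le> u" "u * q \<le> n * b"
  shows "greedy_potential n q (u - b) + 1 \<le> greedy_potential n q u"
proof (cases "u = b")
  case True
  have "1 * 1 \<le> real n / real q * (1 + ln (real u))" using assms by (intro mult_mono) auto
  then show ?thesis using True assms by (simp add: greedy_potential_def)
next
  case False
  have "real u * real q \<le> real n * real b" using assms(5) by (metis of_nat_mult of_nat_le_iff)
  then have "real q / real n \<le> real b / real u" using assms by (simp add: field_simps)
  then have "ln (real (u - b)) \<le> ln (real u) - real q / real n"
    using ln_diff_le[of "real b" "real u"] False assms by (simp add: of_nat_diff)
  then have "real n / real q * (1 + ln (real (u - b))) \<le>
      real n / real q * (1 + (ln (real u) - real q / real n))"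
    by (intro mult_left_mono) auto
  also have "\<dots> = real n / real q * (1 + ln (real u)) - 1" using assms by (simp add: field_simps)
  finally show ?thesis using False assms by (simp add: greedy_potential_def)
qed

definition max_hitters :: "nat \<Rightarrow> nat \<Rightarrow> nat" where
  "max_hitters n q = nat \<lfloor>greedy_potential n q n\<rfloor>"

lemma le_max_hitters:
  assumes "real x + greedy_potential n q u \<le> greedy_potential n q n"
  shows "x \<le> max_hitters n q"
proof -
  have "real x \<le> greedy_potential n q n" using assms greedy_potential_nonneg[of n q u] by linarith
  then show ?thesis by (simp add: max_hitters_def le_nat_floor)
qed

section \<open>The approximation guarantee\<close>

abbreviation good_approx :: "nat \<Rightarrow> nat set set \<Rightarrow> nat \<Rightarrow> enat \<Rightarrow> nat set \<Rightarrow> bool" where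
  "good_approx n E k \<equiv> k_center_approx (2 - 1 / (2 * real k - 1)) (1 - 1 / (2 * real k - 1)) n E k"

lemma approx_radius_le:
  assumes "1 \<le> k" "R \<le> r"
  shows "real (approx_radius k R) \<le> (2 - 1 / (2 * real k - 1)) * real r + (1 - 1 / (2 * real k - 1))"
proof -
  define p where "p = 2 * k - 1"
  have p: "1 \<le> p" "real p = 2 * real k - 1" using assms(1) by (auto simp: p_def)
  have "R + 1 \<le> p * (R div p) + p"
    using p mult_div_mod_eq[of p R] mod_less_divisor[of p R] by linarith
  then have "real R + 1 \<le> real p * real (R div p) + real p"
    by (metis of_nat_1 of_nat_add of_nat_le_iff of_nat_mult)
  then have quotient: "(real R + 1) / real p \<le> real (R div p) + 1" using p(1) by (simp add: field_simps)
  have "R div p \<le> 2 * R" using div_le_dividend[of R p] by linarith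
  then have "real (approx_radius k R) = 2 * real R - real (R div p)"
    by (simp add: approx_radius_def p_def of_nat_diff)
  also have "\<dots> \<le> 2 * real R - (real R + 1) / real p + 1" using quotient by simp
  also have "\<dots> = (2 - 1 / real p) * real R + (1 - 1 / real p)" by (simp add: field_simps add_divide_distrib)
  also have "\<dots> \<le> (2 - 1 / real p) * real r + (1 - 1 / real p)"
    using p assms(2) by (intro add_right_mono mult_left_mono) (auto simp: field_simps)
  finally show ?thesis by (simp add: p(2))
qed

context graph begin

lemma set_gdist_finite_le:
  assumes "v < n" "set_gdist E v C < \<infinity>"
  shows "set_gdist E v C \<le> enat (n - 1)"
proof -
  obtain c where c: "c \<in> C" "gdist E v c < \<infinity>"
    using assms(2) unfolding set_gdist_def INF_less_iff by blast
  then obtain j where j: "gdist E v c = enat j" by (cases "gdist E v c") auto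
  then have "gdist E v c \<le> enat (n - 1)" using gdist_finite_less[OF assms(1) j] by simp
  then show ?thesis unfolding set_gdist_def using c(1) by (rule INF_lower2[rotated])
qed

lemma k_radius_le_if_finite:
  assumes "k_radius n E k \<noteq> \<infinity>"
  shows "k_radius n E k \<le> enat (n - 1)"
proof -
  have "k_radius n E k < \<infinity>" using assms by simp
  then obtain C where C: "C \<subseteq> {..<n}" "card C = k" "(SUP v\<in>{..<n}. set_gdist E v C) < \<infinity>"
    unfolding k_radius_def INF_less_iff by blast
  have "set_gdist E v C \<le> enat (n - 1)" if "v \<in> {..<n}" for v
  proof -
    have "set_gdist E v C \<le> (SUP v\<in>{..<n}. set_gdist E v C)" using that by (rule SUP_upper)
    then have "set_gdist E v C < \<infinity>" using C(3) by (rule le_less_trans)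
    then show ?thesis using set_gdist_finite_le that by simp
  qed
  then have "(SUP v\<in>{..<n}. set_gdist E v C) \<le> enat (n - 1)" by (rule SUP_least)
  then show ?thesis
    unfolding k_radius_def using C(1,2) by (intro INF_lower2[of C]) auto
qed

lemma set_gdist_le_if_d_le:
  assumes "v < n" "D < 2 * n" "c \<in> C" "d c v \<le> D"
  shows "set_gdist E v C \<le> enat D"
proof -
  have "gdist E v c \<le> enat D" using d_le_iff_gdist_le[OF assms(2)] assms(4) d_commute[of c v] by simp
  then show ?thesis unfolding set_gdist_def using assms(3) by (rule INF_lower2[rotated])
qed

text \<open>The value \<open>hi = n\<close> of the binary search means that no finite radius suffices.\<close>

definition encoded_radius :: "nat \<Rightarrow> nat \<Rightarrow> nat" where
  "encoded_radius k hi = (if hi < n then Suc (approx_radius k hi) else 0)"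

lemma good_approx_finite:
  fixes C :: "nat set"
  assumes k: "1 \<le> k" and C: "C \<subseteq> {..<n}" "card C = k"
    and low: "\<And>R. R < hi \<Longrightarrow> \<not> k_radius n E k \<le> enat R" and hi: "hi < n"
    and cov: "\<And>z. z < n \<Longrightarrow> \<exists>c\<in>C. d c z \<le> approx_radius k hi"
  shows "good_approx n E k (enat (approx_radius k hi)) C"
proof -
  let ?D = "approx_radius k hi"
  have D: "?D < 2 * n" using hi by (simp add: approx_radius_def)
  have c: "set_gdist E v C \<le> enat ?D" if "v < n" for v
    using cov[OF that] set_gdist_le_if_d_le[OF that D] by blast
  then have rad: "k_radius n E k \<le> enat ?D"
    unfolding k_radius_def using C by (intro INF_lower2[of C] SUP_least) auto
  then obtain r where r: "k_radius n E k = enat r" by (cases "k_radius n E k") auto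
  have "hi \<le> r" using low[of r] r by (simp add: not_less[symmetric]) blast
  then have "ereal_of_enat (enat ?D) \<le>
      ereal (2 - 1 / (2 * real k - 1)) * ereal_of_enat (k_radius n E k) + ereal (1 - 1 / (2 * real k - 1))"
    using approx_radius_le[OF k] by (simp add: r)
  then show ?thesis using C c rad by (simp add: k_center_approx_def)
qed

lemma good_approx_infinite:
  assumes k: "1 \<le> k" and C: "C \<subseteq> {..<n}" "card C = k" and rad: "k_radius n E k = \<infinity>"
  shows "good_approx n E k \<infinity> C"
proof -
  have "0 < 2 - 1 / (2 * real k - 1)" using k by (simp add: field_simps)
  then show ?thesis using C rad by (simp add: k_center_approx_def)
qed

lemma good_approx_encoded_radius:
  fixes C :: "nat set"
  assumes "1 \<le> k" "C \<subseteq> {..<n}" "card C = k"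
    and low: "\<And>R. R < hi \<Longrightarrow> \<not> k_radius n E k \<le> enat R" and hi: "hi \<le> n"
    and "\<And>z. hi < n \<Longrightarrow> z < n \<Longrightarrow> \<exists>c\<in>C. d c z \<le> approx_radius k hi"
  shows "good_approx n E k
    (case encoded_radius k hi of 0 \<Rightarrow> \<infinity> | Suc r \<Rightarrow> enat r) C"
proof (cases "hi < n")
  case True
  then show ?thesis
    using good_approx_finite[of k C hi] assms by (simp add: encoded_radius_def)
next
  case False
  then have "\<not> k_radius n E k \<le> enat (n - 1)" using low[of "n - 1"] hi n_pos by simp
  then have "k_radius n E k = \<infinity>" using k_radius_le_if_finite by blast
  then show ?thesis
    using good_approx_infinite[of k C] assms False by (simp add: encoded_radius_def)
qed

end

section \<open>Input and memory layout\<close>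

datatype var =
    VertexCount | HalfEdgeCount | RowLength | HitterCount | CandidateCount
  | Source | Head | Tail | Vertex | Edge | Neighbour | Index | Best | ArgBest
  | Low | High | Radius | Shrink | Target | Reach | Threshold | Found | Pass | Candidate | Farthest
  | Count | Answer | Chosen nat | Center nat | Pivot nat | Branching nat

instance var :: countable
  by countable_datatype

datatype arr =
    Ends | Next | First | Dist | Queue | Unhit | Tally | Hitters | HitDist | NearHit | Needed | Used

instantiation arr :: slotted
begin

fun slot_arr :: "arr \<Rightarrow> nat" where
  "slot_arr Ends = 0" | "slot_arr Next = 1" | "slot_arr First = 2" | "slot_arr Dist = 3"
| "slot_arr Queue = 4" | "slot_arr Unhit = 5" | "slot_arr Tally = 6" | "slot_arr Hitters = 7"
| "slot_arr HitDist = 8" | "slot_arr NearHit = 9" | "slot_arr Needed = 10" | "slot_arr Used = 11"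

instance
proof
  fix a b :: arr
  show "slot a = slot b \<longleftrightarrow> a = b" by (cases a; cases b; simp)
qed

end

fun row_count :: "nat \<Rightarrow> arr \<Rightarrow> nat" where
  "row_count n Dist = n"
| "row_count n Queue = n"
| "row_count n _ = 1"

text \<open>The output needs \<open>k \<le> n \<le> m + 1\<close> cells of \<open>Ends\<close>, even if there are no edges.\<close>

fun column_count :: "nat \<Rightarrow> nat \<Rightarrow> arr \<Rightarrow> nat" where
  "column_count n m Ends = 2 * m + 1"
| "column_count n m Next = 2 * m"
| "column_count n m _ = n"

definition fits :: "nat \<Rightarrow> nat \<Rightarrow> arr \<Rightarrow> nat \<Rightarrow> nat \<Rightarrow> bool" where
  "fits n m a i j \<longleftrightarrow> i < row_count n a \<and> j < column_count n m a"

lemma matrix_index_less: "i < n \<Longrightarrow> j < n \<Longrightarrow> i * n + j < n * (n::nat)"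
proof -
  assume "i < n" "j < n"
  then have "i * n + j < Suc i * n" "Suc i * n \<le> n * n" by (simp, intro mult_le_mono1, simp)
  then show ?thesis by (rule less_le_trans)
qed

lemma fits_offset_less:
  assumes "fits n m a i j"
  shows "i * n + j < n * n + 2 * m + 1"
proof (cases "a = Dist \<or> a = Queue")
  case True
  then show ?thesis using assms matrix_index_less[of i n j] by (auto simp: fits_def)
next
  case False
  then have "i = 0" "j < 2 * m + 1 \<or> j < n" using assms by (cases a; auto simp: fits_def)+
  moreover have "n \<le> n * n + 2 * m" by (simp add: trans_le_add1)
  ultimately show ?thesis by auto
qed

lemma fits_offset_inject:
  assumes "fits n m a i j" "fits n m a i' j'" "i * n + j = i' * n + j'"
  shows "i = i' \<and> j = j'"
proof (cases "a = Dist \<or> a = Queue")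
  case True
  then have "(i * n + j) div n = i" "(i' * n + j') div n = i'"
    using assms(1,2) by (auto simp: fits_def)
  then show ?thesis using assms(3) by auto
next
  case False
  then have "i = 0" "i' = 0" using assms(1,2) by (cases a; auto simp: fits_def)+
  then show ?thesis using assms(3) by simp
qed

lemma slotted_offset_inject:
  fixes x y S :: nat
  assumes "x < S" "y < S" "x + a * S = y + b * S"
  shows "x = y \<and> a = b"
proof -
  have "(x + a * S) mod S = x" "(y + b * S) mod S = y" "(x + a * S) div S = a" "(y + b * S) div S = b"
    using assms(1,2) by auto
  then show ?thesis using assms(3) by metis
qed

locale kcenter_input = graph +
  fixes k :: nat and es :: "(nat \<times> nat) list" and w :: nat and q :: nat
  assumes k_pos: "1 \<le> k" and k_le: "k \<le> n"
    and listing: "edge_listing E es"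
    and n_le: "n \<le> length es + 1"
    and word_large: "100 * (n * n + n + length es + 1) \<le> 2 ^ w"
    and q_pos: "1 \<le> q" and q_le: "q \<le> n"
begin

abbreviation m :: nat where "m \<equiv> length es"

lemma address_less: "fits n m a i j \<Longrightarrow> address n (n * n + 2 * m + 1) a i j < 2 ^ w"
proof -
  assume "fits n m a i j"
  then have "i * n + j < n * n + 2 * m + 1" by (rule fits_offset_less)
  moreover have "slot a * (n * n + 2 * m + 1) \<le> 11 * (n * n + 2 * m + 1)"
    by (intro mult_le_mono1) (cases a; simp)
  ultimately show ?thesis using word_large unfolding address_def distrib_left by linarith
qed

end

sublocale kcenter_input \<subseteq> memory_layout w "fits n m" n "n * n + 2 * m + 1"
proof
  fix a a' :: arr and i j i' j'
  show "fits n m a i j \<Longrightarrow> address n (n * n + 2 * m + 1) a i j < 2 ^ w" by (rule address_less)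
  assume fit: "fits n m a i j" "fits n m a' i' j'"
    and eq: "address n (n * n + 2 * m + 1) a i j = address n (n * n + 2 * m + 1) a' i' j'"
  have "i * n + j = i' * n + j'" "slot a = slot a'"
    using slotted_offset_inject[OF fit[THEN fits_offset_less]] eq by (auto simp: address_def)
  then show "a = a' \<and> i = i' \<and> j = j'"
    using fits_offset_inject fit by (simp add: slot_eq_iff)
qed simp

context kcenter_input begin

lemma small_less_word: "x \<le> 4 * n + 4 * m + 4 \<Longrightarrow> x < 2 ^ w"
  using word_large by simp

lemma numeral_less_word [simp]: "1 < (2::nat) ^ w" "2 < (2::nat) ^ w"
  by (intro small_less_word; simp)+

lemma square_less_word: "x \<le> n * n \<Longrightarrow> x < 2 ^ w"
  using word_large by simp

definition sizes :: "(var \<Rightarrow> nat) \<Rightarrow> bool" where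
  "sizes \<sigma> \<longleftrightarrow> \<sigma> VertexCount = n \<and> \<sigma> HalfEdgeCount = 2 * m \<and> \<sigma> RowLength = q"

lemma sizes_unchanged:
  assumes "sizes \<sigma>" "unchanged c \<sigma> \<mu> \<sigma>' \<mu>'" "VertexCount \<notin> writes c" "HalfEdgeCount \<notin> writes c"
    "RowLength \<notin> writes c"
  shows "sizes \<sigma>'"
  using assms by (simp add: sizes_def unchanged_def)

definition endpoint :: "nat \<Rightarrow> nat" where
  "endpoint e = (if even e then fst (es ! (e div 2)) else snd (es ! (e div 2)))"

abbreviation opposite :: "nat \<Rightarrow> nat" where
  "opposite e \<equiv> e + 1 - 2 * (e mod 2)"

lemma E_eq: "E = (\<lambda>x. {fst x, snd x}) ` set es"
  using listing by (simp add: edge_listing_def case_prod_beta)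

lemma opposite_less: "e < 2 * m \<Longrightarrow> opposite e < 2 * m"
  by presburger

lemma half_edge_in_E:
  assumes "e < 2 * m"
  shows "{endpoint e, endpoint (opposite e)} \<in> E"
proof -
  have edge: "es ! (e div 2) \<in> set es" using assms by (intro nth_mem) linarith
  show ?thesis
  proof (cases "even e")
    case True
    then have "opposite e = e + 1" "odd (e + 1)" "(e + 1) div 2 = e div 2"
      by (auto simp: even_iff_mod_2_eq_zero)
    then show ?thesis using imageI[OF edge] True by (simp add: E_eq endpoint_def)
  next
    case False
    then have "opposite e = e - 1" "even (e - 1)" "(e - 1) div 2 = e div 2" by (auto elim!: oddE)
    then show ?thesis using imageI[OF edge] False by (simp add: E_eq endpoint_def insert_commute)
  qed
qed

lemma half_edge_exists:
  assumes "{u, v} \<in> E"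
  obtains e where "e < 2 * m" "endpoint e = u" "endpoint (opposite e) = v"
proof -
  obtain x where x: "x \<in> set es" "{u, v} = {fst x, snd x}" using assms by (auto simp: E_eq)
  then obtain i where i: "i < m" "es ! i = x" by (auto simp: in_set_conv_nth)
  have "endpoint (2 * i) = fst x" "endpoint (2 * i + 1) = snd x" using i by (auto simp: endpoint_def)
  moreover have "opposite (2 * i) = 2 * i + 1" "opposite (2 * i + 1) = 2 * i" by auto
  moreover have "u = fst x \<and> v = snd x \<or> u = snd x \<and> v = fst x" using x by (auto simp: doubleton_eq_iff)
  ultimately show thesis
    using i that[of "2 * i"] that[of "2 * i + 1"] by auto
qed

lemma endpoint_less: "e < 2 * m \<Longrightarrow> endpoint e < n"
  using half_edge_in_E edge_less by blast

end

section \<open>All-pairs shortest paths\<close>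

definition link_half_edges :: "(var, arr) com" where
  "link_half_edges = for_range Edge HalfEdgeCount
     (Put_Elem Next (Var Edge) (Elem First (Elem Ends (Var Edge)));;
      Put_Elem First (Elem Ends (Var Edge)) (Var Edge \<oplus> Lit 1))"

definition visit_neighbour :: "(var, arr) com" where
  "visit_neighbour = Branch (Cell Dist (Var Source) (Var Neighbour) \<doteq> Lit 2 \<otimes> Var VertexCount)
     (Put Dist (Var Source) (Var Neighbour) (Cell Dist (Var Source) (Var Vertex) \<oplus> Lit 1);;
      Put Queue (Var Source) (Var Tail) (Var Neighbour);;
      Tail ::= Var Tail \<oplus> Lit 1) Skip"

text \<open>\<open>Edge\<close> holds a half-edge number plus one; the opposite half-edge differs in the last bit.\<close>

definition scan_edge :: "(var, arr) com" where
  "scan_edge = Neighbour ::= Elem Ends (Var Edge \<ominus> Lit 2 \<otimes> Opr OpMod (Var Edge \<ominus> Lit 1) (Lit 2));;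
     visit_neighbour;; Edge ::= Elem Next (Var Edge \<ominus> Lit 1)"

definition scan_edges :: "(var, arr) com" where
  "scan_edges = Loop (Var Edge) scan_edge"

definition bfs_init :: "(var, arr) com" where
  "bfs_init = fill Dist (Var Source) Vertex VertexCount (Lit 2 \<otimes> Var VertexCount);;
     Put Dist (Var Source) (Var Source) (Lit 0);; Put Queue (Var Source) (Lit 0) (Var Source);;
     Head ::= Lit 0;; Tail ::= Lit 1"

definition bfs_loop :: "(var, arr) com" where
  "bfs_loop = Loop (Var Head \<prec> Var Tail)
     ((Vertex ::= Cell Queue (Var Source) (Var Head);; Edge ::= Elem First (Var Vertex));;
      scan_edges;; Head ::= Var Head \<oplus> Lit 1)"

definition bfs :: "(var, arr) com" where
  "bfs = bfs_init;; bfs_loop;; Put_Elem Unhit (Var Source) (Lit 1 \<ominus> (Var Tail \<prec> Var RowLength))"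

definition apsp :: "(var, arr) com" where
  "apsp = link_half_edges;; for_range Source VertexCount bfs"

lemma visit_neighbour_effects [simp]:
  "writes visit_neighbour = {Tail}" "stores visit_neighbour = {Dist, Queue}"
  by (auto simp: visit_neighbour_def)

lemma scan_edge_effects [simp]:
  "writes scan_edge = {Neighbour, Tail, Edge}" "stores scan_edge = {Dist, Queue}"
  by (auto simp: scan_edge_def)

lemma scan_edges_effects [simp]:
  "writes scan_edges = {Neighbour, Tail, Edge}" "stores scan_edges = {Dist, Queue}"
  by (auto simp: scan_edges_def)

lemma bfs_init_effects [simp]:
  "writes bfs_init = {Vertex, Head, Tail}" "stores bfs_init = {Dist, Queue}"
  by (auto simp: bfs_init_def)

lemma bfs_loop_effects [simp]:
  "writes bfs_loop = {Vertex, Edge, Neighbour, Head, Tail}" "stores bfs_loop = {Dist, Queue}"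
  by (auto simp: bfs_loop_def)

lemma bfs_effects [simp]:
  "writes bfs = {Vertex, Edge, Neighbour, Head, Tail}" "stores bfs = {Dist, Queue, Unhit}"
  by (auto simp: bfs_def)

context kcenter_input begin

definition adjacency :: "(arr \<Rightarrow> nat \<Rightarrow> nat \<Rightarrow> nat) \<Rightarrow> bool" where
  "adjacency \<mu> \<longleftrightarrow> (\<forall>e<2 * m. \<mu> Ends 0 e = endpoint e \<and> \<mu> Next 0 e = last_out endpoint e (endpoint e)) \<and>
     (\<forall>v<n. \<mu> First 0 v = last_out endpoint (2 * m) v)"

lemma runs_link_half_edges:
  assumes "sizes \<sigma>" and ends: "\<And>e. e < 2 * m \<Longrightarrow> \<mu> Ends 0 e = endpoint e" and "\<And>v. v < n \<Longrightarrow> \<mu> First 0 v = 0"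
  shows "runs link_half_edges \<sigma> \<mu> (100 * m + 6) (\<lambda>\<sigma>' \<mu>'. adjacency \<mu>')"
proof -
  let ?body = "Put_Elem Next (Var Edge) (Elem First (Elem Ends (Var Edge)));;
      Put_Elem First (Elem Ends (Var Edge)) (Var Edge \<oplus> Lit 1)"
  let ?I = "\<lambda>j (\<sigma>' :: var \<Rightarrow> nat) \<mu>'. (\<forall>e<j. \<mu>' Next 0 e = last_out endpoint e (endpoint e)) \<and>
    (\<forall>v<n. \<mu>' First 0 v = last_out endpoint j v)"
  have "runs (for_range Edge HalfEdgeCount ?body) \<sigma> \<mu> (100 * m + 6) (?I (2 * m))"
  proof (rule runs_for_range[where I = ?I and C = 42])
    fix j \<sigma>' \<mu>'
    assume j: "j < 2 * m" "\<sigma>' Edge = j" and same: "unchanged (for_range Edge HalfEdgeCount ?body) \<sigma> \<mu> \<sigma>' \<mu>'"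
      and inv: "?I j \<sigma>' \<mu>'"
    have "\<mu>' Ends 0 j = endpoint j" "endpoint j < n"
      using same ends j(1) endpoint_less by (auto simp: unchanged_def)
    then show "runs ?body \<sigma>' \<mu>' 42 (\<lambda>\<sigma>'' \<mu>''. ?I (Suc j) (\<sigma>''(Edge := Suc j)) \<mu>'')"
      using j inv n_pos by (intro runs_straight) (auto simp: fits_def less_Suc_eq small_less_word)
  qed (use assms n_pos in \<open>auto simp: sizes_def small_less_word\<close>)
  then show ?thesis
    unfolding link_half_edges_def
    by (rule runs_weaken) (use ends in \<open>auto simp: adjacency_def unchanged_def\<close>)
qed

definition bfs_state :: "nat \<Rightarrow> nat \<Rightarrow> (var \<Rightarrow> nat) \<Rightarrow> (arr \<Rightarrow> nat \<Rightarrow> nat \<Rightarrow> nat) \<Rightarrow> bool" where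
  "bfs_state s h \<sigma> \<mu> \<longleftrightarrow> bfs_queue s (\<sigma> Tail) (\<mu> Queue s) (\<mu> Dist s) \<and> bfs_frontier s h (\<sigma> Tail) (\<mu> Queue s) \<and>
     (\<forall>i. \<mu> Queue s i < n)"

definition queued :: "nat \<Rightarrow> (var \<Rightarrow> nat) \<Rightarrow> (arr \<Rightarrow> nat \<Rightarrow> nat \<Rightarrow> nat) \<Rightarrow> nat set" where
  "queued s \<sigma> \<mu> = \<mu> Queue s ` {..<\<sigma> Tail}"

definition queue_extends :: "nat \<Rightarrow> (var \<Rightarrow> nat) \<Rightarrow> (arr \<Rightarrow> nat \<Rightarrow> nat \<Rightarrow> nat) \<Rightarrow>
    (var \<Rightarrow> nat) \<Rightarrow> (arr \<Rightarrow> nat \<Rightarrow> nat \<Rightarrow> nat) \<Rightarrow> bool" where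
  "queue_extends s \<sigma> \<mu> \<sigma>' \<mu>' \<longleftrightarrow> \<sigma> Tail \<le> \<sigma>' Tail \<and> (\<forall>i<\<sigma> Tail. \<mu>' Queue s i = \<mu> Queue s i) \<and>
     (\<forall>s'. s' \<noteq> s \<longrightarrow> \<mu>' Queue s' = \<mu> Queue s' \<and> \<mu>' Dist s' = \<mu> Dist s')"

lemma queue_extends_trans:
  "queue_extends s \<sigma> \<mu> \<sigma>' \<mu>' \<Longrightarrow> queue_extends s \<sigma>' \<mu>' \<sigma>'' \<mu>'' \<Longrightarrow> queue_extends s \<sigma> \<mu> \<sigma>'' \<mu>''"
  by (auto simp: queue_extends_def)

lemma queued_mono:
  assumes "queue_extends s \<sigma> \<mu> \<sigma>' \<mu>'"
  shows "queued s \<sigma> \<mu> \<subseteq> queued s \<sigma>' \<mu>'"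
proof
  fix u assume "u \<in> queued s \<sigma> \<mu>"
  then obtain i where "i < \<sigma> Tail" "\<mu> Queue s i = u" by (auto simp: queued_def)
  then show "u \<in> queued s \<sigma>' \<mu>'"
    using assms by (auto simp: queued_def queue_extends_def intro!: image_eqI[of _ _ i])
qed

lemma runs_visit_neighbour:
  assumes "sizes \<sigma>" and s: "s < n" "\<sigma> Source = s" and state: "bfs_state s h \<sigma> \<mu>" "h < \<sigma> Tail"
    and v: "\<sigma> Vertex = \<mu> Queue s h" and u: "\<sigma> Neighbour = u" "{\<mu> Queue s h, u} \<in> E"
  shows "runs visit_neighbour \<sigma> \<mu> 60 (\<lambda>\<sigma>' \<mu>'. bfs_state s h \<sigma>' \<mu>' \<and> queue_extends s \<sigma> \<mu> \<sigma>' \<mu>' \<and>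
      u \<in> queued s \<sigma>' \<mu>')"
proof -
  let ?t = "\<sigma> Tail" and ?v = "\<mu> Queue s h"
  have queue: "bfs_queue s ?t (\<mu> Queue s) (\<mu> Dist s)" and frontier: "bfs_frontier s h ?t (\<mu> Queue s)"
    and entries: "\<forall>i. \<mu> Queue s i < n"
    using state by (auto simp: bfs_state_def)
  have less: "u < n" "?v < n" using u(2) edge_less by auto
  have "\<mu> Dist s ?v = d s ?v" using queue state(2) less by (auto simp: bfs_queue_def)
  moreover have "d s ?v \<le> 2 * n" using d_le_infinite s(1) by blast
  moreover have "\<mu> Dist s u = 2 * n \<longleftrightarrow> u \<notin> queued s \<sigma> \<mu>"
    using queue less by (auto simp: bfs_queue_def queued_def)
  moreover have "?t < n" "bfs_queue s (Suc ?t) ((\<mu> Queue s)(?t := u)) ((\<mu> Dist s)(u := d s ?v + 1))"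
    "bfs_frontier s h (Suc ?t) ((\<mu> Queue s)(?t := u))" if "u \<notin> queued s \<sigma> \<mu>"
  proof -
    show pushed: "bfs_queue s (Suc ?t) ((\<mu> Queue s)(?t := u)) ((\<mu> Dist s)(u := d s ?v + 1))"
      using bfs_queue_push[OF queue frontier state(2) s(1) u(2)] that by (simp add: queued_def)
    show "?t < n" using bfs_queue_length_le[OF pushed] by simp
    show "bfs_frontier s h (Suc ?t) ((\<mu> Queue s)(?t := u))"
      using bfs_frontier_push[OF frontier state(2) s(1) u(2)] that by (simp add: queued_def)
  qed
  ultimately show ?thesis
    unfolding visit_neighbour_def
    using assms less entries
    by (intro runs_straight)
      (auto simp: fits_def sizes_def small_less_word bfs_state_def queue_extends_def queued_def lessThan_Suc
        simp flip: Suc_eq_plus1)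
qed

definition scan_state :: "nat \<Rightarrow> nat \<Rightarrow> (var \<Rightarrow> nat) \<Rightarrow> (arr \<Rightarrow> nat \<Rightarrow> nat \<Rightarrow> nat) \<Rightarrow> bool" where
  "scan_state s v \<sigma> \<mu> \<longleftrightarrow> \<sigma> Edge \<le> 2 * m \<and> (\<forall>e. \<sigma> Edge = Suc e \<longrightarrow> endpoint e = v) \<and>
     (\<forall>e<2 * m. \<sigma> Edge \<le> e \<longrightarrow> endpoint e = v \<longrightarrow> endpoint (opposite e) \<in> queued s \<sigma> \<mu>)"

lemma scan_state_init: "\<sigma> Edge = last_out endpoint (2 * m) v \<Longrightarrow> scan_state s v \<sigma> \<mu>"
  using last_out_le[of endpoint "2 * m" v] last_out_leaves[of endpoint "2 * m" v]
    after_last_out[of endpoint "2 * m" v]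
  by (auto simp: scan_state_def)

lemma scan_state_end:
  assumes "scan_state s v \<sigma> \<mu>" "\<sigma> Edge = 0" "{v, u} \<in> E"
  shows "u \<in> queued s \<sigma> \<mu>"
  using half_edge_exists[OF assms(3)] assms(1,2) unfolding scan_state_def by (metis le0)

lemma scan_state_step:
  assumes scan: "scan_state s v \<sigma> \<mu>" "\<sigma> Edge = Suc e" and visited: "endpoint (opposite e) \<in> queued s \<sigma>' \<mu>'"
    and extends: "queue_extends s \<sigma> \<mu> \<sigma>' \<mu>'"
  shows "scan_state s v (\<sigma>'(Edge := last_out endpoint e v)) \<mu>'"
proof -
  have e: "e < 2 * m" "endpoint e = v" using scan by (auto simp: scan_state_def)
  have "endpoint (opposite e') \<in> queued s \<sigma>' \<mu>'"
    if e': "e' < 2 * m" "last_out endpoint e v \<le> e'" "endpoint e' = v" for e'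
  proof -
    consider "e' = e" | "Suc e \<le> e'" using after_last_out[OF e'(2)] e'(3) by force
    then show ?thesis
    proof cases
      case 1
      then show ?thesis using visited by simp
    next
      case 2
      then show ?thesis using scan e' queued_mono[OF extends] by (auto simp: scan_state_def)
    qed
  qed
  moreover have "queued s (\<sigma>'(Edge := last_out endpoint e v)) \<mu>' = queued s \<sigma>' \<mu>'" by (simp add: queued_def)
  ultimately show ?thesis
    using last_out_le[of endpoint e v] last_out_leaves[of endpoint e v] e by (auto simp: scan_state_def)
qed

lemma adjacency_unchanged:
  "adjacency \<mu> \<Longrightarrow> unchanged c \<sigma> \<mu> \<sigma>' \<mu>' \<Longrightarrow> stores c \<inter> {Ends, Next, First} = {} \<Longrightarrow> adjacency \<mu>'"
  by (simp add: adjacency_def unchanged_def)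

lemma bfs_state_upd: "x \<noteq> Tail \<Longrightarrow> bfs_state s h (\<sigma>(x := a)) \<mu> \<longleftrightarrow> bfs_state s h \<sigma> \<mu>"
  by (simp add: bfs_state_def)

lemma queue_extends_upd:
  "x \<noteq> Tail \<Longrightarrow> queue_extends s (\<sigma>(x := a)) \<mu> \<sigma>' \<mu>' \<longleftrightarrow> queue_extends s \<sigma> \<mu> \<sigma>' \<mu>'"
  "x \<noteq> Tail \<Longrightarrow> queue_extends s \<sigma> \<mu> (\<sigma>'(x := a)) \<mu>' \<longleftrightarrow> queue_extends s \<sigma> \<mu> \<sigma>' \<mu>'"
  by (simp_all add: queue_extends_def)

lemma runs_scan_edge:
  assumes "sizes \<sigma>" and adj: "adjacency \<mu>" and "s < n" "\<sigma> Source = s"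
    and "bfs_state s h \<sigma> \<mu>" "h < \<sigma> Tail" and "\<sigma> Vertex = v" "\<mu> Queue s h = v"
    and scan: "scan_state s v \<sigma> \<mu>" "\<sigma> Edge = Suc e"
  shows "runs scan_edge \<sigma> \<mu> 90 (\<lambda>\<sigma>' \<mu>'. bfs_state s h \<sigma>' \<mu>' \<and> queue_extends s \<sigma> \<mu> \<sigma>' \<mu>' \<and>
     scan_state s v \<sigma>' \<mu>' \<and> \<sigma>' Edge = last_out endpoint e v)"
proof -
  let ?advance = "Edge ::= Elem Next (Var Edge \<ominus> Lit 1)"
  let ?Q = "\<lambda>\<sigma>' \<mu>'. bfs_state s h \<sigma>' \<mu>' \<and> queue_extends s \<sigma> \<mu> \<sigma>' \<mu>' \<and>
     scan_state s v \<sigma>' \<mu>' \<and> \<sigma>' Edge = last_out endpoint e v"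
  have e: "e < 2 * m" "endpoint e = v" using scan by (auto simp: scan_state_def)
  have opp: "opposite e < 2 * m" using opposite_less e(1) .
  have bounds: "Suc e < 2 ^ w" "2 * (e mod 2) < 2 ^ w" using e(1) by (auto intro!: small_less_word)
  let ?\<sigma> = "\<sigma>(Neighbour := endpoint (opposite e))"
  have "runs visit_neighbour ?\<sigma> \<mu> 60
      (\<lambda>\<sigma>' \<mu>'. bfs_state s h \<sigma>' \<mu>' \<and> queue_extends s ?\<sigma> \<mu> \<sigma>' \<mu>' \<and> endpoint (opposite e) \<in> queued s \<sigma>' \<mu>')"
    using assms half_edge_in_E[OF e(1)] e(2)
    by (intro runs_visit_neighbour) (auto simp: sizes_def bfs_state_def)
  then have "runs (visit_neighbour;; ?advance) ?\<sigma> \<mu> 73 ?Q"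
  proof (rule runs_Seq[where T' = 13])
    fix \<sigma>' \<mu>'
    assume same: "unchanged visit_neighbour ?\<sigma> \<mu> \<sigma>' \<mu>'" and visited: "bfs_state s h \<sigma>' \<mu>' \<and>
      queue_extends s ?\<sigma> \<mu> \<sigma>' \<mu>' \<and> endpoint (opposite e) \<in> queued s \<sigma>' \<mu>'"
    then have extends: "queue_extends s \<sigma> \<mu> \<sigma>' \<mu>'" by (simp add: queue_extends_upd)
    then have "scan_state s v (\<sigma>'(Edge := last_out endpoint e v)) \<mu>'"
      using scan_state_step[OF scan] visited by blast
    moreover have "\<mu>' Next 0 e = last_out endpoint e v" "\<sigma>' Edge = Suc e"
      using adj e scan(2) same by (auto simp: adjacency_def unchanged_def)
    ultimately show "runs ?advance \<sigma>' \<mu>' 13 ?Q"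
      using e bounds visited extends
      by (intro runs_straight) (simp_all add: fits_def bfs_state_upd queue_extends_upd)
  qed simp
  moreover have "\<mu> Ends 0 (opposite e) = endpoint (opposite e)" "2 * (e mod 2) \<le> Suc e"
    using adj opp by (auto simp: adjacency_def)
  ultimately show ?thesis
    unfolding scan_edge_def using scan(2) opp bounds
    by (intro runs_Seq_straight[where T = 73]) (simp_all add: fits_def Suc_eq_plus1)
qed

lemma runs_scan_edges:
  assumes "sizes \<sigma>" "adjacency \<mu>" and s: "s < n" "\<sigma> Source = s" and state: "bfs_state s h \<sigma> \<mu>" "h < \<sigma> Tail"
    and v: "\<sigma> Vertex = v" "\<mu> Queue s h = v" "\<sigma> Edge = last_out endpoint (2 * m) v"
  shows "runs scan_edges \<sigma> \<mu> (120 * out_degree endpoint (2 * m) v + 2) (\<lambda>\<sigma>' \<mu>'. bfs_state s h \<sigma>' \<mu>' \<and>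
     queue_extends s \<sigma> \<mu> \<sigma>' \<mu>' \<and> (\<forall>u. {v, u} \<in> E \<longrightarrow> u \<in> queued s \<sigma>' \<mu>'))"
  unfolding scan_edges_def
proof (rule runs_Loop[where I = "\<lambda>\<sigma>' \<mu>'. bfs_state s h \<sigma>' \<mu>' \<and> queue_extends s \<sigma> \<mu> \<sigma>' \<mu>' \<and> scan_state s v \<sigma>' \<mu>'"
      and \<Phi> = "\<lambda>\<sigma>' \<mu>'. 120 * out_degree endpoint (\<sigma>' Edge) v"
        and C = "\<lambda>_ _. 90"], goal_cases init time safe body exit)
  case init
  show ?case using state v by (simp add: queue_extends_def scan_state_init)
next
  case time
  show ?case using v by (simp add: out_degree_last_out)
next
  case (body \<sigma>' \<mu>')
  note same = body(1) and inv = body(2)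
  obtain e where e: "\<sigma>' Edge = Suc e" using body(3) by (cases "\<sigma>' Edge") auto
  have env: "sizes \<sigma>'" "\<sigma>' Source = s" "\<sigma>' Vertex = v" "adjacency \<mu>'" "h < \<sigma>' Tail" "\<mu>' Queue s h = v"
    using sizes_unchanged[OF assms(1) same] adjacency_unchanged[OF assms(2) same] s v state(2) inv
    by (auto simp: unchangedD(1)[OF same] queue_extends_def)
  have "out_degree endpoint (\<sigma>' Edge) v = out_degree endpoint (last_out endpoint e v) v + 1"
    using e inv by (simp add: scan_state_def out_degree_last_out)
  then show ?case
    using inv queue_extends_trans env s(1) e
    by (intro runs_weaken[OF runs_scan_edge[of \<sigma>' \<mu>' s h v e]]) auto
next
  case (exit \<sigma>' \<mu>')
  then show ?case using scan_state_end[of s v \<sigma>' \<mu>'] by simp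
qed simp

lemma runs_bfs_init:
  assumes "sizes \<sigma>" and s: "s < n" "\<sigma> Source = s" and entries: "\<And>i. \<mu> Queue s i < n"
  shows "runs bfs_init \<sigma> \<mu> (20 * n + 30) (\<lambda>\<sigma>' \<mu>'. bfs_state s 0 \<sigma>' \<mu>' \<and> \<sigma>' Head = 0 \<and> \<sigma>' Tail = 1 \<and>
     (\<forall>s'. s' \<noteq> s \<longrightarrow> \<mu>' Queue s' = \<mu> Queue s' \<and> \<mu>' Dist s' = \<mu> Dist s'))"
  unfolding bfs_init_def
proof (rule runs_Seq)
  show "runs (fill Dist (Var Source) Vertex VertexCount (Lit 2 \<otimes> Var VertexCount)) \<sigma> \<mu> (20 * n + 6)
      (\<lambda>\<sigma>' \<mu>'. (\<forall>j<n. \<mu>' Dist s j = 2 * n) \<and> (\<forall>r'. r' \<noteq> s \<longrightarrow> \<mu>' Dist r' = \<mu> Dist r'))"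
    using assms by (intro runs_fill) (auto simp: sizes_def unchanged_def fits_def small_less_word)
  fix \<sigma>' \<mu>'
  assume same: "unchanged (fill Dist (Var Source) Vertex VertexCount (Lit 2 \<otimes> Var VertexCount)) \<sigma> \<mu> \<sigma>' \<mu>'"
    and filled: "(\<forall>j<n. \<mu>' Dist s j = 2 * n) \<and> (\<forall>r'. r' \<noteq> s \<longrightarrow> \<mu>' Dist r' = \<mu> Dist r')"
  have "bfs_queue s 1 ((\<mu> Queue s)(0 := s)) ((\<mu>' Dist s)(s := 0))"
    using filled s(1) by (intro bfs_queue_init) auto
  moreover have "bfs_frontier s 0 1 ((\<mu> Queue s)(0 := s))" by (rule bfs_frontier_init) simp
  moreover have "\<sigma>' Source = s" "\<mu>' Queue = \<mu> Queue" using same s(2) by (simp_all add: unchanged_def)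
  ultimately show "runs (Put Dist (Var Source) (Var Source) (Lit 0);; Put Queue (Var Source) (Lit 0) (Var Source);;
      Head ::= Lit 0;; Tail ::= Lit 1) \<sigma>' \<mu>' 24 (\<lambda>\<sigma>' \<mu>'. bfs_state s 0 \<sigma>' \<mu>' \<and> \<sigma>' Head = 0 \<and> \<sigma>' Tail = 1 \<and>
     (\<forall>s'. s' \<noteq> s \<longrightarrow> \<mu>' Queue s' = \<mu> Queue s' \<and> \<mu>' Dist s' = \<mu> Dist s'))"
    using filled entries s n_pos by (intro runs_straight) (auto simp: bfs_state_def fits_def)
qed simp

definition bfs_weight :: "nat \<Rightarrow> nat" where
  "bfs_weight v = 120 * out_degree endpoint (2 * m) v + 40"

lemma sum_bfs_weight: "(\<Sum>v<n. bfs_weight v) = 240 * m + 40 * n"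
  using sum_out_degree[of "2 * m" endpoint n] endpoint_less
  by (simp add: bfs_weight_def sum.distrib flip: sum_distrib_left)

lemma sum_unprocessed_split:
  fixes f :: "nat \<Rightarrow> nat"
  assumes "bfs_queue s t Q L" "h < t"
  shows "sum f ({..<n} - Q ` {..<h}) = f (Q h) + sum f ({..<n} - Q ` {..<Suc h})"
proof -
  have queue: "inj_on Q {..<t}" "Q h < n" using assms by (auto simp: bfs_queue_def)
  then have "Q h \<notin> Q ` {..<h}" using assms(2) by (auto dest: inj_onD)
  then have split: "{..<n} - Q ` {..<h} = insert (Q h) ({..<n} - Q ` {..<Suc h})"
    using queue(2) by (auto simp: lessThan_Suc)
  show ?thesis unfolding split by (subst sum.insert) auto
qed

definition bfs_inv :: "nat \<Rightarrow> (arr \<Rightarrow> nat \<Rightarrow> nat \<Rightarrow> nat) \<Rightarrow> (var \<Rightarrow> nat) \<Rightarrow> (arr \<Rightarrow> nat \<Rightarrow> nat \<Rightarrow> nat) \<Rightarrow> bool" where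
  "bfs_inv s \<mu>\<^sub>0 \<sigma> \<mu> \<longleftrightarrow> bfs_state s (\<sigma> Head) \<sigma> \<mu> \<and> \<sigma> Head \<le> \<sigma> Tail \<and>
     (\<forall>s'. s' \<noteq> s \<longrightarrow> \<mu> Queue s' = \<mu>\<^sub>0 Queue s' \<and> \<mu> Dist s' = \<mu>\<^sub>0 Dist s')"

definition bfs_remaining :: "nat \<Rightarrow> (var \<Rightarrow> nat) \<Rightarrow> (arr \<Rightarrow> nat \<Rightarrow> nat \<Rightarrow> nat) \<Rightarrow> nat" where
  "bfs_remaining s \<sigma> \<mu> = sum bfs_weight ({..<n} - \<mu> Queue s ` {..<\<sigma> Head})"

lemma runs_process_head:
  assumes "sizes \<sigma>" and adj: "adjacency \<mu>" and s: "s < n" "\<sigma> Source = s"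
    and inv: "bfs_inv s \<mu>\<^sub>0 \<sigma> \<mu>" and head: "\<sigma> Head < \<sigma> Tail"
  shows "runs ((Vertex ::= Cell Queue (Var Source) (Var Head);; Edge ::= Elem First (Var Vertex));;
      scan_edges;; Head ::= Var Head \<oplus> Lit 1) \<sigma> \<mu> (bfs_weight (\<mu> Queue s (\<sigma> Head)) - 10)
    (\<lambda>\<sigma>' \<mu>'. bfs_inv s \<mu>\<^sub>0 \<sigma>' \<mu>' \<and> bfs_remaining s \<sigma> \<mu> = bfs_weight (\<mu> Queue s (\<sigma> Head)) + bfs_remaining s \<sigma>' \<mu>')"
    (is "runs _ _ _ _ ?Q")
proof -
  define h where "h = \<sigma> Head"
  define v where "v = \<mu> Queue s h"
  let ?\<sigma> = "\<sigma>(Vertex := v, Edge := last_out endpoint (2 * m) v)"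
  have queue: "bfs_queue s (\<sigma> Tail) (\<mu> Queue s) (\<mu> Dist s)" and state: "bfs_state s h \<sigma> \<mu>"
    using inv by (auto simp: bfs_inv_def bfs_state_def h_def)
  have small: "v < n" "h < n"
    using queue head bfs_queue_length_le[OF queue] by (auto simp: bfs_queue_def v_def h_def)
  have "runs (scan_edges;; Head ::= Var Head \<oplus> Lit 1) ?\<sigma> \<mu> (120 * out_degree endpoint (2 * m) v + 6) ?Q"
  proof (rule runs_Seq[where T' = 4])
    show "runs scan_edges ?\<sigma> \<mu> (120 * out_degree endpoint (2 * m) v + 2) (\<lambda>\<sigma>' \<mu>'. bfs_state s h \<sigma>' \<mu>' \<and>
        queue_extends s ?\<sigma> \<mu> \<sigma>' \<mu>' \<and> (\<forall>u. {v, u} \<in> E \<longrightarrow> u \<in> queued s \<sigma>' \<mu>'))"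
      using assms state by (intro runs_scan_edges) (auto simp: sizes_def v_def h_def bfs_state_upd)
    fix \<sigma>' \<mu>'
    assume same: "unchanged scan_edges ?\<sigma> \<mu> \<sigma>' \<mu>'" and scanned: "bfs_state s h \<sigma>' \<mu>' \<and>
        queue_extends s ?\<sigma> \<mu> \<sigma>' \<mu>' \<and> (\<forall>u. {v, u} \<in> E \<longrightarrow> u \<in> queued s \<sigma>' \<mu>')"
    have prefix: "h < \<sigma>' Tail" "\<And>i. i \<le> h \<Longrightarrow> \<mu>' Queue s i = \<mu> Queue s i"
      using scanned head by (auto simp: queue_extends_def h_def)
    then have processed: "\<mu>' Queue s ` {..<Suc h} = \<mu> Queue s ` {..<Suc h}" by (intro image_cong) auto
    have "bfs_frontier s (Suc h) (\<sigma>' Tail) (\<mu>' Queue s)"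
      using scanned prefix s(1) by (intro bfs_frontier_advance) (auto simp: bfs_state_def queued_def v_def)
    then have "bfs_inv s \<mu>\<^sub>0 (\<sigma>'(Head := Suc h)) \<mu>'"
      using scanned inv prefix(1) by (auto simp: bfs_inv_def bfs_state_def queue_extends_def)
    moreover have "bfs_remaining s \<sigma> \<mu> = bfs_weight (\<mu> Queue s h) + bfs_remaining s (\<sigma>'(Head := Suc h)) \<mu>'"
      using sum_unprocessed_split[OF queue head, of bfs_weight] processed by (simp add: bfs_remaining_def h_def)
    moreover have "\<sigma>' Head = h" using same by (simp add: unchanged_def h_def)
    ultimately show "runs (Head ::= Var Head \<oplus> Lit 1) \<sigma>' \<mu>' 4 ?Q"
      using small by (intro runs_straight) (simp_all add: small_less_word flip: h_def Suc_eq_plus1)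
  qed simp
  then show ?thesis
    using adj s small
    by (intro runs_Seq_straight[where T = "120 * out_degree endpoint (2 * m) v + 6"])
      (simp_all add: fits_def adjacency_def bfs_weight_def flip: h_def v_def)
qed

lemma runs_bfs_loop:
  assumes "sizes \<sigma>" "adjacency \<mu>" and s: "s < n" "\<sigma> Source = s"
    and inv: "bfs_inv s \<mu>\<^sub>0 \<sigma> \<mu>" and head: "\<sigma> Head = 0"
  shows "runs bfs_loop \<sigma> \<mu> (240 * m + 40 * n + 4) (\<lambda>\<sigma>' \<mu>'. bfs_inv s \<mu>\<^sub>0 \<sigma>' \<mu>' \<and> \<sigma>' Head = \<sigma>' Tail)"
  unfolding bfs_loop_def
proof (rule runs_Loop[where I = "bfs_inv s \<mu>\<^sub>0" and \<Phi> = "bfs_remaining s"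
      and C = "\<lambda>\<sigma>' \<mu>'. bfs_weight (\<mu>' Queue s (\<sigma>' Head)) - 10"], goal_cases init time safe body exit)
  case init
  show ?case by (rule inv)
next
  case time
  show ?case using sum_bfs_weight head by (simp add: bfs_remaining_def)
next
  case (body \<sigma>' \<mu>')
  note same = body(1)
  have env: "sizes \<sigma>'" "adjacency \<mu>'" "\<sigma>' Source = s" "\<sigma>' Head < \<sigma>' Tail"
    using sizes_unchanged[OF assms(1) same] adjacency_unchanged[OF assms(2) same] s body(3)
    by (auto simp: unchangedD(1)[OF same])
  have "10 \<le> bfs_weight (\<mu>' Queue s (\<sigma>' Head))" by (simp add: bfs_weight_def)
  then show ?case
    by (intro runs_weaken[OF runs_process_head[OF env(1,2) s(1) env(3) body(2) env(4)] order_refl]) auto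
next
  case (exit \<sigma>' \<mu>')
  then show ?case by (auto simp: bfs_inv_def)
qed simp

definition explored :: "(arr \<Rightarrow> nat \<Rightarrow> nat \<Rightarrow> nat) \<Rightarrow> nat \<Rightarrow> bool" where
  "explored \<mu> s \<longleftrightarrow> (\<forall>u<n. \<mu> Dist s u = d s u) \<and> (\<forall>i. \<mu> Queue s i < n) \<and>
      nearest_row q s (\<mu> Queue s) (\<mu> Unhit 0 s \<noteq> 0)"

lemma runs_bfs:
  assumes "sizes \<sigma>" "adjacency \<mu>" and s: "s < n" "\<sigma> Source = s" and entries: "\<And>i. \<mu> Queue s i < n"
  shows "runs bfs \<sigma> \<mu> (240 * m + 60 * n + 50) (\<lambda>\<sigma>' \<mu>'. explored \<mu>' s \<and>
     (\<forall>s'. s' \<noteq> s \<longrightarrow> \<mu>' Queue s' = \<mu> Queue s' \<and> \<mu>' Dist s' = \<mu> Dist s' \<and> \<mu>' Unhit 0 s' = \<mu> Unhit 0 s'))"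
    (is "runs _ _ _ _ ?Q")
  unfolding bfs_def
proof (rule runs_Seq[OF runs_bfs_init[of \<sigma> s \<mu>, OF assms(1) s entries]])
  let ?full = "Put_Elem Unhit (Var Source) (Lit 1 \<ominus> (Var Tail \<prec> Var RowLength))"
  fix \<sigma>1 \<mu>1
  assume init_same: "unchanged bfs_init \<sigma> \<mu> \<sigma>1 \<mu>1" and init: "bfs_state s 0 \<sigma>1 \<mu>1 \<and> \<sigma>1 Head = 0 \<and> \<sigma>1 Tail = 1 \<and>
     (\<forall>s'. s' \<noteq> s \<longrightarrow> \<mu>1 Queue s' = \<mu> Queue s' \<and> \<mu>1 Dist s' = \<mu> Dist s')"
  have env: "sizes \<sigma>1" "adjacency \<mu>1" "\<sigma>1 Source = s"
    using sizes_unchanged[OF assms(1) init_same] adjacency_unchanged[OF assms(2) init_same] s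
    by (auto simp: unchangedD(1)[OF init_same])
  have "bfs_inv s \<mu> \<sigma>1 \<mu>1" using init by (simp add: bfs_inv_def)
  then show "runs (bfs_loop;; ?full) \<sigma>1 \<mu>1 (240 * m + 40 * n + 17) ?Q"
  proof (rule runs_Seq[OF runs_bfs_loop[OF env(1,2) s(1) env(3)]])
    fix \<sigma>2 \<mu>2
    assume same: "unchanged bfs_loop \<sigma>1 \<mu>1 \<sigma>2 \<mu>2" and loop: "bfs_inv s \<mu> \<sigma>2 \<mu>2 \<and> \<sigma>2 Head = \<sigma>2 Tail"
    have queue: "bfs_queue s (\<sigma>2 Tail) (\<mu>2 Queue s) (\<mu>2 Dist s)"
      "bfs_frontier s (\<sigma>2 Tail) (\<sigma>2 Tail) (\<mu>2 Queue s)"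
      "\<And>i. \<mu>2 Queue s i < n"
      using loop by (auto simp: bfs_inv_def bfs_state_def)
    have "\<sigma>2 Source = s" "\<sigma>2 RowLength = q" "\<mu>2 Unhit = \<mu> Unhit"
      using same init_same env by (simp_all add: unchanged_def sizes_def)
    then show "runs ?full \<sigma>2 \<mu>2 13 ?Q"
      using s(1) bfs_labels[OF queue(1,2) s(1)] bfs_nearest_row[OF queue(1,2) s(1), of q] queue(3) loop
      by (intro runs_straight; cases "q \<le> \<sigma>2 Tail") (auto simp: fits_def explored_def bfs_inv_def not_less)
  qed (use init in auto)
qed simp

definition tables_computed :: "(arr \<Rightarrow> nat \<Rightarrow> nat \<Rightarrow> nat) \<Rightarrow> bool" where
  "tables_computed \<mu> \<longleftrightarrow> (\<forall>s<n. explored \<mu> s)"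

lemma explored_cong:
  assumes "\<mu>' Dist s = \<mu> Dist s" "\<mu>' Queue s = \<mu> Queue s" "\<mu>' Unhit 0 s = \<mu> Unhit 0 s"
  shows "explored \<mu>' s \<longleftrightarrow> explored \<mu> s"
  using assms by (simp add: explored_def)

lemma runs_apsp:
  assumes "sizes \<sigma>" and ends: "\<And>e. e < 2 * m \<Longrightarrow> \<mu> Ends 0 e = endpoint e"
    and zero: "\<And>v. v < n \<Longrightarrow> \<mu> First 0 v = 0" "\<And>s i. \<mu> Queue s i = 0"
  shows "runs apsp \<sigma> \<mu> (100 * m + n * (240 * m + 60 * n + 58) + 12) (\<lambda>\<sigma>' \<mu>'. tables_computed \<mu>')"
  unfolding apsp_def
proof (rule runs_Seq[OF runs_link_half_edges[of \<sigma> \<mu>, OF assms(1) ends zero(1)]])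
  fix \<sigma>1 \<mu>1
  assume same: "unchanged link_half_edges \<sigma> \<mu> \<sigma>1 \<mu>1" and adj: "adjacency \<mu>1"
  have sizes1: "sizes \<sigma>1" using sizes_unchanged[OF assms(1) same] by (simp add: link_half_edges_def)
  let ?I = "\<lambda>j (\<sigma>' :: var \<Rightarrow> nat) \<mu>'. (\<forall>s<j. explored \<mu>' s) \<and> (\<forall>s i. s \<ge> j \<longrightarrow> \<mu>' Queue s i = 0)"
  have "runs (for_range Source VertexCount bfs) \<sigma>1 \<mu>1 (n * (240 * m + 60 * n + 58) + 6) (?I n)"
  proof (rule runs_for_range[where I = ?I and C = "240 * m + 60 * n + 50"])
    fix s \<sigma>2 \<mu>2
    assume s: "s < n" "\<sigma>2 Source = s" and same2: "unchanged (for_range Source VertexCount bfs) \<sigma>1 \<mu>1 \<sigma>2 \<mu>2"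
      and inv: "?I s \<sigma>2 \<mu>2"
    have env: "sizes \<sigma>2" "adjacency \<mu>2"
      using sizes_unchanged[OF sizes1 same2] adjacency_unchanged[OF adj same2] by auto
    show "runs bfs \<sigma>2 \<mu>2 (240 * m + 60 * n + 50) (\<lambda>\<sigma>'' \<mu>''. ?I (Suc s) (\<sigma>''(Source := Suc s)) \<mu>'')"
    proof (rule runs_weaken[OF runs_bfs[of \<sigma>2 \<mu>2, OF env s] order_refl])
      show "\<mu>2 Queue s i < n" for i using inv n_pos by simp
      fix \<sigma>3 \<mu>3
      assume post: "explored \<mu>3 s \<and> (\<forall>s'. s' \<noteq> s \<longrightarrow> \<mu>3 Queue s' = \<mu>2 Queue s' \<and> \<mu>3 Dist s' = \<mu>2 Dist s' \<and>
        \<mu>3 Unhit 0 s' = \<mu>2 Unhit 0 s')"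
      have "explored \<mu>3 s'" if "s' < s" for s'
        using explored_cong[of \<mu>3 s' \<mu>2] post inv that by simp
      then show "?I (Suc s) (\<sigma>3(Source := Suc s)) \<mu>3"
        using post inv by (simp add: less_Suc_eq)
    qed
  qed (use sizes1 zero same in \<open>auto simp: sizes_def small_less_word algebra_simps unchanged_def link_half_edges_def\<close>)
  then show "runs (for_range Source VertexCount bfs) \<sigma>1 \<mu>1 (n * (240 * m + 60 * n + 58) + 6)
    (\<lambda>\<sigma>' \<mu>'. tables_computed \<mu>')"
    by (rule runs_weaken) (auto simp: tables_computed_def)
qed auto

end

section \<open>Computing a hitting set\<close>

definition tally_row :: "(var, arr) com" where
  "tally_row = for_range Index RowLength (Put_Elem Tally (Cell Queue (Var Vertex) (Var Index))
     (Elem Tally (Cell Queue (Var Vertex) (Var Index)) \<oplus> Lit 1))"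

definition tally_rows :: "(var, arr) com" where
  "tally_rows = for_range Vertex VertexCount (Branch (Elem Unhit (Var Vertex)) tally_row Skip)"

definition tally :: "(var, arr) com" where
  "tally = fill Tally (Lit 0) Vertex VertexCount (Lit 0);; tally_rows"

definition clear_row :: "(var, arr) com" where
  "clear_row = for_range Index RowLength
     (Branch (Cell Queue (Var Vertex) (Var Index) \<doteq> Var ArgBest) (Put_Elem Unhit (Var Vertex) (Lit 0)) Skip)"

definition clear_hit :: "(var, arr) com" where
  "clear_hit = for_range Vertex VertexCount clear_row"

definition record_hitter :: "(var, arr) com" where
  "record_hitter =
     (Put_Elem Hitters (Var HitterCount) (Var ArgBest);; HitterCount ::= Var HitterCount \<oplus> Lit 1);; clear_hit"

definition greedy_round :: "(var, arr) com" where
  "greedy_round = tally;; argmax Vertex VertexCount (Lit 1) (Elem Tally (Var Vertex)) Best ArgBest;;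
     Branch (Var Best) record_hitter Skip"

definition greedy :: "(var, arr) com" where
  "greedy = (HitterCount ::= Lit 0;; Best ::= Lit 1);; Loop (Var Best) greedy_round"

lemma tally_effects [simp]:
  "writes tally_row = {Index}" "stores tally_row = {Tally}"
  "writes tally_rows = {Vertex, Index}" "stores tally_rows = {Tally}"
  "writes tally = {Vertex, Index}" "stores tally = {Tally}"
  by (auto simp: tally_row_def tally_rows_def tally_def)

lemma clear_effects [simp]:
  "writes clear_row = {Index}" "stores clear_row = {Unhit}"
  "writes clear_hit = {Vertex, Index}" "stores clear_hit = {Unhit}"
  by (auto simp: clear_row_def clear_hit_def)

lemma greedy_effects [simp]:
  "writes record_hitter = {Vertex, Index, HitterCount}" "stores record_hitter = {Hitters, Unhit}"
  "writes greedy_round = {Vertex, Index, Best, ArgBest, HitterCount}"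
    "stores greedy_round = {Tally, Hitters, Unhit}"
  "writes greedy = {Vertex, Index, Best, ArgBest, HitterCount}" "stores greedy = {Tally, Hitters, Unhit}"
  by (auto simp: record_hitter_def greedy_round_def greedy_def)

context kcenter_input begin

definition near_row :: "(arr \<Rightarrow> nat \<Rightarrow> nat \<Rightarrow> nat) \<Rightarrow> nat \<Rightarrow> nat set" where
  "near_row \<mu> v = \<mu> Queue v ` {..<q}"

definition unhit :: "(arr \<Rightarrow> nat \<Rightarrow> nat \<Rightarrow> nat) \<Rightarrow> nat set" where
  "unhit \<mu> = {v. v < n \<and> \<mu> Unhit 0 v \<noteq> 0}"

definition hitters :: "nat \<Rightarrow> (arr \<Rightarrow> nat \<Rightarrow> nat \<Rightarrow> nat) \<Rightarrow> nat set" where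
  "hitters sz \<mu> = \<mu> Hitters 0 ` {..<sz}"

definition rows_valid :: "(arr \<Rightarrow> nat \<Rightarrow> nat \<Rightarrow> nat) \<Rightarrow> bool" where
  "rows_valid \<mu> \<longleftrightarrow> (\<forall>v<n. \<forall>i. \<mu> Queue v i < n) \<and> (\<forall>v\<in>unhit \<mu>. inj_on (\<mu> Queue v) {..<q})"

lemma finite_unhit [simp]: "finite (unhit \<mu>)"
  by (simp add: unhit_def)

lemma card_unhit_le: "card (unhit \<mu>) \<le> n"
  using card_mono[of "{..<n}" "unhit \<mu>"] by (auto simp: unhit_def)

lemma runs_tally_row:
  assumes "sizes \<sigma>" "rows_valid \<mu>" and v: "v \<in> unhit \<mu>" "\<sigma> Vertex = v"
    and tally: "\<And>u. u < n \<Longrightarrow> \<mu> Tally 0 u = c u" "\<And>u. c u \<le> n"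
  shows "runs tally_row \<sigma> \<mu> (q * 40 + 6) (\<lambda>\<sigma>' \<mu>'. \<forall>u<n. \<mu>' Tally 0 u = c u + of_bool (u \<in> near_row \<mu> v))"
  unfolding tally_row_def near_row_def
proof (rule runs_for_range[where C = 32
      and I = "\<lambda>i \<sigma>' \<mu>'. \<forall>u<n. \<mu>' Tally 0 u = c u + of_bool (u \<in> \<mu> Queue v ` {..<i})"])
  let ?entry = "Cell Queue (Var Vertex) (Var Index) :: (var, arr) expr"
  let ?incr = "Put_Elem Tally ?entry (Elem Tally ?entry \<oplus> Lit 1)"
  fix i \<sigma>' \<mu>'
  assume i: "i < q" "\<sigma>' Index = i" and same: "unchanged (for_range Index RowLength ?incr) \<sigma> \<mu> \<sigma>' \<mu>'"
    and inv: "\<forall>u<n. \<mu>' Tally 0 u = c u + of_bool (u \<in> \<mu> Queue v ` {..<i})"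
  have vn: "v < n" and entry: "\<mu> Queue v i < n" and inj: "inj_on (\<mu> Queue v) {..<q}"
    using v(1) assms(2) by (auto simp: unhit_def rows_valid_def)
  have "\<sigma>' Vertex = v" "\<mu>' Queue = \<mu> Queue" using same v(2) by (auto simp: unchanged_def)
  moreover have "\<mu> Queue v i \<notin> \<mu> Queue v ` {..<i}" using inj i(1) by (auto dest: inj_onD)
  moreover have "c u + 1 < 2 ^ w" for u using tally(2)[of u] by (intro small_less_word) simp
  ultimately show "runs ?incr \<sigma>' \<mu>' 32
      (\<lambda>\<sigma>'' \<mu>''. \<forall>u<n. \<mu>'' Tally 0 u = c u + of_bool (u \<in> \<mu> Queue v ` {..<Suc i}))"
    using i vn entry inv q_le by (intro runs_straight) (auto simp: fits_def lessThan_Suc)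
qed (use assms q_le in \<open>auto simp: sizes_def small_less_word\<close>)

lemma card_less_Suc:
  fixes A :: "nat set"
  shows "card {v\<in>A. v < Suc j \<and> P v} = card {v\<in>A. v < j \<and> P v} + of_bool (j \<in> A \<and> P j)"
proof -
  have "{v\<in>A. v < Suc j \<and> P v} = {v\<in>A. v < j \<and> P v} \<union> (if j \<in> A \<and> P j then {j} else {})"
    by (auto simp: less_Suc_eq)
  then show ?thesis by simp
qed

lemma runs_tally_rows:
  assumes "sizes \<sigma>" "rows_valid \<mu>" and "\<And>u. u < n \<Longrightarrow> \<mu> Tally 0 u = 0"
  shows "runs tally_rows \<sigma> \<mu> (n * (q * 40 + 23) + 6)
    (\<lambda>\<sigma>' \<mu>'. \<forall>u<n. \<mu>' Tally 0 u = card {v\<in>unhit \<mu>. v < n \<and> u \<in> near_row \<mu> v})"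
  unfolding tally_rows_def
proof (rule runs_for_range[where C = "q * 40 + 15"
      and I = "\<lambda>j \<sigma>' \<mu>'. \<forall>u<n. \<mu>' Tally 0 u = card {v\<in>unhit \<mu>. v < j \<and> u \<in> near_row \<mu> v}"])
  let ?hits = "\<lambda>j u. card {v\<in>unhit \<mu>. v < j \<and> u \<in> near_row \<mu> v}"
  let ?body = "Branch (Elem Unhit (Var Vertex)) tally_row Skip"
  fix j \<sigma>' \<mu>'
  assume j: "j < n" "\<sigma>' Vertex = j" and same: "unchanged (for_range Vertex VertexCount ?body) \<sigma> \<mu> \<sigma>' \<mu>'"
    and inv: "\<forall>u<n. \<mu>' Tally 0 u = ?hits j u"
  have arrays: "\<mu>' Unhit = \<mu> Unhit" "\<mu>' Queue = \<mu> Queue" using same by (auto simp: unchanged_def)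
  then have same_rows: "unhit \<mu>' = unhit \<mu>" "near_row \<mu>' = near_row \<mu>" "rows_valid \<mu>' = rows_valid \<mu>"
    by (auto simp: unhit_def near_row_def rows_valid_def)
  have sizes': "sizes \<sigma>'" using sizes_unchanged[OF assms(1) same] by simp
  show "runs ?body \<sigma>' \<mu>' (q * 40 + 15) (\<lambda>\<sigma>'' \<mu>''. \<forall>u<n. \<mu>'' Tally 0 u = ?hits (Suc j) u)"
  proof (rule runs_Branch[where T = "q * 40 + 6"])
    assume "val (Elem Unhit (Var Vertex)) \<sigma>' \<mu>' \<noteq> 0"
    then have "j \<in> unhit \<mu>" using j arrays by (simp add: unhit_def)
    moreover have "?hits j u \<le> n" for u
      using card_unhit_le[of \<mu>] card_mono[OF finite_unhit[of \<mu>], of "{v\<in>unhit \<mu>. v < j \<and> u \<in> near_row \<mu> v}"]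
      by auto
    ultimately show "runs tally_row \<sigma>' \<mu>' (q * 40 + 6) (\<lambda>\<sigma>'' \<mu>''. \<forall>u<n. \<mu>'' Tally 0 u = ?hits (Suc j) u)"
      using sizes' j inv assms(2) same_rows card_less_Suc[of "unhit \<mu>" j]
      by (intro runs_weaken[OF runs_tally_row[of \<sigma>' \<mu>' j "?hits j"]]) auto
  next
    assume "val (Elem Unhit (Var Vertex)) \<sigma>' \<mu>' = 0"
    then show "runs Skip \<sigma>' \<mu>' (q * 40 + 6) (\<lambda>\<sigma>'' \<mu>''. \<forall>u<n. \<mu>'' Tally 0 u = ?hits (Suc j) u)"
      using j arrays inv card_less_Suc[of "unhit \<mu>" j] by (intro runs_straight) (auto simp: unhit_def)
  qed (use j in \<open>auto simp: fits_def\<close>)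
qed (use assms in \<open>auto simp: sizes_def small_less_word\<close>)

lemma runs_tally:
  assumes "sizes \<sigma>" "rows_valid \<mu>"
  shows "runs tally \<sigma> \<mu> (n * (q * 40 + 40) + 12)
    (\<lambda>\<sigma>' \<mu>'. \<forall>u<n. \<mu>' Tally 0 u = card {v\<in>unhit \<mu>. u \<in> near_row \<mu> v})"
  unfolding tally_def
proof (rule runs_Seq)
  let ?clear = "fill Tally (Lit 0) Vertex VertexCount (Lit 0) :: (var, arr) com"
  show "runs ?clear \<sigma> \<mu> (n * 17 + 6)
      (\<lambda>\<sigma>' \<mu>'. (\<forall>j<n. \<mu>' Tally 0 j = 0) \<and> (\<forall>r'. r' \<noteq> 0 \<longrightarrow> \<mu>' Tally r' = \<mu> Tally r'))"
    using assms by (intro runs_fill) (auto simp: sizes_def fits_def small_less_word)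
  fix \<sigma>1 \<mu>1
  assume same: "unchanged ?clear \<sigma> \<mu> \<sigma>1 \<mu>1"
    and zero: "(\<forall>j<n. \<mu>1 Tally 0 j = 0) \<and> (\<forall>r'. r' \<noteq> 0 \<longrightarrow> \<mu>1 Tally r' = \<mu> Tally r')"
  have "\<mu>1 Unhit = \<mu> Unhit" "\<mu>1 Queue = \<mu> Queue" using same by (auto simp: unchanged_def)
  then have same_rows: "unhit \<mu>1 = unhit \<mu>" "near_row \<mu>1 = near_row \<mu>" "rows_valid \<mu>1 = rows_valid \<mu>"
    by (auto simp: unhit_def near_row_def rows_valid_def)
  have "{v\<in>unhit \<mu>. v < n \<and> u \<in> near_row \<mu> v} = {v\<in>unhit \<mu>. u \<in> near_row \<mu> v}" for u by (auto simp: unhit_def)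
  then show "runs tally_rows \<sigma>1 \<mu>1 (n * (q * 40 + 23) + 6)
      (\<lambda>\<sigma>' \<mu>'. \<forall>u<n. \<mu>' Tally 0 u = card {v\<in>unhit \<mu>. u \<in> near_row \<mu> v})"
    using runs_tally_rows[of \<sigma>1 \<mu>1] sizes_unchanged[OF assms(1) same] assms(2) zero same_rows by simp
qed (simp add: algebra_simps)

lemma runs_clear_row:
  assumes "sizes \<sigma>" and v: "v < n" "\<sigma> Vertex = v"
  shows "runs clear_row \<sigma> \<mu> (q * 28 + 6)
    (\<lambda>\<sigma>' \<mu>'. \<mu>' Unhit 0 = (\<mu> Unhit 0)(v := if \<sigma> ArgBest \<in> near_row \<mu> v then 0 else \<mu> Unhit 0 v))"
  unfolding clear_row_def near_row_def
proof (rule runs_for_range[where C = 20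
      and I = "\<lambda>i \<sigma>' \<mu>'. \<mu>' Unhit 0 = (\<mu> Unhit 0)(v := if \<sigma> ArgBest \<in> \<mu> Queue v ` {..<i} then 0 else \<mu> Unhit 0 v)"])
  let ?body = "Branch (Cell Queue (Var Vertex) (Var Index) \<doteq> Var ArgBest) (Put_Elem Unhit (Var Vertex) (Lit 0)) Skip"
  fix i \<sigma>' \<mu>'
  assume i: "i < q" "\<sigma>' Index = i" and same: "unchanged (for_range Index RowLength ?body) \<sigma> \<mu> \<sigma>' \<mu>'"
    and inv: "\<mu>' Unhit 0 = (\<mu> Unhit 0)(v := if \<sigma> ArgBest \<in> \<mu> Queue v ` {..<i} then 0 else \<mu> Unhit 0 v)"
  have "\<sigma>' Vertex = v" "\<sigma>' ArgBest = \<sigma> ArgBest" "\<mu>' Queue = \<mu> Queue" using same v(2)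
    by (auto simp: unchanged_def)
  then show "runs ?body \<sigma>' \<mu>' 20 (\<lambda>\<sigma>'' \<mu>''. \<mu>'' Unhit 0 =
      (\<mu> Unhit 0)(v := if \<sigma> ArgBest \<in> \<mu> Queue v ` {..<Suc i} then 0 else \<mu> Unhit 0 v))"
    using i v(1) inv q_le by (intro runs_straight) (auto simp: fits_def lessThan_Suc)
qed (use assms q_le in \<open>auto simp: sizes_def small_less_word\<close>)

lemma runs_clear_hit:
  assumes "sizes \<sigma>"
  shows "runs clear_hit \<sigma> \<mu> (n * (q * 28 + 14) + 6) (\<lambda>\<sigma>' \<mu>'. unhit \<mu>' = {v\<in>unhit \<mu>. \<sigma> ArgBest \<notin> near_row \<mu> v})"
  unfolding clear_hit_def
proof (rule runs_weaken)
  show "runs (for_range Vertex VertexCount clear_row) \<sigma> \<mu> (n * (q * 28 + 14) + 6)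
      (\<lambda>\<sigma>' \<mu>'. \<forall>v<n. \<mu>' Unhit 0 v = (if \<sigma> ArgBest \<in> near_row \<mu> v \<and> v < n then 0 else \<mu> Unhit 0 v))"
  proof (rule runs_for_range[where C = "q * 28 + 6" and
        I = "\<lambda>j \<sigma>' \<mu>'. \<forall>v<n. \<mu>' Unhit 0 v = (if \<sigma> ArgBest \<in> near_row \<mu> v \<and> v < j then 0 else \<mu> Unhit 0 v)"])
    fix j \<sigma>1 \<mu>1
    assume j: "j < n" "\<sigma>1 Vertex = j" and same: "unchanged (for_range Vertex VertexCount clear_row) \<sigma> \<mu> \<sigma>1 \<mu>1"
      and inv: "\<forall>v<n. \<mu>1 Unhit 0 v = (if \<sigma> ArgBest \<in> near_row \<mu> v \<and> v < j then 0 else \<mu> Unhit 0 v)"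
    have "sizes \<sigma>1" "\<sigma>1 ArgBest = \<sigma> ArgBest" "near_row \<mu>1 = near_row \<mu>"
      using sizes_unchanged[OF assms same] same by (auto simp: unchanged_def near_row_def)
    then show "runs clear_row \<sigma>1 \<mu>1 (q * 28 + 6)
        (\<lambda>\<sigma>2 \<mu>2. \<forall>v<n. \<mu>2 Unhit 0 v = (if \<sigma> ArgBest \<in> near_row \<mu> v \<and> v < Suc j then 0 else \<mu> Unhit 0 v))"
      using j inv by (intro runs_weaken[OF runs_clear_row[of \<sigma>1 j]]) (auto simp: less_Suc_eq)
  qed (use assms in \<open>auto simp: sizes_def small_less_word\<close>)
qed (auto simp: unhit_def split: if_splits)

lemma runs_record_hitter:
  assumes "sizes \<sigma>" and sz: "\<sigma> HitterCount = sz" "sz < n" and a: "\<sigma> ArgBest = a" "a < n"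
  shows "runs record_hitter \<sigma> \<mu> (n * (q * 28 + 14) + 19) (\<lambda>\<sigma>' \<mu>'. \<sigma>' HitterCount = Suc sz \<and>
    hitters (Suc sz) \<mu>' = insert a (hitters sz \<mu>) \<and> unhit \<mu>' = {v\<in>unhit \<mu>. a \<notin> near_row \<mu> v})"
proof -
  let ?\<sigma> = "\<sigma>(HitterCount := Suc sz)" and ?\<mu> = "put Hitters 0 sz a \<mu>"
  have "hitters (Suc sz) ?\<mu> = insert a (hitters sz \<mu>)" by (auto simp: hitters_def lessThan_Suc)
  moreover have "near_row ?\<mu> = near_row \<mu>" "unhit ?\<mu> = unhit \<mu>" by (auto simp: near_row_def unhit_def)
  moreover have "sizes ?\<sigma>" using assms(1) by (simp add: sizes_def)
  ultimately have "runs clear_hit ?\<sigma> ?\<mu> (n * (q * 28 + 14) + 6) (\<lambda>\<sigma>' \<mu>'. \<sigma>' HitterCount = Suc sz \<and>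
    hitters (Suc sz) \<mu>' = insert a (hitters sz \<mu>) \<and> unhit \<mu>' = {v\<in>unhit \<mu>. a \<notin> near_row \<mu> v})"
    using a by (intro runs_weaken[OF runs_clear_hit]) (auto simp: hitters_def unchanged_def)
  then show ?thesis
    unfolding record_hitter_def using sz a
    by (intro runs_Seq_straight) (auto simp: fits_def small_less_word simp flip: Suc_eq_plus1)
qed

lemma greedy_choice:
  assumes U: "finite U" "U \<noteq> {}" and rows: "\<And>v. v \<in> U \<Longrightarrow> r v \<subseteq> {..<n}" "\<And>v. v \<in> U \<Longrightarrow> card (r v) = q"
    and max: "is_argmax n (\<lambda>_. True) (\<lambda>u. card {v\<in>U. u \<in> r v}) b a"
  shows "b \<noteq> 0" "a < n" "card {v\<in>U. a \<notin> r v} < card U"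
    "greedy_potential n q (card {v\<in>U. a \<notin> r v}) + 1 \<le> greedy_potential n q (card U)"
proof -
  have count: "card U * q \<le> n * b"
    using max by (intro card_mult_le_if_hits_le[OF U(1) rows]) (auto simp: is_argmax_def)
  have pos: "0 < card U" using U by (simp add: card_gt_0_iff)
  then have "0 < n * b" using count q_pos by (metis gr0I less_le_trans mult_eq_0_iff not_one_le_zero)
  then show "b \<noteq> 0" by simp
  then have a: "a < n" "card {v\<in>U. a \<in> r v} = b" using max by (auto simp: is_argmax_def)
  show "a < n" by (rule a(1))
  have "{v\<in>U. a \<notin> r v} = U - {v\<in>U. a \<in> r v}" by auto
  then have diff: "card {v\<in>U. a \<notin> r v} = card U - b"
    using U(1) a(2) by (simp add: card_Diff_subset)
  have b_le: "b \<le> card U" using a(2) card_mono[OF U(1), of "{v\<in>U. a \<in> r v}"] by auto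
  then show "card {v\<in>U. a \<notin> r v} < card U" using diff \<open>b \<noteq> 0\<close> by simp
  show "greedy_potential n q (card {v\<in>U. a \<notin> r v}) + 1 \<le> greedy_potential n q (card U)"
    unfolding diff using q_pos q_le pos b_le count by (intro greedy_potential_step) auto
qed

definition greedy_inv :: "(arr \<Rightarrow> nat \<Rightarrow> nat \<Rightarrow> nat) \<Rightarrow> nat \<Rightarrow> (arr \<Rightarrow> nat \<Rightarrow> nat \<Rightarrow> nat) \<Rightarrow> bool" where
  "greedy_inv \<mu>\<^sub>0 sz \<mu> \<longleftrightarrow> sz + card (unhit \<mu>) \<le> n \<and>
     real sz + greedy_potential n q (card (unhit \<mu>)) \<le> greedy_potential n q n \<and>
     hitters sz \<mu> \<subseteq> {..<n} \<and> unhit \<mu> = {v\<in>unhit \<mu>\<^sub>0. hitters sz \<mu> \<inter> near_row \<mu>\<^sub>0 v = {}}"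

lemma greedy_inv_step:
  assumes "rows_valid \<mu>\<^sub>0" and inv: "greedy_inv \<mu>\<^sub>0 sz \<mu>" and ne: "unhit \<mu> \<noteq> {}"
    and max: "is_argmax n (\<lambda>_. True) (\<lambda>u. card {v\<in>unhit \<mu>. u \<in> near_row \<mu>\<^sub>0 v}) b a"
    and hitters': "hitters (Suc sz) \<mu>' = insert a (hitters sz \<mu>)"
    and unhit': "unhit \<mu>' = {v\<in>unhit \<mu>. a \<notin> near_row \<mu>\<^sub>0 v}"
  shows "greedy_inv \<mu>\<^sub>0 (Suc sz) \<mu>'"
proof -
  have "near_row \<mu>\<^sub>0 v \<subseteq> {..<n}" "card (near_row \<mu>\<^sub>0 v) = q" if "v \<in> unhit \<mu>" for v
    using inv assms(1) that by (auto simp: rows_valid_def near_row_def greedy_inv_def unhit_def card_image)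
  from greedy_choice[OF finite_unhit ne this max]
  show ?thesis
    using inv hitters' unhit' unfolding greedy_inv_def by auto
qed

definition greedy_cost :: nat where
  "greedy_cost = n * (q * 68 + 86) + 60"

lemma runs_choose_hitter:
  assumes "sizes \<sigma>" and valid: "rows_valid \<mu>\<^sub>0" and rows: "near_row \<mu> = near_row \<mu>\<^sub>0"
    and inv: "greedy_inv \<mu>\<^sub>0 (\<sigma> HitterCount) \<mu>"
    and max: "is_argmax n (\<lambda>_. True) (\<lambda>u. card {v\<in>unhit \<mu>. u \<in> near_row \<mu>\<^sub>0 v}) (\<sigma> Best) (\<sigma> ArgBest)"
  shows "runs (Branch (Var Best) record_hitter Skip) \<sigma> \<mu> (n * (q * 28 + 14) + 21) (\<lambda>\<sigma>' \<mu>'.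
    greedy_inv \<mu>\<^sub>0 (\<sigma>' HitterCount) \<mu>' \<and>
    (if \<sigma>' Best = 0 then unhit \<mu>' = {} else \<sigma>' HitterCount = Suc (\<sigma> HitterCount)))"
    (is "runs _ _ _ _ ?Q")
proof (rule runs_Branch[where T = "n * (q * 28 + 14) + 19"])
  assume "val (Var Best) \<sigma> \<mu> \<noteq> 0"
  then have best: "\<sigma> Best \<noteq> 0" by simp
  then have arg: "\<sigma> ArgBest < n" "card {v\<in>unhit \<mu>. \<sigma> ArgBest \<in> near_row \<mu>\<^sub>0 v} \<noteq> 0" using max
    by (auto simp: is_argmax_def)
  then have ne: "unhit \<mu> \<noteq> {}" by auto
  then have "0 < card (unhit \<mu>)" by (simp add: card_gt_0_iff)
  then have "\<sigma> HitterCount < n" using inv unfolding greedy_inv_def by linarith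
  with assms(1) arg(1) show "runs record_hitter \<sigma> \<mu> (n * (q * 28 + 14) + 19) ?Q"
  proof (intro runs_weaken[OF runs_record_hitter[OF _ refl _ refl] order_refl])
    fix \<sigma>' \<mu>'
    assume "unchanged record_hitter \<sigma> \<mu> \<sigma>' \<mu>'" and recorded: "\<sigma>' HitterCount = Suc (\<sigma> HitterCount) \<and>
      hitters (Suc (\<sigma> HitterCount)) \<mu>' = insert (\<sigma> ArgBest) (hitters (\<sigma> HitterCount) \<mu>) \<and>
      unhit \<mu>' = {v\<in>unhit \<mu>. \<sigma> ArgBest \<notin> near_row \<mu> v}"
    then have "\<sigma>' Best \<noteq> 0" using best by (simp add: unchanged_def)
    then show "?Q \<sigma>' \<mu>'" using recorded greedy_inv_step[OF valid inv ne max] rows by simp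
  qed
next
  assume "val (Var Best) \<sigma> \<mu> = 0"
  then have best: "\<sigma> Best = 0" by simp
  have "unhit \<mu> = {}"
  proof (rule ccontr)
    assume ne: "unhit \<mu> \<noteq> {}"
    have "near_row \<mu>\<^sub>0 v \<subseteq> {..<n}" "card (near_row \<mu>\<^sub>0 v) = q" if "v \<in> unhit \<mu>" for v
      using inv valid that by (auto simp: rows_valid_def near_row_def greedy_inv_def unhit_def card_image)
    from greedy_choice(1)[OF finite_unhit ne this max] show False using best by simp
  qed
  then show "runs Skip \<sigma> \<mu> (n * (q * 28 + 14) + 19) ?Q" using inv best by (intro runs_straight) auto
qed simp_all

lemma runs_greedy_round:
  assumes "sizes \<sigma>" and valid: "rows_valid \<mu>\<^sub>0" and queue: "\<mu> Queue = \<mu>\<^sub>0 Queue"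
    and inv: "greedy_inv \<mu>\<^sub>0 (\<sigma> HitterCount) \<mu>"
  shows "runs greedy_round \<sigma> \<mu> (greedy_cost - 10) (\<lambda>\<sigma>' \<mu>'. greedy_inv \<mu>\<^sub>0 (\<sigma>' HitterCount) \<mu>' \<and>
    (if \<sigma>' Best = 0 then unhit \<mu>' = {} else \<sigma>' HitterCount = Suc (\<sigma> HitterCount)))"
    (is "runs _ _ _ _ ?Q")
  unfolding greedy_round_def
proof (rule runs_Seq[OF runs_tally[OF assms(1)]])
  have rows: "near_row \<mu> = near_row \<mu>\<^sub>0" using queue by (simp add: near_row_def fun_eq_iff)
  have "unhit \<mu> \<subseteq> unhit \<mu>\<^sub>0" using inv by (auto simp: greedy_inv_def)
  then show "rows_valid \<mu>" using valid queue by (auto simp: rows_valid_def)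
  let ?argmax = "argmax Vertex VertexCount (Lit 1) (Elem Tally (Var Vertex)) Best ArgBest :: (var, arr) com"
  fix \<sigma>1 \<mu>1
  assume same1: "unchanged tally \<sigma> \<mu> \<sigma>1 \<mu>1" and tally: "\<forall>u<n. \<mu>1 Tally 0 u = card {v\<in>unhit \<mu>. u \<in> near_row \<mu> v}"
  have sizes1: "sizes \<sigma>1" using sizes_unchanged[OF assms(1) same1] by simp
  show "runs (?argmax;; Branch (Var Best) record_hitter Skip) \<sigma>1 \<mu>1 (n * (q * 28 + 46) + 31) ?Q"
  proof (rule runs_Seq)
    show "runs ?argmax \<sigma>1 \<mu>1 (n * 32 + 10) (\<lambda>\<sigma>' \<mu>'. is_argmax n (\<lambda>_. True) (\<mu>1 Tally 0) (\<sigma>' Best) (\<sigma>' ArgBest))"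
      using sizes1 by (intro runs_argmax) (auto simp: sizes_def small_less_word fits_def)
    fix \<sigma>2 \<mu>2
    assume same2: "unchanged ?argmax \<sigma>1 \<mu>1 \<sigma>2 \<mu>2"
      and max: "is_argmax n (\<lambda>_. True) (\<mu>1 Tally 0) (\<sigma>2 Best) (\<sigma>2 ArgBest)"
    have arrays: "\<mu>2 Unhit = \<mu> Unhit" "\<mu>2 Hitters = \<mu> Hitters" "\<mu>2 Queue = \<mu> Queue"
      "\<sigma>2 HitterCount = \<sigma> HitterCount"
      using same1 same2 by (simp_all add: unchanged_def)
    then have "unhit \<mu>2 = unhit \<mu>" "near_row \<mu>2 = near_row \<mu>" "greedy_inv \<mu>\<^sub>0 (\<sigma> HitterCount) \<mu>2"
      using inv by (auto simp: unhit_def near_row_def hitters_def greedy_inv_def)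
    moreover have "is_argmax n (\<lambda>_. True) (\<lambda>u. card {v\<in>unhit \<mu>. u \<in> near_row \<mu>\<^sub>0 v}) (\<sigma>2 Best) (\<sigma>2 ArgBest)"
      using max tally rows by (auto simp: is_argmax_def split: if_splits)
    moreover have "sizes \<sigma>2" using sizes_unchanged[OF sizes1 same2] by simp
    ultimately have "runs (Branch (Var Best) record_hitter Skip) \<sigma>2 \<mu>2 (n * (q * 28 + 14) + 21) (\<lambda>\<sigma>' \<mu>'.
        greedy_inv \<mu>\<^sub>0 (\<sigma>' HitterCount) \<mu>' \<and>
        (if \<sigma>' Best = 0 then unhit \<mu>' = {} else \<sigma>' HitterCount = Suc (\<sigma>2 HitterCount)))"
      using valid rows arrays(4) by (intro runs_choose_hitter) (simp_all only:)
    then show "runs (Branch (Var Best) record_hitter Skip) \<sigma>2 \<mu>2 (n * (q * 28 + 14) + 21) ?Q"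
      unfolding arrays(4) .
  qed (simp add: algebra_simps)
qed (simp add: greedy_cost_def algebra_simps)

definition greedy_remaining :: "(var \<Rightarrow> nat) \<Rightarrow> nat" where
  "greedy_remaining \<sigma> = (if \<sigma> Best = 0 then 0 else Suc (max_hitters n q - \<sigma> HitterCount) * greedy_cost)"

lemma greedy_inv_le_max_hitters: "greedy_inv \<mu>\<^sub>0 sz \<mu> \<Longrightarrow> sz \<le> max_hitters n q"
  by (auto simp: greedy_inv_def intro: le_max_hitters)

definition hits_all_rows :: "(arr \<Rightarrow> nat \<Rightarrow> nat \<Rightarrow> nat) \<Rightarrow> nat \<Rightarrow> (arr \<Rightarrow> nat \<Rightarrow> nat \<Rightarrow> nat) \<Rightarrow> bool" where
  "hits_all_rows \<mu>\<^sub>0 sz \<mu> \<longleftrightarrow> sz \<le> max_hitters n q \<and> sz \<le> n \<and> hitters sz \<mu> \<subseteq> {..<n} \<and>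
     (\<forall>v\<in>unhit \<mu>\<^sub>0. hitters sz \<mu> \<inter> near_row \<mu>\<^sub>0 v \<noteq> {})"

lemma hits_all_rows_if_none_unhit:
  assumes "greedy_inv \<mu>\<^sub>0 sz \<mu>" "unhit \<mu> = {}"
  shows "hits_all_rows \<mu>\<^sub>0 sz \<mu>"
proof -
  have "{v\<in>unhit \<mu>\<^sub>0. hitters sz \<mu> \<inter> near_row \<mu>\<^sub>0 v = {}} = {}" using assms by (auto simp: greedy_inv_def)
  then show ?thesis
    using assms greedy_inv_le_max_hitters[OF assms(1)] unfolding hits_all_rows_def greedy_inv_def by auto
qed

lemma runs_greedy_loop:
  assumes "sizes \<sigma>" and valid: "rows_valid \<mu>" and start: "\<sigma> HitterCount = 0" "\<sigma> Best = 1"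
  shows "runs (Loop (Var Best) greedy_round) \<sigma> \<mu> ((max_hitters n q + 1) * greedy_cost + 2)
    (\<lambda>\<sigma>' \<mu>'. hits_all_rows \<mu> (\<sigma>' HitterCount) \<mu>')"
proof (rule runs_Loop[where I = "\<lambda>\<sigma>' \<mu>'. greedy_inv \<mu> (\<sigma>' HitterCount) \<mu>' \<and> (\<sigma>' Best = 0 \<longrightarrow> unhit \<mu>' = {})"
      and \<Phi> = "\<lambda>\<sigma>' \<mu>'. greedy_remaining \<sigma>'" and C = "\<lambda>_ _. greedy_cost - 10"],
    goal_cases init time safe body exit)
  case init
  show ?case
    using start card_unhit_le[of \<mu>] greedy_potential_mono by (auto simp: greedy_inv_def hitters_def)
next
  case time
  show ?case using start by (simp add: greedy_remaining_def distrib_right)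
next
  case (body \<sigma>' \<mu>')
  have "sizes \<sigma>'" using sizes_unchanged[OF assms(1) body(1)] by simp
  moreover have "\<mu>' Queue = \<mu> Queue" using body(1) by (simp add: unchanged_def)
  ultimately show ?case
  proof (intro runs_weaken[OF runs_greedy_round[of \<sigma>' \<mu> \<mu>'] order_refl])
    fix \<sigma>'' \<mu>''
    assume next_state: "greedy_inv \<mu> (\<sigma>'' HitterCount) \<mu>'' \<and>
      (if \<sigma>'' Best = 0 then unhit \<mu>'' = {} else \<sigma>'' HitterCount = Suc (\<sigma>' HitterCount))"
    have "Suc (max_hitters n q - Suc (\<sigma>' HitterCount)) = max_hitters n q - \<sigma>' HitterCount" if "\<sigma>'' Best \<noteq> 0"
      using next_state that greedy_inv_le_max_hitters[of \<mu> "\<sigma>'' HitterCount" \<mu>''] by auto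
    then show "(greedy_inv \<mu> (\<sigma>'' HitterCount) \<mu>'' \<and> (\<sigma>'' Best = 0 \<longrightarrow> unhit \<mu>'' = {})) \<and>
        greedy_remaining \<sigma>'' + (greedy_cost - 10) + expr_cost (Var Best) + 1 \<le> greedy_remaining \<sigma>'"
      using body(3) next_state by (auto simp: greedy_remaining_def greedy_cost_def)
  qed (use valid body in auto)
next
  case (exit \<sigma>' \<mu>')
  then show ?case by (intro hits_all_rows_if_none_unhit) auto
qed simp

lemma runs_greedy:
  assumes "sizes \<sigma>" and "rows_valid \<mu>"
  shows "runs greedy \<sigma> \<mu> ((max_hitters n q + 1) * greedy_cost + 10)
    (\<lambda>\<sigma>' \<mu>'. hits_all_rows \<mu> (\<sigma>' HitterCount) \<mu>')"
  unfolding greedy_def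
  using assms runs_greedy_loop[of "\<sigma>(HitterCount := 0, Best := 1)" \<mu>]
  by (intro runs_Seq_straight[where T = "(max_hitters n q + 1) * greedy_cost + 2"]) (simp_all add: sizes_def)

end

section \<open>Distances to the hitting set\<close>

text \<open>Maximizing \<open>2 * n - d\<close> instead of minimizing \<open>d\<close> makes \<open>\<infinity>\<close> the initial value.\<close>

definition hitter_closeness :: "(var, arr) expr" where
  "hitter_closeness = Lit 2 \<otimes> Var VertexCount \<ominus> Cell Dist (Var Vertex) (Elem Hitters (Var Index))"

definition nearest_hitters :: "(var, arr) com" where
  "nearest_hitters = for_range Vertex VertexCount
     (argmax Index HitterCount (Lit 1) hitter_closeness Best ArgBest;;
      Put_Elem HitDist (Var Vertex) (Lit 2 \<otimes> Var VertexCount \<ominus> Var Best);;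
      Put_Elem NearHit (Var Vertex) (Var ArgBest))"

definition preprocess :: "(var, arr) com" where
  "preprocess = apsp;; greedy;; nearest_hitters;; CandidateCount ::= Var HitterCount \<oplus> Var RowLength"

lemma nearest_hitters_effects [simp]:
  "writes nearest_hitters = {Vertex, Index, Best, ArgBest}" "stores nearest_hitters = {HitDist, NearHit}"
  by (auto simp: nearest_hitters_def)

context kcenter_input begin

definition hit_entry :: "nat \<Rightarrow> (nat \<Rightarrow> nat) \<Rightarrow> nat \<Rightarrow> nat \<Rightarrow> nat \<Rightarrow> bool" where
  "hit_entry sz S v r j \<longleftrightarrow> r \<le> 2 * n \<and> j < n \<and> (\<forall>i<sz. r \<le> d v (S i)) \<and> (r < 2 * n \<longrightarrow> j < sz \<and> d v (S j) = r)"

lemma hit_entry_if_is_argmax: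
  assumes "sz \<le> n" "v < n" "is_argmax sz (\<lambda>_. True) (\<lambda>i. 2 * n - d v (S i)) b j"
  shows "b \<le> 2 * n" "hit_entry sz S v (2 * n - b) j"
proof -
  have "d v u \<le> 2 * n" for u by (rule d_le_infinite[OF assms(2)])
  moreover show "b \<le> 2 * n" using assms(3) by (auto simp: is_argmax_def split: if_splits)
  ultimately show "hit_entry sz S v (2 * n - b) j"
    using assms n_pos by (force simp: is_argmax_def hit_entry_def split: if_splits)
qed

lemma runs_nearest_hitters:
  assumes "sizes \<sigma>" and sz: "\<sigma> HitterCount = sz" "sz \<le> n" and hit: "hitters sz \<mu> \<subseteq> {..<n}"
    and dist: "\<And>s u. s < n \<Longrightarrow> u < n \<Longrightarrow> \<mu> Dist s u = d s u"
  shows "runs nearest_hitters \<sigma> \<mu> (n * (sz * 60 + 60) + 6)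
    (\<lambda>\<sigma>' \<mu>'. \<forall>v<n. hit_entry sz (\<mu> Hitters 0) v (\<mu>' HitDist 0 v) (\<mu>' NearHit 0 v))"
  unfolding nearest_hitters_def
proof (rule runs_for_range[where C = "sz * 60 + 52"
      and I = "\<lambda>v \<sigma>' \<mu>'. \<forall>u<v. hit_entry sz (\<mu> Hitters 0) u (\<mu>' HitDist 0 u) (\<mu>' NearHit 0 u)"])
  let ?argmax = "argmax Index HitterCount (Lit 1) hitter_closeness Best ArgBest"
  let ?store = "Put_Elem HitDist (Var Vertex) (Lit 2 \<otimes> Var VertexCount \<ominus> Var Best);;
    Put_Elem NearHit (Var Vertex) (Var ArgBest)"
  fix v \<sigma>1 \<mu>1
  assume v: "v < n" "\<sigma>1 Vertex = v" and same: "unchanged (for_range Vertex VertexCount (?argmax;; ?store)) \<sigma> \<mu> \<sigma>1 \<mu>1"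
    and inv: "\<forall>u<v. hit_entry sz (\<mu> Hitters 0) u (\<mu>1 HitDist 0 u) (\<mu>1 NearHit 0 u)"
  have env: "sizes \<sigma>1" "\<sigma>1 HitterCount = sz" "\<mu>1 Dist = \<mu> Dist" "\<mu>1 Hitters = \<mu> Hitters"
    using sizes_unchanged[OF assms(1) same] same sz by (auto simp: unchanged_def)
  have hit_less: "\<mu> Hitters 0 i < n" if "i < sz" for i using hit that by (auto simp: hitters_def)
  show "runs (?argmax;; ?store) \<sigma>1 \<mu>1 (sz * 60 + 52)
      (\<lambda>\<sigma>' \<mu>'. \<forall>u<Suc v. hit_entry sz (\<mu> Hitters 0) u (\<mu>' HitDist 0 u) (\<mu>' NearHit 0 u))"
  proof (rule runs_Seq[where T = "sz * 60 + 10"])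
    show "runs ?argmax \<sigma>1 \<mu>1 (sz * 60 + 10)
        (\<lambda>\<sigma>' \<mu>'. is_argmax sz (\<lambda>_. True) (\<lambda>i. 2 * n - d v (\<mu> Hitters 0 i)) (\<sigma>' Best) (\<sigma>' ArgBest))"
      using env v sz hit_less dist d_le_infinite[OF v(1)]
      by (intro runs_argmax) (auto simp: sizes_def small_less_word fits_def hitter_closeness_def)
    fix \<sigma>2 \<mu>2
    assume same2: "unchanged ?argmax \<sigma>1 \<mu>1 \<sigma>2 \<mu>2"
      and max: "is_argmax sz (\<lambda>_. True) (\<lambda>i. 2 * n - d v (\<mu> Hitters 0 i)) (\<sigma>2 Best) (\<sigma>2 ArgBest)"
    have "\<sigma>2 Vertex = v" "sizes \<sigma>2" "\<mu>2 = \<mu>1"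
      using sizes_unchanged[OF env(1) same2] same2 v by (auto simp: unchanged_def)
    then show "runs ?store \<sigma>2 \<mu>2 30
        (\<lambda>\<sigma>' \<mu>'. \<forall>u<Suc v. hit_entry sz (\<mu> Hitters 0) u (\<mu>' HitDist 0 u) (\<mu>' NearHit 0 u))"
      using hit_entry_if_is_argmax[OF sz(2) v(1) max] inv v
      by (intro runs_straight) (auto simp: sizes_def small_less_word fits_def less_Suc_eq)
  qed simp
qed (use assms in \<open>auto simp: sizes_def small_less_word\<close>)

text \<open>For \<open>k = 1\<close> rows of length one make every vertex a member of the hitting set.\<close>

definition search_tables :: "nat \<Rightarrow> (arr \<Rightarrow> nat \<Rightarrow> nat \<Rightarrow> nat) \<Rightarrow> bool" where
  "search_tables sz \<mu> \<longleftrightarrow> sz \<le> n \<and> hitters sz \<mu> \<subseteq> {..<n} \<and> (\<forall>s<n. \<forall>u<n. \<mu> Dist s u = d s u) \<and>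
     (\<forall>v<n. \<forall>i. \<mu> Queue v i < n) \<and> (\<forall>v<n. hit_entry sz (\<mu> Hitters 0) v (\<mu> HitDist 0 v) (\<mu> NearHit 0 v)) \<and>
     (\<forall>v<n. \<forall>x<n. \<forall>r<2 * n. d v x \<le> r \<longrightarrow> r < \<mu> HitDist 0 v \<longrightarrow> x \<in> near_row \<mu> v) \<and>
     (q = 1 \<longrightarrow> (\<forall>v<n. \<mu> HitDist 0 v = 0))"

lemma search_tablesI:
  assumes tables: "tables_computed \<mu>\<^sub>0" and queue: "\<mu> Queue = \<mu>\<^sub>0 Queue" "\<mu> Dist = \<mu>\<^sub>0 Dist"
    and "sz \<le> n" "hitters sz \<mu> \<subseteq> {..<n}" and hits: "\<And>v. v \<in> unhit \<mu>\<^sub>0 \<Longrightarrow> hitters sz \<mu> \<inter> near_row \<mu>\<^sub>0 v \<noteq> {}"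
    and entries: "\<And>v. v < n \<Longrightarrow> hit_entry sz (\<mu> Hitters 0) v (\<mu> HitDist 0 v) (\<mu> NearHit 0 v)"
  shows "search_tables sz \<mu>"
proof -
  have nearest: "nearest_row q v (\<mu> Queue v) (v \<in> unhit \<mu>\<^sub>0)" if "v < n" for v
    using tables that queue by (simp add: tables_computed_def explored_def unhit_def)
  have hit: "\<exists>i<q. \<mu> HitDist 0 v \<le> d v (\<mu> Queue v i)" if "v < n" "v \<in> unhit \<mu>\<^sub>0" for v
    using hits[OF that(2)] entries[OF that(1)] queue by (force simp: hitters_def near_row_def hit_entry_def)
  have "x \<in> near_row \<mu> v" if "v < n" "x < n" "r < 2 * n" "d v x \<le> r" "r < \<mu> HitDist 0 v" for v x r
  proof -
    have "(\<forall>x<n. d v x \<le> r \<longrightarrow> x \<in> near_row \<mu> v) \<or> (v \<in> unhit \<mu>\<^sub>0 \<and> (\<forall>i<q. d v (\<mu> Queue v i) \<le> r))"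
      using nearest[OF that(1)] that(3) by (simp add: nearest_row_def near_row_def)
    then show ?thesis using hit[OF that(1)] that by (meson le_trans not_less)
  qed
  moreover have "\<mu> HitDist 0 v = 0" if "q = 1" "v < n" for v
    using nearest[OF that(2)] hit[OF that(2)] that(1) by (auto simp: nearest_row_def)
  ultimately show ?thesis
    using assms unfolding search_tables_def tables_computed_def explored_def by auto
qed

definition preprocess_cost :: nat where
  "preprocess_cost = 100 * m + n * (240 * m + 60 * n + 58) + 12 +
     ((max_hitters n q + 1) * greedy_cost + 10 + (n * (max_hitters n q * 60 + 60) + 10))"

lemma runs_preprocess:
  assumes "sizes \<sigma>" and "\<And>e. e < 2 * m \<Longrightarrow> \<mu> Ends 0 e = endpoint e"
    and "\<And>v. v < n \<Longrightarrow> \<mu> First 0 v = 0" "\<And>s i. \<mu> Queue s i = 0"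
  shows "runs preprocess \<sigma> \<mu> preprocess_cost
    (\<lambda>\<sigma>' \<mu>'. search_tables (\<sigma>' HitterCount) \<mu>' \<and> \<sigma>' HitterCount \<le> max_hitters n q \<and>
      \<sigma>' CandidateCount = \<sigma>' HitterCount + q)"
    (is "runs _ _ _ _ ?Q")
  unfolding preprocess_def preprocess_cost_def
proof (rule runs_Seq[OF runs_apsp[of \<sigma> \<mu>, OF assms] order_refl])
  fix \<sigma>1 \<mu>1
  assume same1: "unchanged apsp \<sigma> \<mu> \<sigma>1 \<mu>1" and tables: "tables_computed \<mu>1"
  have sizes1: "sizes \<sigma>1"
    using sizes_unchanged[OF assms(1) same1] by (simp add: apsp_def link_half_edges_def)
  have valid: "rows_valid \<mu>1"
    using tables by (auto simp: rows_valid_def tables_computed_def explored_def nearest_row_def unhit_def)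
  let ?sum = "CandidateCount ::= Var HitterCount \<oplus> Var RowLength"
  show "runs (greedy;; nearest_hitters;; ?sum) \<sigma>1 \<mu>1
      ((max_hitters n q + 1) * greedy_cost + 10 + (n * (max_hitters n q * 60 + 60) + 10)) ?Q"
  proof (rule runs_Seq[OF runs_greedy[OF sizes1 valid] order_refl])
    fix \<sigma>2 \<mu>2
    assume same2: "unchanged greedy \<sigma>1 \<mu>1 \<sigma>2 \<mu>2" and "hits_all_rows \<mu>1 (\<sigma>2 HitterCount) \<mu>2"
    then have greedy: "\<sigma>2 HitterCount \<le> max_hitters n q" "\<sigma>2 HitterCount \<le> n"
      "hitters (\<sigma>2 HitterCount) \<mu>2 \<subseteq> {..<n}"
      "\<And>v. v \<in> unhit \<mu>1 \<Longrightarrow> hitters (\<sigma>2 HitterCount) \<mu>2 \<inter> near_row \<mu>1 v \<noteq> {}"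
      by (auto simp: hits_all_rows_def)
    define sz where "sz = \<sigma>2 HitterCount"
    have env: "sizes \<sigma>2" "\<mu>2 Dist = \<mu>1 Dist" "\<mu>2 Queue = \<mu>1 Queue"
      using sizes_unchanged[OF sizes1 same2] same2 by (auto simp: unchanged_def)
    have "n * (sz * 60 + 60) + 6 \<le> n * (max_hitters n q * 60 + 60) + 6" using greedy by (simp add: sz_def)
    moreover have "runs nearest_hitters \<sigma>2 \<mu>2 (n * (sz * 60 + 60) + 6)
        (\<lambda>\<sigma>' \<mu>'. \<forall>v<n. hit_entry sz (\<mu>2 Hitters 0) v (\<mu>' HitDist 0 v) (\<mu>' NearHit 0 v))"
      using env tables greedy by (intro runs_nearest_hitters)
        (auto simp: sz_def tables_computed_def explored_def)
    ultimately show "runs (nearest_hitters;; ?sum) \<sigma>2 \<mu>2 (n * (max_hitters n q * 60 + 60) + 10) ?Q"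
    proof (intro runs_Seq[where T' = 4])
      fix \<sigma>3 \<mu>3
      assume same3: "unchanged nearest_hitters \<sigma>2 \<mu>2 \<sigma>3 \<mu>3"
        and entries: "\<forall>v<n. hit_entry sz (\<mu>2 Hitters 0) v (\<mu>3 HitDist 0 v) (\<mu>3 NearHit 0 v)"
      have env3: "sizes \<sigma>3" "\<sigma>3 HitterCount = sz" "\<mu>3 Dist = \<mu>1 Dist" "\<mu>3 Queue = \<mu>1 Queue"
        "\<mu>3 Hitters = \<mu>2 Hitters"
        using sizes_unchanged[OF env(1) same3] same3 env by (auto simp: unchanged_def sz_def)
      have "search_tables sz \<mu>3"
        using greedy entries env3 by (intro search_tablesI[OF tables]) (auto simp: sz_def hitters_def)
      then show "runs ?sum \<sigma>3 \<mu>3 4 ?Q"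
        using env3 greedy q_le by (intro runs_straight) (auto simp: sizes_def sz_def intro: small_less_word)
    qed (auto simp: sz_def)
  qed
qed

end

section \<open>The search tree\<close>

fun uncovered_test :: "nat \<Rightarrow> (var, arr) expr" where
  "uncovered_test 0 = Lit 1"
| "uncovered_test (Suc i) =
    uncovered_test i \<otimes> (Var Threshold \<prec> Cell Dist (Var (Chosen i)) (Var Vertex))"

definition find_farthest :: "nat \<Rightarrow> var \<Rightarrow> (var, arr) com" where
  "find_farthest i x = argmax Vertex VertexCount (uncovered_test i) (Elem HitDist (Var Vertex) \<oplus> Lit 1) Best x"

fun copy_chosen :: "nat \<Rightarrow> (var, arr) com" where
  "copy_chosen 0 = Skip"
| "copy_chosen (Suc l) = copy_chosen l;; Center l ::= Var (Chosen l)"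

definition record_solution :: "nat \<Rightarrow> (var, arr) com" where
  "record_solution i = Branch (Var Pass)
     (copy_chosen i;; Center i ::= Var Candidate;; Found ::= Lit 1) Skip"

definition test_candidate :: "nat \<Rightarrow> (var, arr) com" where
  "test_candidate i = check_all Pass Vertex VertexCount
     (uncovered_test i \<otimes> (Var Threshold \<prec> Cell Dist (Var Candidate) (Var Vertex)))"

definition last_from_row :: "nat \<Rightarrow> (var, arr) com" where
  "last_from_row i = for_range Index RowLength
     (Candidate ::= Cell Queue (Var Farthest) (Var Index);; test_candidate i;; record_solution i)"

definition mark_needed :: "nat \<Rightarrow> (var, arr) com" where
  "mark_needed i = fill Needed (Lit 0) Index HitterCount (Lit 0);;
     for_range Vertex VertexCount
       (Branch (uncovered_test i) (Put_Elem Needed (Elem NearHit (Var Vertex)) (Lit 1)) Skip)"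

definition test_by_hitters :: "(var, arr) com" where
  "test_by_hitters = check_all Pass Index HitterCount
     (Elem Needed (Var Index) \<otimes>
      (Var Radius \<oplus> Var Reach \<prec> Cell Dist (Var Candidate) (Elem Hitters (Var Index))))"

definition last_by_hitters :: "nat \<Rightarrow> (var, arr) com" where
  "last_by_hitters i = mark_needed i;;
     for_range Candidate VertexCount (test_by_hitters;; record_solution i)"

definition last_center :: "nat \<Rightarrow> (var, arr) com" where
  "last_center i = Threshold ::= Var Target;; find_farthest i Farthest;;
     Branch (Var Reach \<oplus> Lit 1 \<prec> Var Best) (last_from_row i) (last_by_hitters i)"

definition choose_candidate :: "nat \<Rightarrow> (var, arr) com" where
  "choose_candidate i = Branch (Var (Branching i) \<prec> Var HitterCount)
     (Chosen i ::= Elem Hitters (Var (Branching i)))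
     (Chosen i ::= Cell Queue (Var (Pivot i)) (Var (Branching i) \<ominus> Var HitterCount))"

fun search :: "nat \<Rightarrow> nat \<Rightarrow> (var, arr) com" where
  "search i 0 = last_center i"
| "search i (Suc r) = Threshold ::= Var Radius \<oplus> Lit (2 * i) \<otimes> Var Shrink \<ominus> Var Shrink;;
     find_farthest i (Pivot i);;
     for_range (Branching i) CandidateCount (choose_candidate i;; search (Suc i) r)"

definition search_round :: "nat \<Rightarrow> (var, arr) com" where
  "search_round k = (Shrink ::= Var Radius \<oslash> Lit (2 * k - 1);;
     Target ::= Lit 2 \<otimes> Var Radius \<ominus> Var Shrink;;
     Reach ::= (Var Radius \<ominus> Var Shrink) \<oslash> Lit 2;; Found ::= Lit 0);; search 0 (k - 1)"

definition volatile :: "nat \<Rightarrow> var set" where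
  "volatile i = {Vertex, Index, Best, Threshold, Found, Pass, Candidate, Farthest} \<union>
     range Center \<union> Chosen ` {i..} \<union> Pivot ` {i..} \<union> Branching ` {i..}"

lemma volatile_Suc_subset: "volatile (Suc i) \<subseteq> volatile i"
  by (auto simp: volatile_def)

lemma expr_cost_uncovered_test: "expr_cost (uncovered_test i) = 11 * i + 1"
  by (induction i) auto

lemma copy_chosen_effects [simp]:
  "writes (copy_chosen i) = Center ` {..<i}" "stores (copy_chosen i) = {}" "cost (copy_chosen i) = 2 * i"
  by (induction i) (auto simp: lessThan_Suc)

lemma find_farthest_effects [simp]:
  "writes (find_farthest i x) = {Vertex, Best, x}" "stores (find_farthest i x) = {}"
  by (auto simp: find_farthest_def)

lemma record_solution_effects [simp]:
  "writes (record_solution i) = insert Found (Center ` {..<Suc i})" "stores (record_solution i) = {}"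
  by (auto simp: record_solution_def lessThan_Suc)

lemma test_effects [simp]:
  "writes (test_candidate i) = {Pass, Vertex}" "stores (test_candidate i) = {}"
  "writes test_by_hitters = {Pass, Index}" "stores test_by_hitters = {}"
  by (auto simp: test_candidate_def test_by_hitters_def)

lemma choose_candidate_effects [simp]:
  "writes (choose_candidate i) = {Chosen i}" "stores (choose_candidate i) = {}"
  by (auto simp: choose_candidate_def)

lemma last_center_effects:
  "writes (last_from_row i) \<subseteq> volatile i" "stores (last_from_row i) = {}"
  "writes (mark_needed i) \<subseteq> {Index, Vertex}" "stores (mark_needed i) = {Needed}"
  "writes (last_by_hitters i) \<subseteq> volatile i" "stores (last_by_hitters i) = {Needed}"
  "writes (last_center i) \<subseteq> volatile i" "stores (last_center i) \<subseteq> {Needed}"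
  by (auto simp: last_from_row_def mark_needed_def last_by_hitters_def last_center_def volatile_def)

lemma writes_search: "writes (search i r) \<subseteq> volatile i"
proof (induction r arbitrary: i)
  case 0
  then show ?case using last_center_effects by simp
next
  case (Suc r)
  have "writes (search (Suc i) r) \<subseteq> volatile i" using Suc volatile_Suc_subset by blast
  then show ?case by (auto simp: volatile_def)
qed

lemma stores_search: "stores (search i r) \<subseteq> {Needed}"
proof (induction r arbitrary: i)
  case 0
  then show ?case using last_center_effects by simp
next
  case (Suc r)
  then show ?case using Suc[of "Suc i"] by simp
qed

locale search_input = kcenter_input +
  fixes sz :: nat and \<tau> :: "arr \<Rightarrow> nat \<Rightarrow> nat \<Rightarrow> nat"
  assumes tables: "search_tables sz \<tau>" and q_eq_1: "k = 1 \<Longrightarrow> q = 1"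
begin

lemma sz_le: "sz \<le> n"
  using tables by (simp add: search_tables_def)

lemma table_entries:
  "s < n \<Longrightarrow> u < n \<Longrightarrow> \<tau> Dist s u = d s u" "v < n \<Longrightarrow> \<tau> Queue v i < n" "j < sz \<Longrightarrow> \<tau> Hitters 0 j < n"
  using tables by (auto simp: search_tables_def hitters_def)

lemma table_hit_entry:
  assumes "v < n"
  shows "\<tau> HitDist 0 v \<le> 2 * n" "\<tau> NearHit 0 v < n" "j < sz \<Longrightarrow> \<tau> HitDist 0 v \<le> d v (\<tau> Hitters 0 j)"
    "\<tau> HitDist 0 v < 2 * n \<Longrightarrow> \<tau> NearHit 0 v < sz \<and> d v (\<tau> Hitters 0 (\<tau> NearHit 0 v)) = \<tau> HitDist 0 v"
  using tables assms by (auto simp: search_tables_def hit_entry_def)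

definition pass_cost :: nat where
  "pass_cost = n * (11 * k + 100)"

lemma le_pass_cost:
  assumes "a \<le> 11 * k + 26" "b \<le> 2 * k + 72"
  shows "n * a + b \<le> pass_cost"
proof -
  have "n * a \<le> n * (11 * k + 26)" using assms(1) by (rule mult_le_mono2)
  moreover have "pass_cost = n * (11 * k + 26) + 74 * n" by (simp add: pass_cost_def algebra_simps)
  moreover have "2 * k \<le> 2 * n" using k_le by simp
  ultimately show ?thesis using assms(2) n_pos by linarith
qed

text \<open>Half of this accounts for the candidates tried on one level, the other half for the overhead.\<close>

definition fan_out :: nat where
  "fan_out = 2 * (sz + q) + 4"

definition round_done :: "nat \<Rightarrow> (var \<Rightarrow> nat) \<Rightarrow> (var \<Rightarrow> nat) \<Rightarrow> bool" where
  "round_done R \<sigma> \<sigma>' \<longleftrightarrow> (if \<sigma>' Found = 0 then (\<forall>l<k. \<sigma>' (Center l) = \<sigma> (Center l)) \<and> \<not> k_radius n E k \<le> enat R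
     else (\<forall>l<k. \<sigma>' (Center l) < n) \<and> (\<forall>z<n. \<exists>l<k. d (\<sigma>' (Center l)) z \<le> approx_radius k R))"

end

locale round_input = search_input +
  fixes R :: nat
  assumes R_less: "R < n"

sublocale round_input \<subseteq> radius_guess n E k "hitters sz \<tau>" "near_row \<tau>" "\<tau> HitDist 0" R
proof
  show "1 \<le> k" "R < n" by (rule k_pos, rule R_less)
  show "s < n" if "s \<in> hitters sz \<tau>" for s using that table_entries(3) by (auto simp: hitters_def)
  show "x < n" if "v < n" "x \<in> near_row \<tau> v" for v x using that table_entries(2) by (auto simp: near_row_def)
  show "near_row \<tau> v \<noteq> {}" for v using q_pos by (simp add: near_row_def lessThan_empty_iff)
  show "\<tau> HitDist 0 v \<le> d v s" if "v < n" "s \<in> hitters sz \<tau>" for v s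
    using that table_hit_entry(3) by (auto simp: hitters_def)
  show "\<tau> HitDist 0 v \<le> 2 * n" if "v < n" for v using table_hit_entry(1) that .
  show "\<exists>s\<in>hitters sz \<tau>. d v s = \<tau> HitDist 0 v" if "v < n" "\<tau> HitDist 0 v < 2 * n" for v
    using table_hit_entry(4) that by (auto simp: hitters_def)
  show "x \<in> near_row \<tau> v" if "v < n" "r < 2 * n" "r < \<tau> HitDist 0 v" "x < n" "d v x \<le> r" for v r x
    using tables that by (auto simp: search_tables_def)
  show "\<tau> HitDist 0 v = 0" if "v < n" "k = 1" for v
    using tables that(1) q_eq_1[OF that(2)] unfolding search_tables_def by blast
qed

context round_input begin

definition chosen :: "nat \<Rightarrow> (var \<Rightarrow> nat) \<Rightarrow> nat set" where
  "chosen i \<sigma> = (\<lambda>l. \<sigma> (Chosen l)) ` {..<i}"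

definition search_env :: "nat \<Rightarrow> (var \<Rightarrow> nat) \<Rightarrow> (arr \<Rightarrow> nat \<Rightarrow> nat \<Rightarrow> nat) \<Rightarrow> bool" where
  "search_env i \<sigma> \<mu> \<longleftrightarrow> sizes \<sigma> \<and> \<sigma> HitterCount = sz \<and> \<sigma> CandidateCount = sz + q \<and>
     \<sigma> Radius = R \<and> \<sigma> Shrink = h \<and> \<sigma> Target = D \<and> \<sigma> Reach = \<rho> \<and>
     (\<forall>a. a \<noteq> Needed \<longrightarrow> \<mu> a = \<tau> a) \<and> chosen i \<sigma> \<subseteq> {..<n}"

lemma search_env_unchanged:
  assumes "search_env i \<sigma> \<mu>" "unchanged c \<sigma> \<mu> \<sigma>' \<mu>'" "writes c \<subseteq> volatile i" "stores c \<subseteq> {Needed}"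
  shows "search_env i \<sigma>' \<mu>'" "chosen i \<sigma>' = chosen i \<sigma>"
proof -
  have same: "\<sigma>' x = \<sigma> x" if "x \<notin> volatile i" for x using assms(2,3) that by (auto simp: unchanged_def)
  have "\<sigma>' (Chosen l) = \<sigma> (Chosen l)" if "l < i" for l
    by (rule same) (use that in \<open>auto simp: volatile_def\<close>)
  then show "chosen i \<sigma>' = chosen i \<sigma>" by (simp add: chosen_def)
  moreover have "\<mu>' a = \<tau> a" if "a \<noteq> Needed" for a
    using assms that by (auto simp: unchanged_def search_env_def)
  moreover have "\<sigma>' x = \<sigma> x" if "x \<in> {VertexCount, HalfEdgeCount, RowLength, HitterCount, CandidateCount,
      Radius, Shrink, Target, Reach}" for x
    by (rule same) (use that in \<open>auto simp: volatile_def\<close>)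
  ultimately show "search_env i \<sigma>' \<mu>'"
    using assms(1) by (simp add: search_env_def sizes_def)
qed

lemma search_env_arrays:
  assumes "search_env i \<sigma> \<mu>"
  shows "a \<noteq> Needed \<Longrightarrow> \<mu> a = \<tau> a"
  using assms by (simp add: search_env_def)

lemma uncovered_test_correct:
  assumes env: "search_env i \<sigma> \<mu>" and z: "\<sigma> Vertex < n"
  shows "safe (uncovered_test i) \<sigma> \<mu>"
    "val (uncovered_test i) \<sigma> \<mu> = of_bool (\<sigma> Vertex \<in> beyond (\<sigma> Threshold) (chosen i \<sigma>))"
proof -
  have dist: "\<mu> Dist = \<tau> Dist" using env by (simp add: search_env_def)
  have "safe (uncovered_test j) \<sigma> \<mu> \<and>
      val (uncovered_test j) \<sigma> \<mu> = of_bool (\<sigma> Vertex \<in> beyond (\<sigma> Threshold) (chosen j \<sigma>))" if "j \<le> i" for j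
    using that
  proof (induction j)
    case 0
    then show ?case using z by (simp add: chosen_def beyond_def)
  next
    case (Suc j)
    have "\<sigma> (Chosen j) < n" using env Suc.prems unfolding search_env_def chosen_def
      by (meson Suc_le_eq imageI lessThan_iff subsetD)
    moreover from this have "fits n m Dist (\<sigma> (Chosen j)) (\<sigma> Vertex)" using z by (simp add: fits_def)
    ultimately show ?case
      using Suc z dist table_entries(1) by (auto simp: chosen_def beyond_def lessThan_Suc of_bool_def)
  qed
  then show "safe (uncovered_test i) \<sigma> \<mu>"
    "val (uncovered_test i) \<sigma> \<mu> = of_bool (\<sigma> Vertex \<in> beyond (\<sigma> Threshold) (chosen i \<sigma>))" by auto
qed

abbreviation is_farthest :: "nat \<Rightarrow> nat set \<Rightarrow> nat \<Rightarrow> nat \<Rightarrow> bool" where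
  "is_farthest t A \<equiv> is_argmax n (\<lambda>z. z \<in> beyond t A) (\<lambda>z. \<tau> HitDist 0 z + 1)"

lemma runs_find_farthest:
  assumes env: "search_env i \<sigma> \<mu>" and x: "x \<in> volatile i" "x \<notin> {Vertex, Best, Threshold}"
  shows "runs (find_farthest i x) \<sigma> \<mu> (n * (11 * i + 36) + 10)
    (\<lambda>\<sigma>' \<mu>'. is_farthest (\<sigma> Threshold) (chosen i \<sigma>) (\<sigma>' Best) (\<sigma>' x))"
  unfolding find_farthest_def
proof (rule runs_argmax, goal_cases bound small distinct one exprs time)
  case (exprs z \<sigma>')
  have "unchanged (find_farthest i x) \<sigma> \<mu> \<sigma>' \<mu>" using exprs(3) by (auto simp: unchanged_def)
  from search_env_unchanged[OF env this]
  have env': "search_env i \<sigma>' \<mu>" "chosen i \<sigma>' = chosen i \<sigma>" using x by (auto simp: volatile_def)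
  moreover have "\<sigma>' Threshold = \<sigma> Threshold" using exprs(3) x by auto
  moreover have "\<mu> HitDist = \<tau> HitDist" using search_env_arrays[OF env] by simp
  ultimately show ?case
    using uncovered_test_correct[OF env'(1)] exprs table_hit_entry(1)[of z]
    by (auto simp: fits_def intro!: small_less_word)
qed (use env x in \<open>auto simp: search_env_def sizes_def small_less_word expr_cost_uncovered_test
    volatile_def algebra_simps\<close>)

text \<open>Until a solution is found, the centers \<open>Y\<close> of the last successful round are kept.\<close>

definition solution :: "(nat \<Rightarrow> nat) \<Rightarrow> (var \<Rightarrow> nat) \<Rightarrow> bool" where
  "solution Y \<sigma> \<longleftrightarrow> (if \<sigma> Found = 0 then \<forall>l<k. \<sigma> (Center l) = Y l
     else (\<forall>l<k. \<sigma> (Center l) < n) \<and> (\<forall>z<n. \<exists>l<k. d (\<sigma> (Center l)) z \<le> D))"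

definition finds :: "(nat \<Rightarrow> nat) \<Rightarrow> bool \<Rightarrow> (var \<Rightarrow> nat) \<Rightarrow> (var \<Rightarrow> nat) \<Rightarrow> bool" where
  "finds Y P \<sigma> \<sigma>' \<longleftrightarrow> solution Y \<sigma>' \<and> (\<sigma> Found \<noteq> 0 \<or> P \<longrightarrow> \<sigma>' Found \<noteq> 0)"

lemma solution_cong:
  assumes "\<sigma>' Found = \<sigma> Found" "\<And>l. \<sigma>' (Center l) = \<sigma> (Center l)"
  shows "solution Y \<sigma>' \<longleftrightarrow> solution Y \<sigma>"
  using assms by (simp add: solution_def)

lemma runs_copy_chosen: "runs (copy_chosen i) \<sigma> \<mu> (2 * i) (\<lambda>\<sigma>' \<mu>'. \<forall>l<i. \<sigma>' (Center l) = \<sigma> (Chosen l))"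
proof (induction i)
  case 0
  then show ?case by (auto intro!: runs_straight)
next
  case (Suc i)
  then show ?case
    unfolding copy_chosen.simps
    by (rule runs_Seq[where T' = 2]) (auto intro!: runs_straight simp: unchanged_def less_Suc_eq)
qed

definition completes :: "nat set \<Rightarrow> nat \<Rightarrow> bool" where
  "completes A u \<longleftrightarrow> (\<forall>z\<in>beyond D A. d u z \<le> D)"

lemma runs_record_solution:
  assumes i: "Suc i = k" and A: "chosen i \<sigma> \<subseteq> {..<n}" and u: "\<sigma> Candidate < n" and old: "solution Y \<sigma>"
    and pass: "\<sigma> Pass = of_bool P" "P \<Longrightarrow> completes (chosen i \<sigma>) (\<sigma> Candidate)"
  shows "runs (record_solution i) \<sigma> \<mu> (2 * k + 10) (\<lambda>\<sigma>' \<mu>'. finds Y P \<sigma> \<sigma>')"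
  unfolding record_solution_def
proof (rule runs_Branch[where T = "2 * k + 4"])
  assume "val (Var Pass) \<sigma> \<mu> \<noteq> 0"
  then have "completes (chosen i \<sigma>) (\<sigma> Candidate)" using pass by auto
  show "runs (copy_chosen i;; Center i ::= Var Candidate;; Found ::= Lit 1) \<sigma> \<mu> (2 * k + 4)
    (\<lambda>\<sigma>' \<mu>'. finds Y P \<sigma> \<sigma>')"
  proof (rule runs_Seq[OF runs_copy_chosen, where T' = 4])
    fix \<sigma>' \<mu>'
    assume same: "unchanged (copy_chosen i) \<sigma> \<mu> \<sigma>' \<mu>'" and copied: "\<forall>l<i. \<sigma>' (Center l) = \<sigma> (Chosen l)"
    define \<sigma>2 where "\<sigma>2 = \<sigma>'(Center i := \<sigma> Candidate, Found := 1)"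
    have centers: "\<sigma>2 (Center l) = (if l = i then \<sigma> Candidate else \<sigma> (Chosen l))" if "l < k" for l
      using copied that i by (auto simp: \<sigma>2_def)
    have "\<exists>l<k. d (\<sigma>2 (Center l)) z \<le> D" if z: "z < n" for z
    proof (cases "z \<in> beyond D (chosen i \<sigma>)")
      case True
      then show ?thesis
        using \<open>completes (chosen i \<sigma>) (\<sigma> Candidate)\<close> centers[of i] i by (intro exI[of _ i])
          (auto simp: completes_def)
    next
      case False
      then obtain l where "l < i" "d (\<sigma> (Chosen l)) z \<le> D" using z
        by (auto simp: beyond_def chosen_def not_less)
      then show ?thesis using centers[of l] i by (intro exI[of _ l]) auto
    qed
    moreover have "\<sigma>2 (Center l) < n" if "l < k" for l
      using centers[OF that] u A i that by (auto simp: chosen_def image_subset_iff)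
    ultimately have "finds Y P \<sigma> \<sigma>2" by (simp add: finds_def solution_def \<sigma>2_def)
    moreover have "\<sigma>' Candidate = \<sigma> Candidate" using same by (auto simp: unchanged_def)
    ultimately show "runs (Center i ::= Var Candidate;; Found ::= Lit 1) \<sigma>' \<mu>' 4 (\<lambda>\<sigma>' \<mu>'. finds Y P \<sigma> \<sigma>')"
      by (intro runs_straight) (simp_all add: \<sigma>2_def)
  qed (use i in auto)
next
  assume "val (Var Pass) \<sigma> \<mu> = 0"
  then show "runs Skip \<sigma> \<mu> (2 * k + 4) (\<lambda>\<sigma>' \<mu>'. finds Y P \<sigma> \<sigma>')"
    using pass(1) old by (intro runs_straight) (auto simp: finds_def)
qed auto

lemma runs_test_and_record:
  assumes i: "Suc i = k" and env: "search_env i \<sigma> \<mu>" and u: "\<sigma> Candidate < n" and old: "solution Y \<sigma>"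
    and test: "runs c \<sigma> \<mu> T (\<lambda>\<sigma>' \<mu>'. \<sigma>' Pass = of_bool P)" "writes c \<subseteq> {Pass, Vertex, Index}" "stores c = {}"
    and P: "P \<Longrightarrow> completes (chosen i \<sigma>) (\<sigma> Candidate)"
  shows "runs (c;; record_solution i) \<sigma> \<mu> (T + (2 * k + 10)) (\<lambda>\<sigma>' \<mu>'. finds Y P \<sigma> \<sigma>')"
proof (rule runs_Seq[OF test(1) order_refl])
  fix \<sigma>' \<mu>'
  assume same: "unchanged c \<sigma> \<mu> \<sigma>' \<mu>'" and tested: "\<sigma>' Pass = of_bool P"
  have "{Pass, Vertex, Index} \<subseteq> volatile i" by (simp add: volatile_def)
  then have "search_env i \<sigma>' \<mu>'" "chosen i \<sigma>' = chosen i \<sigma>"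
    using search_env_unchanged[OF env same] test(2,3) by auto
  moreover have "\<sigma>' Candidate = \<sigma> Candidate" "\<sigma>' Found = \<sigma> Found" "solution Y \<sigma>' = solution Y \<sigma>"
    using unchangedD(1)[OF same] test(2) by (auto intro!: solution_cong)
  ultimately show "runs (record_solution i) \<sigma>' \<mu>' (2 * k + 10) (\<lambda>\<sigma>' \<mu>'. finds Y P \<sigma> \<sigma>')"
    using i u old P tested
    by (intro runs_weaken[OF runs_record_solution[of i \<sigma>' Y P]]) (auto simp: search_env_def finds_def)
qed

lemma runs_try_candidates:
  assumes range: "\<sigma> b = N" "N < 2 ^ w" "x \<noteq> b" "x \<notin> writes c" "b \<notin> writes c" "x \<noteq> Found" "x \<notin> range Center"
    and old: "solution Y \<sigma>"
    and body: "\<And>j \<sigma>' \<mu>'. j < N \<Longrightarrow> \<sigma>' x = j \<Longrightarrow> unchanged (for_range x b c) \<sigma> \<mu> \<sigma>' \<mu>' \<Longrightarrow> solution Y \<sigma>' \<Longrightarrow>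
      runs c \<sigma>' \<mu>' C (\<lambda>\<sigma>'' \<mu>''. finds Y (P j) \<sigma>' \<sigma>'')"
    and time: "N * (C + 8) + 6 \<le> T"
  shows "runs (for_range x b c) \<sigma> \<mu> T (\<lambda>\<sigma>' \<mu>'. finds Y (\<exists>j<N. P j) \<sigma> \<sigma>')"
proof (rule runs_for_range[where I = "\<lambda>i \<sigma>' \<mu>'. finds Y (\<exists>j<i. P j) \<sigma> \<sigma>'" and C = C])
  have "solution Y (\<sigma>(x := 0)) = solution Y \<sigma>" using range(6,7) by (intro solution_cong) auto
  then show "finds Y (\<exists>j<0. P j) \<sigma> (\<sigma>(x := 0))" using old range(6) by (simp add: finds_def)
  fix j \<sigma>' \<mu>'
  assume j: "j < N" "\<sigma>' x = j" and "unchanged (for_range x b c) \<sigma> \<mu> \<sigma>' \<mu>'"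
    and inv: "finds Y (\<exists>j'<j. P j') \<sigma> \<sigma>'"
  then have "runs c \<sigma>' \<mu>' C (\<lambda>\<sigma>'' \<mu>''. finds Y (P j) \<sigma>' \<sigma>'')" by (intro body) (auto simp: finds_def)
  then show "runs c \<sigma>' \<mu>' C (\<lambda>\<sigma>'' \<mu>''. finds Y (\<exists>j'<Suc j. P j') \<sigma> (\<sigma>''(x := Suc j)))"
  proof (rule runs_weaken[OF _ order_refl])
    fix \<sigma>'' \<mu>'' assume found: "finds Y (P j) \<sigma>' \<sigma>''"
    have "solution Y (\<sigma>''(x := Suc j)) = solution Y \<sigma>''" using range(6,7) by (intro solution_cong) auto
    then show "finds Y (\<exists>j'<Suc j. P j') \<sigma> (\<sigma>''(x := Suc j))"
      using found inv range(6) by (auto simp: finds_def less_Suc_eq)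
  qed
qed (use range time in auto)

lemma runs_test_candidate:
  assumes env: "search_env i \<sigma> \<mu>" "\<sigma> Threshold = D" and u: "\<sigma> Candidate < n"
  shows "runs (test_candidate i) \<sigma> \<mu> (n * (11 * i + 24) + 8)
    (\<lambda>\<sigma>' \<mu>'. \<sigma>' Pass = of_bool (completes (chosen i \<sigma>) (\<sigma> Candidate)))"
proof -
  have "runs (test_candidate i) \<sigma> \<mu> (n * (11 * i + 24) + 8)
      (\<lambda>\<sigma>' \<mu>'. \<sigma>' Pass = of_bool (\<forall>z<n. \<not> (z \<in> beyond D (chosen i \<sigma>) \<and> D < d (\<sigma> Candidate) z)))"
    unfolding test_candidate_def
  proof (rule runs_check_all, goal_cases bound small distinct one exprs time)
    case (exprs z \<sigma>')
    have same: "unchanged (test_candidate i) \<sigma> \<mu> \<sigma>' \<mu>" using exprs(3) by (auto simp: unchanged_def)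
    have "search_env i \<sigma>' \<mu>" "chosen i \<sigma>' = chosen i \<sigma>"
      using search_env_unchanged[OF env(1) same] by (auto simp: volatile_def)
    moreover have "\<sigma>' Threshold = D" "\<sigma>' Candidate = \<sigma> Candidate" using exprs(3) env(2) by auto
    ultimately show ?case
      using uncovered_test_correct[of i \<sigma>' \<mu>] exprs u table_entries(1) search_env_arrays[OF env(1), of Dist]
      by (auto simp: fits_def of_bool_def)
  qed (use env(1) in \<open>auto simp: search_env_def sizes_def small_less_word expr_cost_uncovered_test algebra_simps\<close>)
  moreover have "(\<forall>z<n. \<not> (z \<in> beyond D A \<and> D < d u z)) = completes A u" for A u
    unfolding completes_def beyond_def not_less[symmetric] by blast
  ultimately show ?thesis by simp
qed

lemma runs_last_from_row:
  assumes i: "Suc i = k" and env: "search_env i \<sigma> \<mu>" "\<sigma> Threshold = D" and w: "\<sigma> Farthest < n"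
    and old: "solution Y \<sigma>"
  shows "runs (last_from_row i) \<sigma> \<mu> (q * pass_cost + 6)
    (\<lambda>\<sigma>' \<mu>'. finds Y (\<exists>u\<in>near_row \<tau> (\<sigma> Farthest). completes (chosen i \<sigma>) u) \<sigma> \<sigma>')"
proof -
  let ?try = "test_candidate i;; record_solution i"
  let ?body = "Candidate ::= Cell Queue (Var Farthest) (Var Index);; ?try"
  let ?completes = "\<lambda>j. completes (chosen i \<sigma>) (\<tau> Queue (\<sigma> Farthest) j)"
  have "runs (last_from_row i) \<sigma> \<mu> (q * pass_cost + 6) (\<lambda>\<sigma>' \<mu>'. finds Y (\<exists>j<q. ?completes j) \<sigma> \<sigma>')"
    unfolding last_from_row_def
  proof (rule runs_try_candidates[where C = "n * (11 * i + 24) + 2 * k + 27"])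
    fix j \<sigma>1 \<mu>1
    assume j: "j < q" "\<sigma>1 Index = j" and same: "unchanged (for_range Index RowLength ?body) \<sigma> \<mu> \<sigma>1 \<mu>1"
      and old1: "solution Y \<sigma>1"
    have env1: "search_env i \<sigma>1 \<mu>1" "chosen i \<sigma>1 = chosen i \<sigma>"
      using search_env_unchanged[OF env(1) same] by (auto simp: volatile_def)
    have same_vars: "\<sigma>1 Threshold = D" "\<sigma>1 Farthest = \<sigma> Farthest" using same env(2)
      by (auto simp: unchanged_def)
    define u where "u = \<tau> Queue (\<sigma> Farthest) j"
    have u: "u < n" "\<mu>1 Queue (\<sigma> Farthest) j = u"
      using table_entries(2)[OF w] search_env_arrays[OF env1(1)] by (simp_all add: u_def)
    define \<sigma>2 where "\<sigma>2 = \<sigma>1(Candidate := u)"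
    have env2: "search_env i \<sigma>2 \<mu>1" "chosen i \<sigma>2 = chosen i \<sigma>"
      using env1 by (auto simp: \<sigma>2_def search_env_def sizes_def chosen_def)
    have "solution Y \<sigma>2" using old1 solution_cong[of \<sigma>2 \<sigma>1 Y] by (simp add: \<sigma>2_def)
    then have "runs ?try \<sigma>2 \<mu>1 (n * (11 * i + 24) + 8 + (2 * k + 10)) (\<lambda>\<sigma>' \<mu>'. finds Y (?completes j) \<sigma>2 \<sigma>')"
      using runs_test_candidate[OF env2(1)] i env2 u(1) same_vars(1)
      by (intro runs_test_and_record) (auto simp: \<sigma>2_def u_def)
    moreover have "finds Y P \<sigma>2 = finds Y P \<sigma>1" for P by (simp add: finds_def \<sigma>2_def fun_eq_iff)
    ultimately show "runs ?body \<sigma>1 \<mu>1 (n * (11 * i + 24) + 2 * k + 27) (\<lambda>\<sigma>' \<mu>'. finds Y (?completes j) \<sigma>1 \<sigma>')"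
      using j w q_le same_vars(2) u(2)
      by (intro runs_Seq_straight[where T = "n * (11 * i + 24) + 8 + (2 * k + 10)"])
        (auto simp: fits_def \<sigma>2_def)
  next
    have "n * (11 * i + 24) + (2 * k + 35) \<le> pass_cost" using i by (intro le_pass_cost) auto
    then show "q * (n * (11 * i + 24) + 2 * k + 27 + 8) + 6 \<le> q * pass_cost + 6" by (simp add: add.assoc)
  qed (use env w q_le old in \<open>auto simp: search_env_def sizes_def small_less_word\<close>)
  then show ?thesis by (simp add: near_row_def Bex_def)
qed

lemma runs_mark_needed:
  assumes env: "search_env i \<sigma> \<mu>" "\<sigma> Threshold = t"
    and near: "\<And>z. z \<in> beyond t (chosen i \<sigma>) \<Longrightarrow> \<tau> NearHit 0 z < sz"
  shows "runs (mark_needed i) \<sigma> \<mu> (sz * 17 + n * (11 * i + 30) + 12)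
    (\<lambda>\<sigma>' \<mu>'. \<forall>j<sz. \<mu>' Needed 0 j = of_bool (\<exists>z\<in>beyond t (chosen i \<sigma>). \<tau> NearHit 0 z = j))"
  unfolding mark_needed_def
proof (rule runs_Seq)
  let ?fill = "fill Needed (Lit 0) Index HitterCount (Lit 0) :: (var, arr) com"
  let ?body = "Branch (uncovered_test i) (Put_Elem Needed (Elem NearHit (Var Vertex)) (Lit 1)) Skip"
  let ?needed = "\<lambda>l j. of_bool (\<exists>z\<in>beyond t (chosen i \<sigma>). z < l \<and> \<tau> NearHit 0 z = j)"
  show "runs ?fill \<sigma> \<mu> (sz * 17 + 6)
      (\<lambda>\<sigma>' \<mu>'. (\<forall>j<sz. \<mu>' Needed 0 j = 0) \<and> (\<forall>r. r \<noteq> 0 \<longrightarrow> \<mu>' Needed r = \<mu> Needed r))"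
    using env sz_le by (intro runs_fill) (auto simp: search_env_def fits_def small_less_word)
  fix \<sigma>1 \<mu>1
  assume same1: "unchanged ?fill \<sigma> \<mu> \<sigma>1 \<mu>1"
    and zero: "(\<forall>j<sz. \<mu>1 Needed 0 j = 0) \<and> (\<forall>r. r \<noteq> 0 \<longrightarrow> \<mu>1 Needed r = \<mu> Needed r)"
  have env1: "search_env i \<sigma>1 \<mu>1" "chosen i \<sigma>1 = chosen i \<sigma>" "\<sigma>1 Threshold = t"
    using search_env_unchanged[OF env(1) same1] same1 env(2) by (auto simp: volatile_def unchanged_def)
  have "runs (for_range Vertex VertexCount ?body) \<sigma>1 \<mu>1 (n * (11 * i + 30) + 6)
    (\<lambda>\<sigma>' \<mu>'. \<forall>j<sz. \<mu>' Needed 0 j = ?needed n j)"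
  proof (rule runs_for_range[where C = "11 * i + 22" and I = "\<lambda>l \<sigma>' \<mu>'. \<forall>j<sz. \<mu>' Needed 0 j = ?needed l j"])
    fix l \<sigma>2 \<mu>2
    assume l: "l < n" "\<sigma>2 Vertex = l" and same2: "unchanged (for_range Vertex VertexCount ?body) \<sigma>1 \<mu>1 \<sigma>2 \<mu>2"
      and inv: "\<forall>j<sz. \<mu>2 Needed 0 j = ?needed l j"
    have env2: "search_env i \<sigma>2 \<mu>2" "chosen i \<sigma>2 = chosen i \<sigma>" "\<sigma>2 Threshold = t"
      using search_env_unchanged[OF env1(1) same2] same2 env1(2,3) by (auto simp: volatile_def unchanged_def)
    then show "runs ?body \<sigma>2 \<mu>2 (11 * i + 22) (\<lambda>\<sigma>' \<mu>'. \<forall>j<sz. \<mu>' Needed 0 j = ?needed (Suc l) j)"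
      using uncovered_test_correct[OF env2(1)] l inv near[of l] search_env_arrays[OF env2(1), of NearHit] sz_le
      by (intro runs_straight) (auto simp: fits_def less_Suc_eq expr_cost_uncovered_test)
  qed (use env1 zero in \<open>auto simp: search_env_def sizes_def small_less_word\<close>)
  then show "runs (for_range Vertex VertexCount ?body) \<sigma>1 \<mu>1 (n * (11 * i + 30) + 6)
      (\<lambda>\<sigma>' \<mu>'. \<forall>j<sz. \<mu>' Needed 0 j = of_bool (\<exists>z\<in>beyond t (chosen i \<sigma>). \<tau> NearHit 0 z = j))"
    by (rule runs_weaken) (auto simp: beyond_def of_bool_def)
qed simp

definition near_needed :: "nat set \<Rightarrow> nat \<Rightarrow> bool" where
  "near_needed A u \<longleftrightarrow> (\<forall>z\<in>beyond D A. d u (\<tau> Hitters 0 (\<tau> NearHit 0 z)) \<le> R + \<rho>)"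

lemma near_hitter:
  assumes "v < n" "\<tau> HitDist 0 v \<le> \<rho>"
  shows "\<tau> NearHit 0 v < sz" "d v (\<tau> Hitters 0 (\<tau> NearHit 0 v)) \<le> \<rho>"
proof -
  have "\<tau> HitDist 0 v < 2 * n" using assms(2) R_less by (simp add: \<rho>_def)
  then show "\<tau> NearHit 0 v < sz" "d v (\<tau> Hitters 0 (\<tau> NearHit 0 v)) \<le> \<rho>"
    using table_hit_entry(4)[OF assms(1)] assms(2) by auto
qed

lemma completes_if_near_needed:
  assumes "u < n" "near_needed A u" "\<And>z. z \<in> beyond D A \<Longrightarrow> \<tau> HitDist 0 z \<le> \<rho>"
  shows "completes A u"
  using assms near_hitter(2) last_center_near_sound[OF assms(1)]
  unfolding completes_def near_needed_def beyond_def by blast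

lemma near_needed_if_covers:
  assumes "c < n" "covers {c} (beyond D A)" "\<And>z. z \<in> beyond D A \<Longrightarrow> \<tau> HitDist 0 z \<le> \<rho>"
  shows "near_needed A c"
  using assms(3) near_hitter(2) last_center_near_complete[OF assms(1,2)]
  unfolding near_needed_def beyond_def by blast

lemma runs_test_by_hitters:
  assumes env: "search_env i \<sigma> \<mu>" and u: "\<sigma> Candidate < n"
    and near: "\<And>z. z \<in> beyond D A \<Longrightarrow> \<tau> NearHit 0 z < sz"
    and marked: "\<forall>j<sz. \<mu> Needed 0 j = of_bool (\<exists>z\<in>beyond D A. \<tau> NearHit 0 z = j)"
  shows "runs test_by_hitters \<sigma> \<mu> (sz * 39 + 8) (\<lambda>\<sigma>' \<mu>'. \<sigma>' Pass = of_bool (near_needed A (\<sigma> Candidate)))"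
proof -
  let ?unreached = "\<lambda>j. (\<exists>z\<in>beyond D A. \<tau> NearHit 0 z = j) \<and> R + \<rho> < d (\<sigma> Candidate) (\<tau> Hitters 0 j)"
  have "runs test_by_hitters \<sigma> \<mu> (sz * 39 + 8) (\<lambda>\<sigma>' \<mu>'. \<sigma>' Pass = of_bool (\<forall>j<sz. \<not> ?unreached j))"
    unfolding test_by_hitters_def
  proof (rule runs_check_all, goal_cases bound small distinct one exprs time)
    case (exprs j \<sigma>')
    have "\<mu> Dist = \<tau> Dist" "\<mu> Hitters = \<tau> Hitters" using search_env_arrays[OF env] by simp_all
    moreover have "\<sigma>' Radius = R" "\<sigma>' Reach = \<rho>" "\<sigma>' Candidate = \<sigma> Candidate"
      using exprs(3) env by (auto simp: search_env_def)
    moreover have "R + \<rho> < 2 ^ w" using R_less by (intro small_less_word) (simp add: \<rho>_def)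
    ultimately show ?case
      using exprs(1,2) marked u table_entries(1,3) sz_le by (auto simp: fits_def)
  qed (use env sz_le in \<open>auto simp: search_env_def small_less_word\<close>)
  moreover have "(\<forall>j<sz. \<not> ?unreached j) = near_needed A (\<sigma> Candidate)"
    unfolding near_needed_def not_less[symmetric] using near by blast
  ultimately show ?thesis by simp
qed

lemma finds_weaken: "finds Y P \<sigma> \<sigma>' \<Longrightarrow> (P' \<Longrightarrow> P) \<Longrightarrow> finds Y P' \<sigma> \<sigma>'"
  by (auto simp: finds_def)

lemma runs_try_by_hitters:
  assumes i: "Suc i = k" and env: "search_env i \<sigma> \<mu>" and old: "solution Y \<sigma>"
    and near: "\<And>z. z \<in> beyond D (chosen i \<sigma>) \<Longrightarrow> \<tau> HitDist 0 z \<le> \<rho>"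
    and marked: "\<forall>j<sz. \<mu> Needed 0 j = of_bool (\<exists>z\<in>beyond D (chosen i \<sigma>). \<tau> NearHit 0 z = j)"
  shows "runs (for_range Candidate VertexCount (test_by_hitters;; record_solution i)) \<sigma> \<mu>
    (n * (sz * 39 + 2 * k + 26) + 6) (\<lambda>\<sigma>' \<mu>'. finds Y (\<exists>c<n. covers {c} (beyond D (chosen i \<sigma>))) \<sigma> \<sigma>')"
proof -
  let ?A = "chosen i \<sigma>" and ?try = "test_by_hitters;; record_solution i"
  have hitter: "\<tau> NearHit 0 z < sz" if "z \<in> beyond D ?A" for z
    using near_hitter(1)[OF _ near[OF that]] that by (simp add: beyond_def)
  have "runs (for_range Candidate VertexCount ?try) \<sigma> \<mu> (n * (sz * 39 + 2 * k + 26) + 6)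
      (\<lambda>\<sigma>' \<mu>'. finds Y (\<exists>u<n. near_needed ?A u) \<sigma> \<sigma>')"
  proof (rule runs_try_candidates[where C = "sz * 39 + 2 * k + 18"])
    fix u \<sigma>1 \<mu>1
    assume u: "u < n" "\<sigma>1 Candidate = u" and old1: "solution Y \<sigma>1"
      and same: "unchanged (for_range Candidate VertexCount ?try) \<sigma> \<mu> \<sigma>1 \<mu>1"
    have env1: "search_env i \<sigma>1 \<mu>1" "chosen i \<sigma>1 = ?A" "\<mu>1 Needed = \<mu> Needed"
      using search_env_unchanged[OF env same] same by (auto simp: volatile_def unchanged_def)
    have "runs ?try \<sigma>1 \<mu>1 (sz * 39 + 8 + (2 * k + 10)) (\<lambda>\<sigma>' \<mu>'. finds Y (near_needed ?A u) \<sigma>1 \<sigma>')"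
      using i u env1 old1 marked hitter near completes_if_near_needed runs_test_by_hitters[of i \<sigma>1 \<mu>1 ?A]
      by (intro runs_test_and_record) auto
    then show "runs ?try \<sigma>1 \<mu>1 (sz * 39 + 2 * k + 18) (\<lambda>\<sigma>' \<mu>'. finds Y (near_needed ?A u) \<sigma>1 \<sigma>')"
      by (simp add: ac_simps)
  qed (use env old in \<open>auto simp: search_env_def sizes_def small_less_word\<close>)
  then show ?thesis
    by (rule runs_weaken[OF _ order_refl]) (use near_needed_if_covers near in \<open>blast intro: finds_weaken\<close>)
qed

lemma runs_last_by_hitters:
  assumes i: "Suc i = k" and env: "search_env i \<sigma> \<mu>" "\<sigma> Threshold = D" and old: "solution Y \<sigma>"
    and near: "\<And>z. z \<in> beyond D (chosen i \<sigma>) \<Longrightarrow> \<tau> HitDist 0 z \<le> \<rho>"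
  shows "runs (last_by_hitters i) \<sigma> \<mu> ((sz + 2) * pass_cost)
    (\<lambda>\<sigma>' \<mu>'. finds Y (\<exists>c<n. covers {c} (beyond D (chosen i \<sigma>))) \<sigma> \<sigma>')"
  unfolding last_by_hitters_def
proof (rule runs_Seq)
  let ?A = "chosen i \<sigma>"
  have "\<tau> NearHit 0 z < sz" if "z \<in> beyond D ?A" for z
    using near_hitter(1)[OF _ near[OF that]] that by (simp add: beyond_def)
  then show "runs (mark_needed i) \<sigma> \<mu> (sz * 17 + n * (11 * i + 30) + 12)
      (\<lambda>\<sigma>' \<mu>'. \<forall>j<sz. \<mu>' Needed 0 j = of_bool (\<exists>z\<in>beyond D ?A. \<tau> NearHit 0 z = j))"
    by (rule runs_mark_needed[OF env])
  fix \<sigma>1 \<mu>1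
  assume same: "unchanged (mark_needed i) \<sigma> \<mu> \<sigma>1 \<mu>1"
    and marked: "\<forall>j<sz. \<mu>1 Needed 0 j = of_bool (\<exists>z\<in>beyond D ?A. \<tau> NearHit 0 z = j)"
  have "writes (mark_needed i) \<subseteq> volatile i" using last_center_effects(3)[of i] by (auto simp: volatile_def)
  then have env1: "search_env i \<sigma>1 \<mu>1" "chosen i \<sigma>1 = ?A"
    using search_env_unchanged[OF env(1) same] last_center_effects(4)[of i] by auto
  have "\<sigma>1 x = \<sigma> x" if "x \<notin> {Index, Vertex}" for x
    using unchangedD(1)[OF same, of x] last_center_effects(3)[of i] that by blast
  then have same_vars: "solution Y \<sigma>1 = solution Y \<sigma>" "\<sigma>1 Found = \<sigma> Found" by (auto intro!: solution_cong)
  have "runs (for_range Candidate VertexCount (test_by_hitters;; record_solution i)) \<sigma>1 \<mu>1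
      (n * (sz * 39 + 2 * k + 26) + 6) (\<lambda>\<sigma>' \<mu>'. finds Y (\<exists>c<n. covers {c} (beyond D ?A)) \<sigma>1 \<sigma>')"
    using runs_try_by_hitters[OF i env1(1), of Y] env1(2) old same_vars(1) near marked by simp
  then show "runs (for_range Candidate VertexCount (test_by_hitters;; record_solution i)) \<sigma>1 \<mu>1
      (n * (sz * 39 + 2 * k + 26) + 6) (\<lambda>\<sigma>' \<mu>'. finds Y (\<exists>c<n. covers {c} (beyond D ?A)) \<sigma> \<sigma>')"
    using same_vars(2) by (simp add: finds_def)
next
  have "sz * 17 \<le> n * (17 * sz)" using n_pos by simp
  then have "sz * 17 + n * (11 * i + 30) + 12 + (n * (sz * 39 + 2 * k + 26) + 6) \<le>
      n * (56 * sz + 11 * i + 2 * k + 74)"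
    using n_pos unfolding distrib_left by linarith
  also have "\<dots> \<le> n * ((sz + 2) * (11 * k + 100))" using i by (intro mult_le_mono2) (simp add: algebra_simps)
  finally show "sz * 17 + n * (11 * i + 30) + 12 + (n * (sz * 39 + 2 * k + 26) + 6) \<le> (sz + 2) * pass_cost"
    by (simp add: pass_cost_def mult.left_commute)
qed

lemma is_farthestD:
  assumes "is_farthest t A b v"
  shows "v < n" "z \<in> beyond t A \<Longrightarrow> v \<in> beyond t A \<and> \<tau> HitDist 0 z \<le> \<tau> HitDist 0 v"
    "z \<in> beyond t A \<Longrightarrow> \<tau> HitDist 0 z < b" "b \<noteq> 0 \<Longrightarrow> v \<in> beyond t A \<and> b = \<tau> HitDist 0 v + 1"
proof -
  have max: "\<And>z. z \<in> beyond t A \<Longrightarrow> \<tau> HitDist 0 z + 1 \<le> b"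
    using assms by (auto simp: is_argmax_def beyond_def)
  then show "z \<in> beyond t A \<Longrightarrow> \<tau> HitDist 0 z < b" by fastforce
  show v: "b \<noteq> 0 \<Longrightarrow> v \<in> beyond t A \<and> b = \<tau> HitDist 0 v + 1" using assms by (simp add: is_argmax_def)
  show "v < n" using assms n_pos by (auto simp: is_argmax_def split: if_splits)
  show "z \<in> beyond t A \<Longrightarrow> v \<in> beyond t A \<and> \<tau> HitDist 0 z \<le> \<tau> HitDist 0 v"
    using max[of z] v by (cases "b = 0") auto
qed

lemma runs_finish_search:
  assumes i: "Suc i = k" and env: "search_env i \<sigma> \<mu>" "\<sigma> Threshold = D" and old: "solution Y \<sigma>"
    and far: "is_farthest D (chosen i \<sigma>) (\<sigma> Best) (\<sigma> Farthest)"
  shows "runs (Branch (Var Reach \<oplus> Lit 1 \<prec> Var Best) (last_from_row i) (last_by_hitters i)) \<sigma> \<mu>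
    ((sz + q + 2) * pass_cost + 12) (\<lambda>\<sigma>' \<mu>'. finds Y (\<exists>c<n. covers {c} (beyond D (chosen i \<sigma>))) \<sigma> \<sigma>')"
    (is "runs _ _ _ _ ?Q")
proof (rule runs_Branch[where T = "(sz + q + 2) * pass_cost + 6"])
  have reach: "\<sigma> Reach = \<rho>" using env(1) by (simp add: search_env_def)
  then show "safe (Var Reach \<oplus> Lit 1 \<prec> Var Best) \<sigma> \<mu>"
    using R_less by (auto simp: \<rho>_def intro!: small_less_word)
  show "runs (last_from_row i) \<sigma> \<mu> ((sz + q + 2) * pass_cost + 6) ?Q"
    if "val (Var Reach \<oplus> Lit 1 \<prec> Var Best) \<sigma> \<mu> \<noteq> 0"
  proof (rule runs_weaken[OF runs_last_from_row[OF i env is_farthestD(1)[OF far] old]])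
    fix \<sigma>' assume found: "finds Y (\<exists>u\<in>near_row \<tau> (\<sigma> Farthest). completes (chosen i \<sigma>) u) \<sigma> \<sigma>'"
    have "\<rho> + 1 < \<sigma> Best" using that reach by (simp split: if_splits)
    then have "\<sigma> Farthest \<in> beyond D (chosen i \<sigma>)" "\<rho> < \<tau> HitDist 0 (\<sigma> Farthest)"
      using is_farthestD(4)[OF far] by auto
    then show "?Q \<sigma>' \<mu>'" for \<mu>'
      using last_center_far[of _ "chosen i \<sigma>"] by (intro finds_weaken[OF found]) (auto simp: completes_def)
  qed (simp add: distrib_right)
  show "runs (last_by_hitters i) \<sigma> \<mu> ((sz + q + 2) * pass_cost + 6) ?Q"
    if "val (Var Reach \<oplus> Lit 1 \<prec> Var Best) \<sigma> \<mu> = 0"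
  proof (rule runs_weaken[OF runs_last_by_hitters[OF i env old]])
    have "\<sigma> Best \<le> \<rho> + 1" using that reach by (simp split: if_splits)
    then show "\<tau> HitDist 0 z \<le> \<rho>" if "z \<in> beyond D (chosen i \<sigma>)" for z
      using is_farthestD(3)[OF far that] by simp
  qed (simp_all add: distrib_right)
qed simp

lemma runs_last_center:
  assumes i: "Suc i = k" and env: "search_env i \<sigma> \<mu>" and old: "solution Y \<sigma>"
  shows "runs (last_center i) \<sigma> \<mu> (pass_cost * fan_out) (\<lambda>\<sigma>' \<mu>'. finds Y (completable i (chosen i \<sigma>)) \<sigma> \<sigma>')"
  unfolding last_center_def
proof (rule runs_Seq_straight[where T = "pass_cost * fan_out - 2"])
  let ?finish = "Branch (Var Reach \<oplus> Lit 1 \<prec> Var Best) (last_from_row i) (last_by_hitters i)"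
  define \<sigma>1 where "\<sigma>1 = \<sigma>(Threshold := D)"
  have env1: "search_env i \<sigma>1 \<mu>" "chosen i \<sigma>1 = chosen i \<sigma>" "\<sigma>1 Threshold = D"
    using env by (auto simp: \<sigma>1_def search_env_def sizes_def chosen_def)
  have cost: "n * (11 * i + 36) + 10 + ((sz + q + 2) * pass_cost + 12) \<le> pass_cost * fan_out - 2"
    "cost (Threshold ::= Var Target :: (var, arr) com) + (pass_cost * fan_out - 2) \<le> pass_cost * fan_out"
  proof -
    have "n * (11 * i + 36) + 24 \<le> pass_cost" using i by (intro le_pass_cost) auto
    then show "n * (11 * i + 36) + 10 + ((sz + q + 2) * pass_cost + 12) \<le> pass_cost * fan_out - 2"
      "cost (Threshold ::= Var Target :: (var, arr) com) + (pass_cost * fan_out - 2) \<le> pass_cost * fan_out"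
      by (simp_all add: fan_out_def algebra_simps)
  qed
  have "runs (find_farthest i Farthest;; ?finish) \<sigma>1 \<mu> (pass_cost * fan_out - 2)
      (\<lambda>\<sigma>' \<mu>'. finds Y (completable i (chosen i \<sigma>)) \<sigma> \<sigma>')"
  proof (rule runs_Seq[OF runs_find_farthest[OF env1(1)] cost(1)])
    fix \<sigma>2 \<mu>2
    assume same: "unchanged (find_farthest i Farthest) \<sigma>1 \<mu> \<sigma>2 \<mu>2"
      and far: "is_farthest (\<sigma>1 Threshold) (chosen i \<sigma>1) (\<sigma>2 Best) (\<sigma>2 Farthest)"
    have env2: "search_env i \<sigma>2 \<mu>2" "chosen i \<sigma>2 = chosen i \<sigma>"
      using search_env_unchanged[OF env1(1) same] env1(2) by (auto simp: volatile_def)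
    have "\<sigma>2 Threshold = D" "\<sigma>2 Found = \<sigma> Found" "solution Y \<sigma>2 = solution Y \<sigma>"
      using same by (auto simp: \<sigma>1_def unchanged_def intro!: solution_cong)
    then show "runs ?finish \<sigma>2 \<mu>2 ((sz + q + 2) * pass_cost + 12)
      (\<lambda>\<sigma>' \<mu>'. finds Y (completable i (chosen i \<sigma>)) \<sigma> \<sigma>')"
      using env1 env2 far old completable_last[OF _ i]
      by (intro runs_weaken[OF runs_finish_search[OF i env2(1)]]) (auto simp: finds_def)
  qed (auto simp: volatile_def)
  then show "wp (Threshold ::= Var Target)
    (\<lambda>\<sigma>' \<mu>'. runs (find_farthest i Farthest;; ?finish) \<sigma>' \<mu>' (pass_cost * fan_out - 2)
      (\<lambda>\<sigma>' \<mu>'. finds Y (completable i (chosen i \<sigma>)) \<sigma> \<sigma>')) \<sigma> \<mu>"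
    using env by (simp add: \<sigma>1_def search_env_def)
  show "cost (Threshold ::= Var Target :: (var, arr) com) + (pass_cost * fan_out - 2) \<le> pass_cost * fan_out"
    by (rule cost(2))
qed

definition candidate :: "nat \<Rightarrow> nat \<Rightarrow> nat" where
  "candidate v j = (if j < sz then \<tau> Hitters 0 j else \<tau> Queue v (j - sz))"

lemma candidate_range: "candidate v ` {..<sz + q} = hitters sz \<tau> \<union> near_row \<tau> v"
proof -
  have "{..<sz + q} = {..<sz} \<union> (+) sz ` {..<q}"
    by (auto simp: lessThan_atLeast0 image_add_atLeastLessThan)
  moreover have "candidate v ` {..<sz} = hitters sz \<tau>"
    unfolding hitters_def by (intro image_cong) (simp_all add: candidate_def)
  moreover have "candidate v ` (+) sz ` {..<q} = near_row \<tau> v"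
    unfolding image_image near_row_def by (simp add: candidate_def)
  ultimately show ?thesis by (simp only: image_Un)
qed

lemma runs_choose_candidate:
  assumes env: "search_env i \<sigma> \<mu>" and j: "\<sigma> (Branching i) < sz + q" and v: "\<sigma> (Pivot i) < n"
  shows "runs (choose_candidate i) \<sigma> \<mu> 15
    (\<lambda>\<sigma>' \<mu>'. \<mu>' = \<mu> \<and> \<sigma>' = \<sigma>(Chosen i := candidate (\<sigma> (Pivot i)) (\<sigma> (Branching i))))"
  unfolding choose_candidate_def
  using env j v search_env_arrays[OF env] sz_le q_le
  by (intro runs_straight) (auto simp: search_env_def fits_def candidate_def intro!: small_less_word)

lemma runs_branch:
  assumes env: "search_env i \<sigma> \<mu>" and old: "solution Y \<sigma>" and v: "\<sigma> (Pivot i) = v" "v < n"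
    and search: "\<And>\<sigma> \<mu>. search_env (Suc i) \<sigma> \<mu> \<Longrightarrow> solution Y \<sigma> \<Longrightarrow>
      runs (search (Suc i) r) \<sigma> \<mu> C (\<lambda>\<sigma>' \<mu>'. finds Y (completable (Suc i) (chosen (Suc i) \<sigma>)) \<sigma> \<sigma>')"
  shows "runs (for_range (Branching i) CandidateCount (choose_candidate i;; search (Suc i) r)) \<sigma> \<mu>
    ((sz + q) * (C + 23) + 6)
    (\<lambda>\<sigma>' \<mu>'. finds Y (\<exists>x\<in>hitters sz \<tau> \<union> near_row \<tau> v. completable (Suc i) (insert x (chosen i \<sigma>))) \<sigma> \<sigma>')"
proof -
  let ?body = "choose_candidate i;; search (Suc i) r"
  let ?P = "\<lambda>j. completable (Suc i) (insert (candidate v j) (chosen i \<sigma>))"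
  have writes: "writes ?body \<subseteq> volatile (Suc i) \<union> {Chosen i}" using writes_search[of "Suc i" r] by auto
  have volatile: "volatile (Suc i) \<union> {Chosen i, Branching i} \<subseteq> volatile i" "CandidateCount \<notin> volatile i"
    "Branching i \<notin> volatile (Suc i)" "Pivot i \<notin> volatile (Suc i)"
    by (auto simp: volatile_def)
  have "runs (for_range (Branching i) CandidateCount ?body) \<sigma> \<mu> ((sz + q) * (C + 23) + 6)
      (\<lambda>\<sigma>' \<mu>'. finds Y (\<exists>j<sz + q. ?P j) \<sigma> \<sigma>')"
  proof (rule runs_try_candidates[where C = "C + 15"])
    fix j \<sigma>1 \<mu>1
    assume j: "j < sz + q" "\<sigma>1 (Branching i) = j" and old1: "solution Y \<sigma>1"
      and same: "unchanged (for_range (Branching i) CandidateCount ?body) \<sigma> \<mu> \<sigma>1 \<mu>1"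
    have env1: "search_env i \<sigma>1 \<mu>1" "chosen i \<sigma>1 = chosen i \<sigma>"
      using search_env_unchanged[OF env same] stores_search[of "Suc i" r] writes volatile(1) by auto
    have pivot: "\<sigma>1 (Pivot i) = v" using unchangedD(1)[OF same, of "Pivot i"] writes volatile(4) v by auto
    define \<sigma>2 where "\<sigma>2 = \<sigma>1(Chosen i := candidate v j)"
    have cand: "candidate v j < n" using table_entries(2,3) v(2) by (simp add: candidate_def)
    have "chosen (Suc i) \<sigma>2 = insert (candidate v j) (chosen i \<sigma>)"
      using env1(2) by (auto simp: chosen_def lessThan_Suc \<sigma>2_def)
    moreover from this have "search_env (Suc i) \<sigma>2 \<mu>1"
      using env1 cand by (auto simp: search_env_def sizes_def \<sigma>2_def)
    moreover have "solution Y \<sigma>2" using old1 solution_cong[of \<sigma>2 \<sigma>1 Y] by (simp add: \<sigma>2_def)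
    ultimately have "runs (search (Suc i) r) \<sigma>2 \<mu>1 C (\<lambda>\<sigma>' \<mu>'. finds Y (?P j) \<sigma>2 \<sigma>')"
      using search[of \<sigma>2 \<mu>1] by simp
    moreover have "finds Y P \<sigma>2 = finds Y P \<sigma>1" for P by (simp add: finds_def \<sigma>2_def fun_eq_iff)
    ultimately show "runs ?body \<sigma>1 \<mu>1 (C + 15) (\<lambda>\<sigma>' \<mu>'. finds Y (?P j) \<sigma>1 \<sigma>')"
      using j pivot v(2)
      by (intro runs_Seq[OF runs_choose_candidate[OF env1(1)], where T' = C]) (simp_all add: \<sigma>2_def)
  qed (use env old sz_le q_le writes volatile in \<open>auto simp: search_env_def intro!: small_less_word\<close>)
  moreover have "(\<exists>j<sz + q. ?P j) = (\<exists>x\<in>hitters sz \<tau> \<union> near_row \<tau> v. completable (Suc i) (insert x (chosen i \<sigma>)))"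
    unfolding candidate_range[symmetric] by auto
  ultimately show ?thesis by simp
qed

lemma branch_cost_le:
  assumes "pass_cost \<le> C" "x \<le> pass_cost"
  shows "x + (sz + q) * (C + 23) \<le> C * fan_out"
proof -
  have "n * 0 + 23 \<le> pass_cost" by (rule le_pass_cost) simp_all
  then have "(sz + q) * (C + 23) \<le> (sz + q) * (2 * C)" using assms by (intro mult_le_mono2) linarith
  then show ?thesis using assms by (simp add: fan_out_def algebra_simps)
qed

lemma runs_find_and_branch:
  assumes i: "Suc i < k" and env: "search_env i \<sigma> \<mu>" "\<sigma> Threshold = R + 2 * i * h - h" and old: "solution Y \<sigma>"
    and search: "\<And>\<sigma> \<mu>. search_env (Suc i) \<sigma> \<mu> \<Longrightarrow> solution Y \<sigma> \<Longrightarrow>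
      runs (search (Suc i) r) \<sigma> \<mu> C (\<lambda>\<sigma>' \<mu>'. finds Y (completable (Suc i) (chosen (Suc i) \<sigma>)) \<sigma> \<sigma>')"
  shows "runs
    (find_farthest i (Pivot i);; for_range (Branching i) CandidateCount (choose_candidate i;; search (Suc i) r))
    \<sigma> \<mu> (n * (11 * i + 36) + 10 + ((sz + q) * (C + 23) + 6)) (\<lambda>\<sigma>' \<mu>'. finds Y (completable i (chosen i \<sigma>)) \<sigma> \<sigma>')"
proof (rule runs_Seq[OF runs_find_farthest[OF env(1)] order_refl])
  fix \<sigma>' \<mu>'
  assume same: "unchanged (find_farthest i (Pivot i)) \<sigma> \<mu> \<sigma>' \<mu>'"
    and far: "is_farthest (\<sigma> Threshold) (chosen i \<sigma>) (\<sigma>' Best) (\<sigma>' (Pivot i))"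
  have env': "search_env i \<sigma>' \<mu>'" "chosen i \<sigma>' = chosen i \<sigma>"
    using search_env_unchanged[OF env(1) same] by (auto simp: volatile_def)
  have same_vars: "\<sigma>' Found = \<sigma> Found" "solution Y \<sigma>' = solution Y \<sigma>"
    using same by (auto simp: unchanged_def intro!: solution_cong)
  have "\<exists>x\<in>hitters sz \<tau> \<union> near_row \<tau> (\<sigma>' (Pivot i)). completable (Suc i) (insert x (chosen i \<sigma>))"
    if "completable i (chosen i \<sigma>)"
    using that i env far is_farthestD(1,2)[OF far] by (intro completable_step) (auto simp: search_env_def)
  then show "runs (for_range (Branching i) CandidateCount (choose_candidate i;; search (Suc i) r)) \<sigma>' \<mu>'
      ((sz + q) * (C + 23) + 6) (\<lambda>\<sigma>' \<mu>'. finds Y (completable i (chosen i \<sigma>)) \<sigma> \<sigma>')"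
    using search old env' same_vars is_farthestD(1)[OF far]
    by (intro runs_weaken[OF runs_branch[OF env'(1) _ refl]]) (auto simp: finds_def)
qed (auto simp: volatile_def)

lemma runs_search_step:
  assumes i: "Suc i < k" and env: "search_env i \<sigma> \<mu>" and old: "solution Y \<sigma>" and C: "pass_cost \<le> C"
    and search: "\<And>\<sigma> \<mu>. search_env (Suc i) \<sigma> \<mu> \<Longrightarrow> solution Y \<sigma> \<Longrightarrow>
      runs (search (Suc i) r) \<sigma> \<mu> C (\<lambda>\<sigma>' \<mu>'. finds Y (completable (Suc i) (chosen (Suc i) \<sigma>)) \<sigma> \<sigma>')"
  shows "runs (search i (Suc r)) \<sigma> \<mu> (C * fan_out) (\<lambda>\<sigma>' \<mu>'. finds Y (completable i (chosen i \<sigma>)) \<sigma> \<sigma>')"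
  unfolding search.simps
proof (rule runs_Seq_straight)
  let ?set_threshold = "Threshold ::= Var Radius \<oplus> Lit (2 * i) \<otimes> Var Shrink \<ominus> Var Shrink :: (var, arr) com"
  let ?branch = "for_range (Branching i) CandidateCount (choose_candidate i;; search (Suc i) r)"
  let ?T = "n * (11 * i + 36) + 10 + ((sz + q) * (C + 23) + 6)"
  define \<sigma>1 where "\<sigma>1 = \<sigma>(Threshold := R + 2 * i * h - h)"
  have "search_env i \<sigma>1 \<mu>" "chosen i \<sigma>1 = chosen i \<sigma>" "solution Y \<sigma>1"
    using env old solution_cong[of \<sigma>1 \<sigma> Y] by (auto simp: \<sigma>1_def search_env_def sizes_def chosen_def)
  then have "runs (find_farthest i (Pivot i);; ?branch) \<sigma>1 \<mu> ?T
    (\<lambda>\<sigma>' \<mu>'. finds Y (completable i (chosen i \<sigma>)) \<sigma> \<sigma>')"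
    using runs_find_and_branch[OF i _ _ _ search, of \<sigma>1 \<mu>] by (simp add: \<sigma>1_def finds_def)
  moreover have "2 * i < 2 ^ w" "2 * i * h < 2 ^ w" "R + 2 * i * h < 2 ^ w"
    using odd_multiple_h_le[of i] i k_le R_less by (intro small_less_word; linarith)+
  moreover have "h \<le> R + 2 * i * h" using h_le by simp
  moreover have "\<sigma> Radius = R" "\<sigma> Shrink = h" using env by (simp_all add: search_env_def)
  ultimately show "wp ?set_threshold (\<lambda>\<sigma>' \<mu>'. runs (find_farthest i (Pivot i);; ?branch) \<sigma>' \<mu>' ?T
      (\<lambda>\<sigma>' \<mu>'. finds Y (completable i (chosen i \<sigma>)) \<sigma> \<sigma>')) \<sigma> \<mu>"
    unfolding \<sigma>1_def by simp
  have "n * (11 * i + 36) + 24 \<le> pass_cost" using i by (intro le_pass_cost) auto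
  then have "n * (11 * i + 36) + 24 + (sz + q) * (C + 23) \<le> C * fan_out" by (rule branch_cost_le[OF C])
  moreover have "cost ?set_threshold = 8" by simp
  ultimately show "cost ?set_threshold + ?T \<le> C * fan_out" by linarith
qed

lemma runs_search:
  assumes "i + Suc r = k" "search_env i \<sigma> \<mu>" "solution Y \<sigma>"
  shows "runs (search i r) \<sigma> \<mu> (pass_cost * fan_out ^ Suc r)
    (\<lambda>\<sigma>' \<mu>'. finds Y (completable i (chosen i \<sigma>)) \<sigma> \<sigma>')"
  using assms
proof (induction r arbitrary: i \<sigma> \<mu>)
  case 0
  then show ?case using runs_last_center[of i \<sigma> \<mu> Y] by simp
next
  case (Suc r)
  have "1 \<le> fan_out ^ Suc r" by (rule one_le_power) (simp add: fan_out_def)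
  then have "pass_cost \<le> pass_cost * fan_out ^ Suc r" by (metis mult_le_mono2 nat_mult_1_right)
  then have "runs (search i (Suc r)) \<sigma> \<mu> (pass_cost * fan_out ^ Suc r * fan_out)
      (\<lambda>\<sigma>' \<mu>'. finds Y (completable i (chosen i \<sigma>)) \<sigma> \<sigma>')"
    using Suc.prems Suc.IH[of "Suc i"] by (intro runs_search_step) simp_all
  moreover have "pass_cost * fan_out ^ Suc r * fan_out = pass_cost * fan_out ^ Suc (Suc r)" by simp
  ultimately show ?case by (simp only:)
qed

lemma runs_search_round:
  assumes "sizes \<sigma>" "\<sigma> HitterCount = sz" "\<sigma> CandidateCount = sz + q" "\<sigma> Radius = R"
    and "\<And>a. a \<noteq> Needed \<Longrightarrow> \<mu> a = \<tau> a"
  shows "runs (search_round k) \<sigma> \<mu> (pass_cost * fan_out ^ k + 20) (\<lambda>\<sigma>' \<mu>'. round_done R \<sigma> \<sigma>')"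
  unfolding search_round_def
proof (rule runs_Seq_straight[where T = "pass_cost * fan_out ^ k"])
  define \<sigma>1 where "\<sigma>1 = \<sigma>(Shrink := h, Target := D, Reach := \<rho>, Found := 0)"
  let ?Y = "\<lambda>l. \<sigma> (Center l)"
  have "search_env 0 \<sigma>1 \<mu>" using assms by (auto simp: search_env_def sizes_def chosen_def \<sigma>1_def)
  moreover have "solution ?Y \<sigma>1" by (simp add: solution_def \<sigma>1_def)
  moreover have "Suc (k - 1) = k" using k_pos by simp
  ultimately have "runs (search 0 (k - 1)) \<sigma>1 \<mu> (pass_cost * fan_out ^ k)
      (\<lambda>\<sigma>' \<mu>'. finds ?Y (completable 0 (chosen 0 \<sigma>1)) \<sigma>1 \<sigma>')"
    using runs_search[of 0 "k - 1" \<sigma>1 \<mu> ?Y] by simp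
  then have "runs (search 0 (k - 1)) \<sigma>1 \<mu> (pass_cost * fan_out ^ k) (\<lambda>\<sigma>' \<mu>'. round_done R \<sigma> \<sigma>')"
    by (rule runs_weaken[OF _ order_refl])
      (use completable_empty in \<open>auto simp: finds_def solution_def round_done_def chosen_def D_def \<sigma>1_def
        split: if_splits\<close>)
  moreover have "2 * k - 1 < 2 ^ w" "2 * R < 2 ^ w" "R < 2 ^ w" "2 < (2::nat) ^ w"
    using k_le R_less by (auto intro!: small_less_word)
  moreover have "h \<le> 2 * R" "h \<le> R" using h_le by simp_all
  ultimately show "wp (Shrink ::= Var Radius \<oslash> Lit (2 * k - 1);;
     Target ::= Lit 2 \<otimes> Var Radius \<ominus> Var Shrink;;
     Reach ::= (Var Radius \<ominus> Var Shrink) \<oslash> Lit 2;; Found ::= Lit 0)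
     (\<lambda>\<sigma>' \<mu>'. runs (search 0 (k - 1)) \<sigma>' \<mu>' (pass_cost * fan_out ^ k) (\<lambda>\<sigma>' \<mu>'. round_done R \<sigma> \<sigma>')) \<sigma> \<mu>"
    using assms(4) unfolding \<sigma>1_def D_eq \<rho>_def by (simp flip: h_def)
qed simp

end

section \<open>Binary search\<close>

definition halve_bracket :: "nat \<Rightarrow> (var, arr) com" where
  "halve_bracket k = Radius ::= (Var Low \<oplus> Var High) \<oslash> Lit 2;; search_round k;;
     Branch (Var Found) (High ::= Var Radius) (Low ::= Var Radius \<oplus> Lit 1)"

definition binary_search :: "nat \<Rightarrow> (var, arr) com" where
  "binary_search k = (Low ::= Lit 0;; High ::= Var VertexCount);; Loop (Var Low \<prec> Var High) (halve_bracket k)"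

lemma search_round_effects:
  "writes (search_round k) \<subseteq> volatile 0 \<union> {Shrink, Target, Reach}" "stores (search_round k) \<subseteq> {Needed}"
  using writes_search[of 0 "k - 1"] stores_search[of 0 "k - 1"] by (auto simp: search_round_def volatile_def)

lemma binary_search_effects:
  "writes (halve_bracket k) \<subseteq> volatile 0 \<union> {Shrink, Target, Reach, Radius, Low, High}"
  "stores (halve_bracket k) \<subseteq> {Needed}"
  "writes (binary_search k) \<subseteq> volatile 0 \<union> {Shrink, Target, Reach, Radius, Low, High}"
  "stores (binary_search k) \<subseteq> {Needed}"
  using search_round_effects[of k] by (auto simp: halve_bracket_def binary_search_def volatile_def)

lemma not_in_writes_binary_search:
  assumes "x \<in> {VertexCount, HalfEdgeCount, RowLength, HitterCount, CandidateCount}"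
  shows "x \<notin> writes (halve_bracket k)" "x \<notin> writes (binary_search k)"
proof -
  have "x \<notin> volatile 0 \<union> {Shrink, Target, Reach, Radius, Low, High}" using assms by (auto simp: volatile_def)
  then show "x \<notin> writes (halve_bracket k)" "x \<notin> writes (binary_search k)"
    using binary_search_effects[of k] by auto
qed

context search_input begin

definition bracket :: "(var \<Rightarrow> nat) \<Rightarrow> bool" where
  "bracket \<sigma> \<longleftrightarrow> \<sigma> Low \<le> \<sigma> High \<and> \<sigma> High \<le> n \<and> (\<forall>R<\<sigma> Low. \<not> k_radius n E k \<le> enat R) \<and>
     (\<forall>l<k. \<sigma> (Center l) < n) \<and>
     (\<sigma> High < n \<longrightarrow> (\<forall>z<n. \<exists>l<k. d (\<sigma> (Center l)) z \<le> approx_radius k (\<sigma> High)))"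

lemma bracket_halve:
  assumes "bracket \<sigma>" "\<sigma> Low < \<sigma> High" and done_R: "round_done R \<sigma> \<sigma>'" "R = (\<sigma> Low + \<sigma> High) div 2"
    and "\<sigma>' Low = \<sigma> Low" "\<sigma>' High = \<sigma> High"
  shows "\<sigma>' Found \<noteq> 0 \<Longrightarrow> bracket (\<sigma>'(High := R))" "\<sigma>' Found = 0 \<Longrightarrow> bracket (\<sigma>'(Low := Suc R))"
proof -
  have R: "\<sigma> Low \<le> R" "R < \<sigma> High" using assms(2) done_R(2) by auto
  show "\<sigma>' Found \<noteq> 0 \<Longrightarrow> bracket (\<sigma>'(High := R))"
    using R assms by (auto simp: bracket_def round_done_def)
  assume failed: "\<sigma>' Found = 0"
  then have "\<not> k_radius n E k \<le> enat R'" if "R' \<le> R" for R'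
    using done_R(1) that order_trans[of "k_radius n E k" "enat R'" "enat R"] by (auto simp: round_done_def)
  then show "bracket (\<sigma>'(Low := Suc R))"
    using R assms failed by (auto simp: bracket_def round_done_def less_Suc_eq_le cong: conj_cong)
qed

definition round_cost :: nat where
  "round_cost = pass_cost * fan_out ^ k + 40"

lemma runs_halve_bracket:
  assumes env: "sizes \<sigma>" "\<sigma> HitterCount = sz" "\<sigma> CandidateCount = sz + q" "\<And>a. a \<noteq> Needed \<Longrightarrow> \<mu> a = \<tau> a"
    and inv: "bracket \<sigma>" "\<sigma> Low < \<sigma> High"
  shows "runs (halve_bracket k) \<sigma> \<mu> (round_cost - 4)
    (\<lambda>\<sigma>' \<mu>'. bracket \<sigma>' \<and> \<sigma>' High - \<sigma>' Low \<le> (\<sigma> High - \<sigma> Low) div 2)"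
  unfolding halve_bracket_def
proof (rule runs_Seq_straight[where T = "pass_cost * fan_out ^ k + 30"])
  define R where "R = (\<sigma> Low + \<sigma> High) div 2"
  define \<sigma>1 where "\<sigma>1 = \<sigma>(Radius := R)"
  let ?Q = "\<lambda>\<sigma>' (\<mu>' :: arr \<Rightarrow> nat \<Rightarrow> nat \<Rightarrow> nat). bracket \<sigma>' \<and> \<sigma>' High - \<sigma>' Low \<le> (\<sigma> High - \<sigma> Low) div 2"
  let ?update = "Branch (Var Found) (High ::= Var Radius) (Low ::= Var Radius \<oplus> Lit 1)"
  have high: "\<sigma> High \<le> n" "R < \<sigma> High" using inv by (auto simp: bracket_def R_def)
  then interpret round_input n E k es w q sz \<tau> R by unfold_locales simp
  have "runs (search_round k) \<sigma>1 \<mu> (pass_cost * fan_out ^ k + 20) (\<lambda>\<sigma>' \<mu>'. round_done R \<sigma>1 \<sigma>')"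
    using env by (intro runs_search_round) (auto simp: \<sigma>1_def sizes_def)
  then have "runs (search_round k;; ?update) \<sigma>1 \<mu> (pass_cost * fan_out ^ k + 30) ?Q"
  proof (rule runs_Seq[where T' = 8])
    fix \<sigma>2 \<mu>2
    assume same: "unchanged (search_round k) \<sigma>1 \<mu> \<sigma>2 \<mu>2" and done_R: "round_done R \<sigma>1 \<sigma>2"
    have vars: "\<sigma>2 x = \<sigma>1 x" if "x \<in> {Low, High, Radius}" for x
      using unchangedD(1)[OF same, of x] search_round_effects(1)[of k] that by (auto simp: volatile_def)
    have "bracket \<sigma>1" using inv by (simp add: bracket_def \<sigma>1_def)
    then have "\<sigma>2 Found \<noteq> 0 \<Longrightarrow> bracket (\<sigma>2(High := R))" "\<sigma>2 Found = 0 \<Longrightarrow> bracket (\<sigma>2(Low := Suc R))"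
      using bracket_halve[of \<sigma>1 R \<sigma>2] done_R inv(2) vars by (simp_all add: \<sigma>1_def R_def)
    moreover have "\<sigma>2 Low = \<sigma> Low" "\<sigma>2 High = \<sigma> High" "\<sigma>2 Radius = R" using vars by (simp_all add: \<sigma>1_def)
    moreover have "R - \<sigma> Low \<le> (\<sigma> High - \<sigma> Low) div 2" "\<sigma> High - Suc R \<le> (\<sigma> High - \<sigma> Low) div 2"
      using inv(2) by (auto simp: R_def)
    ultimately show "runs ?update \<sigma>2 \<mu>2 8 ?Q"
      using R_less by (intro runs_straight) (auto simp: small_less_word simp flip: Suc_eq_plus1)
  qed simp
  then show "wp (Radius ::= (Var Low \<oplus> Var High) \<oslash> Lit 2)
      (\<lambda>\<sigma>' \<mu>'. runs (search_round k;; ?update) \<sigma>' \<mu>' (pass_cost * fan_out ^ k + 30) ?Q) \<sigma> \<mu>"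
    using high inv(2) by (auto simp: \<sigma>1_def R_def intro: small_less_word)
qed (simp add: round_cost_def)

lemma floorlog_half: "0 < x \<Longrightarrow> y \<le> x div 2 \<Longrightarrow> floorlog 2 y + 1 \<le> floorlog 2 x"
  using floorlog_mono[of y "x div 2" 2] compute_floorlog[of 2 x] by simp

lemma runs_binary_search:
  assumes env: "sizes \<sigma>" "\<sigma> HitterCount = sz" "\<sigma> CandidateCount = sz + q" "\<And>a. a \<noteq> Needed \<Longrightarrow> \<mu> a = \<tau> a"
    and centers: "\<And>l. l < k \<Longrightarrow> \<sigma> (Center l) < n"
  shows "runs (binary_search k) \<sigma> \<mu> (floorlog 2 n * round_cost + 8) (\<lambda>\<sigma>' \<mu>'. bracket \<sigma>' \<and> \<sigma>' Low = \<sigma>' High)"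
  unfolding binary_search_def
proof (rule runs_Seq_straight[where T = "floorlog 2 n * round_cost + 4"])
  let ?\<sigma> = "\<sigma>(Low := 0, High := n)"
  have "runs (Loop (Var Low \<prec> Var High) (halve_bracket k)) ?\<sigma> \<mu> (floorlog 2 n * round_cost + 4)
      (\<lambda>\<sigma>' \<mu>'. bracket \<sigma>' \<and> \<sigma>' Low = \<sigma>' High)"
  proof (rule runs_Loop[where I = "\<lambda>\<sigma>' \<mu>'. bracket \<sigma>'" and C = "\<lambda>_ _. round_cost - 4"
        and \<Phi> = "\<lambda>\<sigma>' \<mu>'. floorlog 2 (\<sigma>' High - \<sigma>' Low) * round_cost"], goal_cases init time safe body exit)
    case init
    show ?case using centers by (simp add: bracket_def)
  next
    case (body \<sigma>' \<mu>')
    note same = body(1)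
    have "\<sigma>' x = \<sigma> x" if "x \<in> {VertexCount, HalfEdgeCount, RowLength, HitterCount, CandidateCount}" for x
      using unchangedD(1)[OF same not_in_writes_binary_search(1)[OF that]] that by auto
    moreover have "\<mu>' a = \<tau> a" if "a \<noteq> Needed" for a
      using unchangedD(2)[OF same, of a] binary_search_effects(2)[of k] that env(4) by auto
    moreover have less: "\<sigma>' Low < \<sigma>' High" using body(3) by simp
    ultimately have "runs (halve_bracket k) \<sigma>' \<mu>' (round_cost - 4)
        (\<lambda>\<sigma>'' \<mu>''. bracket \<sigma>'' \<and> \<sigma>'' High - \<sigma>'' Low \<le> (\<sigma>' High - \<sigma>' Low) div 2)"
      using env(1-3) body(2) by (intro runs_halve_bracket) (auto simp: sizes_def)
    then show ?case
    proof (rule runs_weaken[OF _ order_refl])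
      fix \<sigma>'' assume halved: "bracket \<sigma>'' \<and> \<sigma>'' High - \<sigma>'' Low \<le> (\<sigma>' High - \<sigma>' Low) div 2"
      then have "(floorlog 2 (\<sigma>'' High - \<sigma>'' Low) + 1) * round_cost \<le>
          floorlog 2 (\<sigma>' High - \<sigma>' Low) * round_cost"
        using floorlog_half less by (intro mult_le_mono1) simp
      moreover have "4 \<le> round_cost" "expr_cost (Var Low \<prec> Var High :: (var, arr) expr) = 3"
        by (simp_all add: round_cost_def)
      ultimately show "bracket \<sigma>'' \<and> floorlog 2 (\<sigma>'' High - \<sigma>'' Low) * round_cost + (round_cost - 4) +
          expr_cost (Var Low \<prec> Var High :: (var, arr) expr) + 1 \<le> floorlog 2 (\<sigma>' High - \<sigma>' Low) * round_cost"
        using halved unfolding distrib_right by linarith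
    qed
  next
    case (exit \<sigma>' \<mu>')
    then show ?case by (auto simp: bracket_def split: if_splits)
  qed simp_all
  then show "wp (Low ::= Lit 0;; High ::= Var VertexCount)
    (\<lambda>\<sigma>' \<mu>'. runs (Loop (Var Low \<prec> Var High) (halve_bracket k)) \<sigma>' \<mu>'
      (floorlog 2 n * round_cost + 4) (\<lambda>\<sigma>' \<mu>'. bracket \<sigma>' \<and> \<sigma>' Low = \<sigma>' High)) \<sigma> \<mu>"
    using env(1) by (simp add: sizes_def)
qed simp

end

section \<open>Output\<close>

definition mark :: "var \<Rightarrow> (var, arr) com" where
  "mark x = Branch (Elem Used (Var x)) Skip
     (Put_Elem Used (Var x) (Lit 1);; Count ::= Var Count \<oplus> Lit 1)"

fun mark_centers :: "nat \<Rightarrow> (var, arr) com" where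
  "mark_centers 0 = Skip"
| "mark_centers (Suc l) = mark_centers l;; mark (Center l)"

definition pad :: "nat \<Rightarrow> (var, arr) com" where
  "pad k = for_range Vertex VertexCount (Branch (Var Count \<prec> Lit k) (mark Vertex) Skip)"

definition list_used :: "(var, arr) com" where
  "list_used = Index ::= Lit 0;; for_range Vertex VertexCount
     (Branch (Elem Used (Var Vertex)) (Put_Elem Ends (Var Index) (Var Vertex);; Index ::= Var Index \<oplus> Lit 1) Skip)"

definition answer :: "nat \<Rightarrow> (var, arr) com" where
  "answer k = Branch (Var High \<prec> Var VertexCount)
     (Answer ::= Lit 2 \<otimes> Var High \<ominus> Var High \<oslash> Lit (2 * k - 1) \<oplus> Lit 1) (Answer ::= Lit 0)"

definition write_output :: "nat \<Rightarrow> (var, arr) com" where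
  "write_output k = Count ::= Lit 0;; mark_centers k;; pad k;; list_used;; answer k"

lemma mark_effects [simp]:
  "writes (mark x) = {Count}" "stores (mark x) = {Used}"
  "writes (pad k) = {Vertex, Count}" "stores (pad k) = {Used}"
  by (auto simp: mark_def pad_def)

lemma mark_centers_effects: "writes (mark_centers l) \<subseteq> {Count}" "stores (mark_centers l) \<subseteq> {Used}"
  by (induction l) auto

lemma list_used_effects [simp]: "writes list_used = {Index, Vertex}" "stores list_used = {Ends}"
  by (auto simp: list_used_def)

context kcenter_input begin

definition used :: "(arr \<Rightarrow> nat \<Rightarrow> nat \<Rightarrow> nat) \<Rightarrow> nat set" where
  "used \<mu> = {v. v < n \<and> \<mu> Used 0 v \<noteq> 0}"

definition counted :: "(var \<Rightarrow> nat) \<Rightarrow> (arr \<Rightarrow> nat \<Rightarrow> nat \<Rightarrow> nat) \<Rightarrow> bool" where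
  "counted \<sigma> \<mu> \<longleftrightarrow> \<sigma> Count = card (used \<mu>)"

lemma finite_used [simp]: "finite (used \<mu>)"
  by (simp add: used_def)

lemma card_used_le: "card (used \<mu>) \<le> n"
  using card_mono[of "{..<n}" "used \<mu>"] by (auto simp: used_def)

lemma runs_mark:
  assumes "counted \<sigma> \<mu>" "\<sigma> x < n"
  shows "runs (mark x) \<sigma> \<mu> 22 (\<lambda>\<sigma>' \<mu>'. counted \<sigma>' \<mu>' \<and> used \<mu>' = insert (\<sigma> x) (used \<mu>))"
proof -
  have "used (put Used 0 (\<sigma> x) 1 \<mu>) = insert (\<sigma> x) (used \<mu>)" using assms(2) by (auto simp: used_def)
  moreover have "Suc (card (used \<mu>)) < 2 ^ w" using card_used_le[of \<mu>] by (intro small_less_word) simp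
  moreover have "insert (\<sigma> x) (used \<mu>) = used \<mu>" if "\<mu> Used 0 (\<sigma> x) \<noteq> 0" using that assms(2)
    by (auto simp: used_def)
  moreover have "\<sigma> x \<notin> used \<mu>" if "\<mu> Used 0 (\<sigma> x) = 0" using that by (simp add: used_def)
  ultimately show ?thesis
    unfolding mark_def using assms by (intro runs_straight) (auto simp: fits_def counted_def)
qed

lemma runs_mark_centers:
  assumes "counted \<sigma> \<mu>" "\<And>l'. l' < l \<Longrightarrow> \<sigma> (Center l') < n"
  shows "runs (mark_centers l) \<sigma> \<mu> (22 * l)
    (\<lambda>\<sigma>' \<mu>'. counted \<sigma>' \<mu>' \<and> used \<mu>' = used \<mu> \<union> (\<lambda>l'. \<sigma> (Center l')) ` {..<l})"
  using assms(2)
proof (induction l)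
  case 0
  then show ?case using assms(1) by (auto intro: runs_straight)
next
  case (Suc l)
  then have "runs (mark_centers l) \<sigma> \<mu> (22 * l)
    (\<lambda>\<sigma>' \<mu>'. counted \<sigma>' \<mu>' \<and> used \<mu>' = used \<mu> \<union> (\<lambda>l'. \<sigma> (Center l')) ` {..<l})" by simp
  then show ?case
    unfolding mark_centers.simps
  proof (rule runs_Seq)
    fix \<sigma>' \<mu>'
    assume same: "unchanged (mark_centers l) \<sigma> \<mu> \<sigma>' \<mu>'"
      and marked: "counted \<sigma>' \<mu>' \<and> used \<mu>' = used \<mu> \<union> (\<lambda>l'. \<sigma> (Center l')) ` {..<l}"
    have "\<sigma>' (Center l) = \<sigma> (Center l)"
      using unchangedD(1)[OF same, of "Center l"] mark_centers_effects(1)[of l] by auto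
    then show "runs (mark (Center l)) \<sigma>' \<mu>' 22
        (\<lambda>\<sigma>' \<mu>'. counted \<sigma>' \<mu>' \<and> used \<mu>' = used \<mu> \<union> (\<lambda>l'. \<sigma> (Center l')) ` {..<Suc l})"
      using marked Suc.prems by (intro runs_weaken[OF runs_mark order_refl]) (auto simp: lessThan_Suc)
  qed simp
qed

lemma runs_pad:
  assumes "sizes \<sigma>" "counted \<sigma> \<mu>" "card (used \<mu>) \<le> k"
  shows "runs (pad k) \<sigma> \<mu> (40 * n + 6) (\<lambda>\<sigma>' \<mu>'. used \<mu> \<subseteq> used \<mu>' \<and> card (used \<mu>') = k)"
proof -
  let ?body = "Branch (Var Count \<prec> Lit k) (mark Vertex) Skip"
  let ?I = "\<lambda>j \<sigma>' \<mu>'. counted \<sigma>' \<mu>' \<and> used \<mu> \<subseteq> used \<mu>' \<and> card (used \<mu>') \<le> k \<and>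
    (card (used \<mu>') < k \<longrightarrow> {..<j} \<subseteq> used \<mu>')"
  have "runs (pad k) \<sigma> \<mu> (40 * n + 6) (?I n)"
    unfolding pad_def
  proof (rule runs_for_range[where I = ?I and C = 32])
    fix j \<sigma>1 \<mu>1
    assume j: "j < n" "\<sigma>1 Vertex = j" and inv: "?I j \<sigma>1 \<mu>1"
    show "runs ?body \<sigma>1 \<mu>1 32 (\<lambda>\<sigma>' \<mu>'. ?I (Suc j) (\<sigma>'(Vertex := Suc j)) \<mu>')"
    proof (rule runs_Branch[where T = 22])
      assume "val (Var Count \<prec> Lit k) \<sigma>1 \<mu>1 \<noteq> 0"
      then have "card (used \<mu>1) < k" using inv by (simp add: counted_def split: if_splits)
      then show "runs (mark Vertex) \<sigma>1 \<mu>1 22 (\<lambda>\<sigma>' \<mu>'. ?I (Suc j) (\<sigma>'(Vertex := Suc j)) \<mu>')"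
        using inv j by (intro runs_weaken[OF runs_mark order_refl])
          (auto simp: counted_def lessThan_Suc card_insert_if)
    next
      assume "val (Var Count \<prec> Lit k) \<sigma>1 \<mu>1 = 0"
      then show "runs Skip \<sigma>1 \<mu>1 22 (\<lambda>\<sigma>' \<mu>'. ?I (Suc j) (\<sigma>'(Vertex := Suc j)) \<mu>')"
        using inv by (intro runs_straight) (auto simp: counted_def split: if_splits)
    qed (use k_le in \<open>auto intro: small_less_word\<close>)
  qed (use assms in \<open>auto simp: sizes_def small_less_word counted_def\<close>)
  then show ?thesis
  proof (rule runs_weaken[OF _ order_refl])
    fix \<sigma>' \<mu>' assume inv: "?I n \<sigma>' \<mu>'"
    have "\<not> card (used \<mu>') < k"
    proof
      assume less: "card (used \<mu>') < k"
      then have "card {..<n} \<le> card (used \<mu>')" using inv by (intro card_mono) auto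
      then show False using less k_le by simp
    qed
    then show "used \<mu> \<subseteq> used \<mu>' \<and> card (used \<mu>') = k" using inv by auto
  qed
qed

definition enumerates :: "nat set \<Rightarrow> (var \<Rightarrow> nat) \<Rightarrow> (arr \<Rightarrow> nat \<Rightarrow> nat \<Rightarrow> nat) \<Rightarrow> bool" where
  "enumerates A \<sigma> \<mu> \<longleftrightarrow> \<sigma> Index = card A \<and> \<mu> Ends 0 ` {..<\<sigma> Index} = A"

lemma enumerates_upd: "x \<noteq> Index \<Longrightarrow> enumerates A (\<sigma>(x := a)) \<mu> \<longleftrightarrow> enumerates A \<sigma> \<mu>"
  by (simp add: enumerates_def)

lemma enumerates_insert:
  assumes "enumerates A \<sigma> \<mu>" "finite A" "v \<notin> A"
  shows "enumerates (insert v A) (\<sigma>(Index := Suc (\<sigma> Index))) (put Ends 0 (\<sigma> Index) v \<mu>)"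
proof -
  have "(\<mu> Ends 0)(\<sigma> Index := v) ` {..<Suc (\<sigma> Index)} = insert v (\<mu> Ends 0 ` {..<\<sigma> Index})"
    by (rule image_upd_lessThan_Suc)
  also have "\<dots> = insert v A" using assms(1) by (metis enumerates_def)
  finally show ?thesis using assms by (simp add: enumerates_def)
qed

lemma runs_list_used:
  assumes "sizes \<sigma>"
  shows "runs list_used \<sigma> \<mu> (40 * n + 8) (\<lambda>\<sigma>' \<mu>'. \<mu>' Ends 0 ` {..<card (used \<mu>)} = used \<mu>)"
  unfolding list_used_def
proof (rule runs_Seq_straight[where T = "40 * n + 6"])
  let ?body = "Branch (Elem Used (Var Vertex))
    (Put_Elem Ends (Var Index) (Var Vertex);; Index ::= Var Index \<oplus> Lit 1) Skip"
  have "runs (for_range Vertex VertexCount ?body) (\<sigma>(Index := 0)) \<mu> (40 * n + 6) (enumerates (used \<mu> \<inter> {..<n}))"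
  proof (rule runs_for_range[where C = 32 and I = "\<lambda>j. enumerates (used \<mu> \<inter> {..<j})"])
    fix j \<sigma>1 \<mu>1
    assume j: "j < n" "\<sigma>1 Vertex = j"
      and same: "unchanged (for_range Vertex VertexCount ?body) (\<sigma>(Index := 0)) \<mu> \<sigma>1 \<mu>1"
      and inv: "enumerates (used \<mu> \<inter> {..<j}) \<sigma>1 \<mu>1"
    have "card (used \<mu> \<inter> {..<j}) \<le> j" using card_mono[of "{..<j}" "used \<mu> \<inter> {..<j}"] by simp
    then have index: "\<sigma>1 Index < n" "\<sigma>1 Index < 2 * m + 1" using inv j(1) n_le by (auto simp: enumerates_def)
    have used: "\<mu>1 Used 0 j \<noteq> 0 \<longleftrightarrow> j \<in> used \<mu>" using same j(1) by (simp add: unchanged_def used_def)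
    show "runs ?body \<sigma>1 \<mu>1 32 (\<lambda>\<sigma>' \<mu>'. enumerates (used \<mu> \<inter> {..<Suc j}) (\<sigma>'(Vertex := Suc j)) \<mu>')"
    proof (cases "j \<in> used \<mu>")
      case True
      then have "used \<mu> \<inter> {..<Suc j} = insert j (used \<mu> \<inter> {..<j})" by (auto simp: lessThan_Suc)
      then show ?thesis
        using True used j index enumerates_insert[OF inv, of j]
        by (intro runs_straight) (simp_all add: fits_def small_less_word enumerates_upd flip: Suc_eq_plus1)
    next
      case False
      then have "used \<mu> \<inter> {..<Suc j} = used \<mu> \<inter> {..<j}" by (auto simp: lessThan_Suc)
      then show ?thesis using False used j inv by (intro runs_straight) (simp_all add: fits_def enumerates_upd)
    qed
  qed (use assms in \<open>auto simp: sizes_def small_less_word enumerates_def\<close>)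
  moreover have "used \<mu> \<inter> {..<n} = used \<mu>" by (auto simp: used_def)
  ultimately have "runs (for_range Vertex VertexCount ?body) (\<sigma>(Index := 0)) \<mu> (40 * n + 6)
      (\<lambda>\<sigma>' \<mu>'. \<mu>' Ends 0 ` {..<card (used \<mu>)} = used \<mu>)"
    by (elim runs_weaken[OF _ order_refl]) (metis enumerates_def)
  then show "wp (Index ::= Lit 0) (\<lambda>\<sigma>' \<mu>'. runs (for_range Vertex VertexCount ?body) \<sigma>' \<mu>' (40 * n + 6)
      (\<lambda>\<sigma>' \<mu>'. \<mu>' Ends 0 ` {..<card (used \<mu>)} = used \<mu>)) \<sigma> \<mu>" by simp
qed simp

lemma runs_answer:
  assumes "sizes \<sigma>" "\<sigma> High \<le> n"
  shows "runs (answer k) \<sigma> \<mu> 14 (\<lambda>\<sigma>' \<mu>'. \<sigma>' Answer = encoded_radius k (\<sigma> High) \<and> \<mu>' = \<mu>)"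
proof -
  have "2 * k - 1 < 2 ^ w" "2 * \<sigma> High + 1 < 2 ^ w" "2 * \<sigma> High < 2 ^ w" using k_le assms(2)
    by (auto intro!: small_less_word)
  moreover have "\<sigma> High div (2 * k - 1) \<le> 2 * \<sigma> High"
    using div_le_dividend[of "\<sigma> High" "2 * k - 1"] by linarith
  moreover have "2 * \<sigma> High - \<sigma> High div (2 * k - 1) + 1 < 2 ^ w" using assms(2) by (intro small_less_word) simp
  ultimately show ?thesis
    unfolding answer_def using assms
    by (intro runs_straight; cases "\<sigma> High < n") (simp_all add: sizes_def encoded_radius_def approx_radius_def)
qed

lemma runs_write_output:
  assumes "sizes \<sigma>" "used \<mu> = {}" and centers: "\<And>l. l < k \<Longrightarrow> \<sigma> (Center l) < n" and high: "\<sigma> High \<le> n"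
  shows "runs (write_output k) \<sigma> \<mu> (22 * k + 80 * n + 30) (\<lambda>\<sigma>' \<mu>'. \<sigma>' Answer = encoded_radius k (\<sigma> High) \<and>
    (let C = \<mu>' Ends 0 ` {..<k} in C \<subseteq> {..<n} \<and> card C = k \<and> (\<forall>l<k. \<sigma> (Center l) \<in> C)))"
    (is "runs _ _ _ _ ?Q")
  unfolding write_output_def
proof (rule runs_Seq_straight[where T = "22 * k + 80 * n + 28"])
  let ?\<sigma> = "\<sigma>(Count := 0)" and ?centers = "(\<lambda>l. \<sigma> (Center l)) ` {..<k}"
  have "runs (mark_centers k;; pad k;; list_used;; answer k) ?\<sigma> \<mu> (22 * k + 80 * n + 28) ?Q"
  proof (rule runs_Seq)
    show "runs (mark_centers k) ?\<sigma> \<mu> (22 * k) (\<lambda>\<sigma>' \<mu>'. counted \<sigma>' \<mu>' \<and> used \<mu>' = ?centers)"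
      using runs_mark_centers[of ?\<sigma> \<mu> k] assms by (simp add: counted_def)
    fix \<sigma>1 \<mu>1
    assume same1: "unchanged (mark_centers k) ?\<sigma> \<mu> \<sigma>1 \<mu>1" and marked: "counted \<sigma>1 \<mu>1 \<and> used \<mu>1 = ?centers"
    have vars1: "\<sigma>1 x = \<sigma> x" if "x \<noteq> Count" for x
      using unchangedD(1)[OF same1, of x] mark_centers_effects(1)[of k] that by auto
    then have sizes1: "sizes \<sigma>1" using assms(1) by (simp add: sizes_def)
    have "card (used \<mu>1) \<le> k" using marked card_image_le[of "{..<k}" "\<lambda>l. \<sigma> (Center l)"] by simp
    then have "runs (pad k) \<sigma>1 \<mu>1 (40 * n + 6) (\<lambda>\<sigma>' \<mu>'. used \<mu>1 \<subseteq> used \<mu>' \<and> card (used \<mu>') = k)"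
      using marked by (intro runs_pad[OF sizes1]) auto
    then show "runs (pad k;; list_used;; answer k) \<sigma>1 \<mu>1 (80 * n + 28) ?Q"
    proof (rule runs_Seq)
      fix \<sigma>2 \<mu>2
      assume same2: "unchanged (pad k) \<sigma>1 \<mu>1 \<sigma>2 \<mu>2" and padded: "used \<mu>1 \<subseteq> used \<mu>2 \<and> card (used \<mu>2) = k"
      have sizes2: "sizes \<sigma>2" using sizes_unchanged[OF sizes1 same2] by simp
      show "runs (list_used;; answer k) \<sigma>2 \<mu>2 (40 * n + 22) ?Q"
      proof (rule runs_Seq[OF runs_list_used[OF sizes2]])
        fix \<sigma>3 \<mu>3
        assume same3: "unchanged list_used \<sigma>2 \<mu>2 \<sigma>3 \<mu>3" and listed: "\<mu>3 Ends 0 ` {..<card (used \<mu>2)} = used \<mu>2"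
        have "sizes \<sigma>3" using sizes_unchanged[OF sizes2 same3] by simp
        moreover have "\<sigma>3 High = \<sigma> High" using same2 same3 vars1 by (simp add: unchanged_def)
        moreover have "\<mu>3 Ends 0 ` {..<k} = used \<mu>2" using listed padded by simp
        moreover have "used \<mu>2 \<subseteq> {..<n}" by (auto simp: used_def)
        moreover have "\<sigma> (Center l) \<in> used \<mu>2" if "l < k" for l using padded marked that by blast
        ultimately show "runs (answer k) \<sigma>3 \<mu>3 14 ?Q"
          using high padded by (intro runs_weaken[OF runs_answer order_refl]) simp_all
      qed simp
    qed simp
  qed simp
  then show "wp (Count ::= Lit 0) (\<lambda>\<sigma>' \<mu>'.
      runs (mark_centers k;; pad k;; list_used;; answer k) \<sigma>' \<mu>' (22 * k + 80 * n + 28) ?Q) \<sigma> \<mu>"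
    by simp
qed simp

end

section \<open>The complete program\<close>

definition near_row_length :: "nat \<Rightarrow> nat \<Rightarrow> nat" where
  "near_row_length k n = (if k = 1 then 1 else LEAST q. n \<le> q * q)"

lemma le_near_row_length_square: "k \<noteq> 1 \<Longrightarrow> n \<le> near_row_length k n * near_row_length k n"
  using LeastI[of "\<lambda>q. n \<le> q * q" n] by (simp add: near_row_length_def)

lemma near_row_length_le: "k \<noteq> 1 \<Longrightarrow> n \<le> q * q \<Longrightarrow> near_row_length k n \<le> q"
  by (simp add: near_row_length_def Least_le)

lemma near_row_length_bounds:
  assumes "1 \<le> n"
  shows "1 \<le> near_row_length k n" "near_row_length k n \<le> n"
proof -
  show "1 \<le> near_row_length k n"
  proof (cases "k = 1")
    case False
    from le_near_row_length_square[OF this, of n] show ?thesis using assms by (cases "near_row_length k n") auto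
  qed (simp add: near_row_length_def)
  show "near_row_length k n \<le> n"
    using near_row_length_le[of k n n] assms by (cases "k = 1") (simp_all add: near_row_length_def)
qed

definition set_row_length :: "nat \<Rightarrow> (var, arr) com" where
  "set_row_length k = RowLength ::= Lit 1;;
     (if k = 1 then Skip
      else Loop (Var RowLength \<otimes> Var RowLength \<prec> Var VertexCount) (RowLength ::= Var RowLength \<oplus> Lit 1))"

definition kcenter :: "nat \<Rightarrow> (var, arr) com" where
  "kcenter k = set_row_length k;; preprocess;; binary_search k;; write_output k"

lemma set_row_length_effects [simp]: "writes (set_row_length k) = {RowLength}" "stores (set_row_length k) = {}"
  by (auto simp: set_row_length_def)

lemma preprocess_effects [simp]:
  "writes preprocess =
     {Source, Head, Tail, Vertex, Edge, Neighbour, Index, Best, ArgBest, HitterCount, CandidateCount}"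
  "stores preprocess = {Next, First, Dist, Queue, Unhit, Tally, Hitters, HitDist, NearHit}"
  by (auto simp: preprocess_def apsp_def link_half_edges_def)

context kcenter_input begin

lemma runs_set_row_length:
  assumes q: "q = near_row_length k n" and n: "\<sigma> VertexCount = n"
  shows "runs (set_row_length k) \<sigma> \<mu> (10 * n + 10) (\<lambda>\<sigma>' \<mu>'. \<sigma>' RowLength = q)"
proof (cases "k = 1")
  case True
  then show ?thesis
    unfolding set_row_length_def using q by (intro runs_straight) (simp_all add: near_row_length_def)
next
  case False
  let ?test = "Var RowLength \<otimes> Var RowLength \<prec> Var VertexCount :: (var, arr) expr"
  have "runs (Loop ?test (RowLength ::= Var RowLength \<oplus> Lit 1)) (\<sigma>(RowLength := 1)) \<mu> (10 * n + 6)
    (\<lambda>\<sigma>' \<mu>'. \<sigma>' RowLength = q)"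
  proof (rule runs_Loop[where I = "\<lambda>\<sigma>' \<mu>'. \<sigma>' RowLength \<le> q" and \<Phi> = "\<lambda>\<sigma>' \<mu>'. (q - \<sigma>' RowLength) * 10"
        and C = "\<lambda>_ _. 4"], goal_cases init time safe body exit)
    case (safe \<sigma>' \<mu>')
    then have "\<sigma>' RowLength * \<sigma>' RowLength \<le> n * n" using q_le by (intro mult_le_mono) auto
    then show ?case by (simp add: square_less_word)
  next
    case (body \<sigma>' \<mu>')
    have "\<sigma>' VertexCount = n" using body(1) n by (simp add: unchanged_def)
    then have "\<sigma>' RowLength * \<sigma>' RowLength < n" using body(3) by (simp split: if_splits)
    then have "\<sigma>' RowLength \<noteq> q" using le_near_row_length_square[OF False, of n] q by auto
    then have "\<sigma>' RowLength < q" using body(2) by simp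
    then show ?case using q_le by (intro runs_straight) (auto simp: small_less_word)
  next
    case (exit \<sigma>' \<mu>')
    have "\<sigma>' VertexCount = n" using exit(1) n by (simp add: unchanged_def)
    then have "n \<le> \<sigma>' RowLength * \<sigma>' RowLength" using exit(3) by (simp split: if_splits)
    then show ?case using near_row_length_le[OF False] exit(2) q by fastforce
  qed (use q_pos q_le in auto)
  then show ?thesis
    unfolding set_row_length_def using False by (intro runs_Seq_straight[where T = "10 * n + 6"]) simp_all
qed

definition search_cost :: nat where
  "search_cost = floorlog 2 n * (n * (11 * k + 100) * (2 * (max_hitters n q + q) + 4) ^ k + 40)"

definition kcenter_cost :: nat where
  "kcenter_cost = preprocess_cost + search_cost + 22 * k + 90 * n + 48"

lemma runs_search_and_output:
  assumes q: "q = near_row_length k n" and env: "sizes \<sigma>" "\<sigma> CandidateCount = \<sigma> HitterCount + q"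
    and computed: "search_tables (\<sigma> HitterCount) \<mu>" "\<sigma> HitterCount \<le> max_hitters n q" and used: "used \<mu> = {}"
    and centers: "\<And>l. \<sigma> (Center l) < n"
  shows "runs (binary_search k;; write_output k) \<sigma> \<mu> (search_cost + 22 * k + 80 * n + 38) (\<lambda>\<sigma>' \<mu>'.
    good_approx n E k
      (case \<sigma>' Answer of 0 \<Rightarrow> \<infinity> | Suc r \<Rightarrow> enat r) (\<mu>' Ends 0 ` {..<k}))"
    (is "runs _ _ _ _ ?Q")
proof -
  define sz where "sz = \<sigma> HitterCount"
  interpret search_input n E k es w q sz \<mu>
    using computed q by unfold_locales (auto simp: sz_def near_row_length_def)
  have "round_cost \<le> n * (11 * k + 100) * (2 * (max_hitters n q + q) + 4) ^ k + 40"
    unfolding round_cost_def pass_cost_def fan_out_def using computed(2)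
    by (intro add_right_mono mult_le_mono2 power_mono) (simp_all add: sz_def)
  then have "floorlog 2 n * round_cost + 8 + (22 * k + 80 * n + 30) \<le> search_cost + 22 * k + 80 * n + 38"
    unfolding search_cost_def by (simp add: mult_le_mono2)
  then show ?thesis
  proof (rule runs_Seq[OF runs_binary_search[of \<sigma> \<mu>], rotated 5])
    fix \<sigma>' \<mu>'
    assume same: "unchanged (binary_search k) \<sigma> \<mu> \<sigma>' \<mu>'" and found: "bracket \<sigma>' \<and> \<sigma>' Low = \<sigma>' High"
    have sizes': "sizes \<sigma>'"
      by (rule sizes_unchanged[OF env(1) same]) (rule not_in_writes_binary_search, simp)+
    have "\<mu>' Used = \<mu> Used" using unchangedD(2)[OF same, of Used] binary_search_effects(4)[of k] by auto
    then have used': "used \<mu>' = {}" using used by (simp add: used_def)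
    have centers': "\<sigma>' (Center l) < n" if "l < k" for l using found that by (simp add: bracket_def)
    have high: "\<sigma>' High \<le> n" using found by (simp add: bracket_def)
    show "runs (write_output k) \<sigma>' \<mu>' (22 * k + 80 * n + 30) ?Q"
    proof (rule runs_weaken[OF runs_write_output[of \<sigma>' \<mu>', OF sizes' used' centers' high] order_refl])
      fix \<sigma>'' and \<mu>'' :: "arr \<Rightarrow> nat \<Rightarrow> nat \<Rightarrow> nat"
      define C where "C = \<mu>'' Ends 0 ` {..<k}"
      assume "\<sigma>'' Answer = encoded_radius k (\<sigma>' High) \<and> (let C = \<mu>'' Ends 0 ` {..<k} in
        C \<subseteq> {..<n} \<and> card C = k \<and> (\<forall>l<k. \<sigma>' (Center l) \<in> C))"
      then have answer: "\<sigma>'' Answer = encoded_radius k (\<sigma>' High)" and C: "C \<subseteq> {..<n}" "card C = k"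
        and centers_in: "\<And>l. l < k \<Longrightarrow> \<sigma>' (Center l) \<in> C"
        by (simp_all add: C_def Let_def)
      have "\<exists>c\<in>C. d c z \<le> approx_radius k (\<sigma>' High)" if "\<sigma>' High < n" "z < n" for z
        using found that centers_in unfolding bracket_def by blast
      then show "?Q \<sigma>'' \<mu>''"
        using good_approx_encoded_radius[OF k_pos C, of "\<sigma>' High"] found high answer
        by (simp add: bracket_def C_def)
    qed
  qed (use env centers in \<open>auto simp: sz_def\<close>)
qed

lemma runs_kcenter:
  assumes q: "q = near_row_length k n" and vars: "\<sigma> VertexCount = n" "\<sigma> HalfEdgeCount = 2 * m"
    "\<And>l. \<sigma> (Center l) = 0"
    and ends: "\<And>e. e < 2 * m \<Longrightarrow> \<mu> Ends 0 e = endpoint e"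
    and zero: "\<And>v. \<mu> First 0 v = 0" "\<And>s i. \<mu> Queue s i = 0" "\<And>v. \<mu> Used 0 v = 0"
  shows "runs (kcenter k) \<sigma> \<mu> kcenter_cost (\<lambda>\<sigma>' \<mu>'.
    good_approx n E k
      (case \<sigma>' Answer of 0 \<Rightarrow> \<infinity> | Suc r \<Rightarrow> enat r) (\<mu>' Ends 0 ` {..<k}))"
    (is "runs _ _ _ _ ?Q")
  unfolding kcenter_def
proof (rule runs_Seq[OF runs_set_row_length[of \<sigma> \<mu>, OF q vars(1)], where T' = "kcenter_cost - (10 * n + 10)"])
  fix \<sigma>1 \<mu>1
  assume same1: "unchanged (set_row_length k) \<sigma> \<mu> \<sigma>1 \<mu>1" and row: "\<sigma>1 RowLength = q"
  have sizes1: "sizes \<sigma>1" and "\<mu>1 = \<mu>" using same1 vars row by (auto simp: sizes_def unchanged_def)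
  then have pre: "runs preprocess \<sigma>1 \<mu>1 preprocess_cost (\<lambda>\<sigma>' \<mu>'. search_tables (\<sigma>' HitterCount) \<mu>' \<and>
      \<sigma>' HitterCount \<le> max_hitters n q \<and> \<sigma>' CandidateCount = \<sigma>' HitterCount + q)"
    using ends zero by (intro runs_preprocess) auto
  show "runs (preprocess;; binary_search k;; write_output k) \<sigma>1 \<mu>1 (kcenter_cost - (10 * n + 10)) ?Q"
  proof (rule runs_Seq[OF pre, where T' = "search_cost + 22 * k + 80 * n + 38"])
    fix \<sigma>2 \<mu>2
    assume same2: "unchanged preprocess \<sigma>1 \<mu>1 \<sigma>2 \<mu>2" and computed: "search_tables (\<sigma>2 HitterCount) \<mu>2 \<and>
      \<sigma>2 HitterCount \<le> max_hitters n q \<and> \<sigma>2 CandidateCount = \<sigma>2 HitterCount + q"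
    have "sizes \<sigma>2" using sizes_unchanged[OF sizes1 same2] by simp
    moreover have "used \<mu>2 = {}" using same2 zero(3) \<open>\<mu>1 = \<mu>\<close> by (simp add: unchanged_def used_def)
    moreover have "\<sigma>2 (Center l) = 0" for l using same1 same2 vars(3) by (simp add: unchanged_def)
    ultimately show "runs (binary_search k;; write_output k) \<sigma>2 \<mu>2 (search_cost + 22 * k + 80 * n + 38) ?Q"
      using computed n_pos by (intro runs_search_and_output[OF q]) auto
  qed (simp add: kcenter_cost_def)
qed (simp add: kcenter_cost_def)

end

definition prologue :: "instr list" where
  "prologue = [Move (var_reg VertexCount) 0, Bin OpAdd (var_reg HalfEdgeCount) 1 1, Bin OpMul 1 0 0,
     Bin OpAdd 1 1 (var_reg HalfEdgeCount), Const (tmp_reg 0) 1, Bin OpAdd 1 1 (tmp_reg 0)]"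

definition kcenter_program :: "nat \<Rightarrow> instr list" where
  "kcenter_program k = prologue @ compile (kcenter k) @ [Move 0 (var_reg Answer)]"

context kcenter_input begin

definition initial_vars :: "var \<Rightarrow> nat" where
  "initial_vars = (\<lambda>_. 0)(VertexCount := n, HalfEdgeCount := 2 * m)"

definition initial_arrays :: "arr \<Rightarrow> nat \<Rightarrow> nat \<Rightarrow> nat" where
  "initial_arrays a i j = mem (input_state n es) (address n (n * n + 2 * m + 1) a i j)"

lemma initial_arrays_Ends: "e < 2 * m \<Longrightarrow> initial_arrays Ends 0 e = endpoint e"
  by (simp add: initial_arrays_def address_def input_state_def endpoint_def)

lemma initial_arrays_zero: "a \<noteq> Ends \<Longrightarrow> initial_arrays a i j = 0"
proof -
  assume "a \<noteq> Ends"
  then have "1 \<le> slot a" by (cases a) simp_all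
  then have "n * n + 2 * m + 1 \<le> slot a * (n * n + 2 * m + 1)" by (metis mult_1 mult_le_mono1)
  then have "2 * m \<le> slot a * (n * n + 2 * m + 1)" by (rule order_trans[rotated]) simp
  then have "2 * m \<le> address n (n * n + 2 * m + 1) a i j" unfolding address_def by (rule trans_le_add2)
  then show ?thesis by (simp add: initial_arrays_def input_state_def)
qed

lemma prologue_reaches:
  "\<exists>r. represents r initial_vars initial_arrays \<and> reaches w 6 (prologue @ K, input_state n es) (K, r)"
proof -
  have "0 < w" using numeral_less_word(1) by (cases w) simp_all
  moreover have "2 * m < 2 ^ w" "n * n < 2 ^ w" "n * n + 2 * m < 2 ^ w" "n * n + 2 * m + 1 < 2 ^ w"
    using word_large by simp_all
  ultimately show ?thesis
    by (auto simp: prologue_def reaches_instr represents_def initial_vars_def initial_arrays_def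
        input_state_def set_reg_def mult_2[symmetric])
qed

lemma kcenter_program_reaches:
  assumes q: "q = near_row_length k n" and T: "kcenter_cost + 7 \<le> T"
  obtains r where "reaches w T (kcenter_program k, input_state n es) ([], r)"
    "good_approx n E k (output_value ([], r)) (output_centers k ([], r))"
proof -
  have "runs (kcenter k) initial_vars initial_arrays kcenter_cost (\<lambda>\<sigma>' \<mu>'.
    good_approx n E k
      (case \<sigma>' Answer of 0 \<Rightarrow> \<infinity> | Suc r \<Rightarrow> enat r) (\<mu>' Ends 0 ` {..<k}))"
    by (rule runs_kcenter[OF q]) (auto simp: initial_vars_def initial_arrays_Ends initial_arrays_zero)
  then obtain t \<sigma> \<mu> where exec: "exec (kcenter k) initial_vars initial_arrays t \<sigma> \<mu>" "t \<le> kcenter_cost"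
    and approx: "good_approx n E k
      (case \<sigma> Answer of 0 \<Rightarrow> \<infinity> | Suc r \<Rightarrow> enat r) (\<mu> Ends 0 ` {..<k})"
    unfolding runs_def by blast
  let ?epilogue = "[Move 0 (var_reg Answer)]"
  obtain r0 where r0: "represents r0 initial_vars initial_arrays"
    "reaches w 6 (kcenter_program k, input_state n es) (compile (kcenter k) @ ?epilogue, r0)"
    using prologue_reaches unfolding kcenter_program_def by blast
  obtain r1 where r1: "represents r1 \<sigma> \<mu>" "reaches w t (compile (kcenter k) @ ?epilogue, r0) (?epilogue, r1)"
    using compile_reaches[OF exec(1) r0(1)] by blast
  define r where "r = set_reg 0 (\<sigma> Answer) r1"
  have "reaches w 1 (?epilogue, r1) ([], r)" using represents_var[OF r1(1)] by (simp add: reaches_instr r_def)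
  from reaches_trans[OF reaches_trans[OF reaches_trans[OF r0(2) r1(2)] this] reaches_halted[of w "T - (6 + t + 1)"]]
  have "reaches w T (kcenter_program k, input_state n es) ([], r)" using exec(2) T by simp
  moreover have "mem r l = \<mu> Ends 0 l" if "l < k" for l
  proof -
    have "fits n m Ends 0 l" using that k_le n_le by (simp add: fits_def)
    then have "mem r1 (address n (n * n + 2 * m + 1) Ends 0 l) = \<mu> Ends 0 l" using r1(1)
      unfolding represents_def by blast
    then show ?thesis by (simp add: r_def set_reg_def address_def)
  qed
  then have "output_centers k ([], r) = \<mu> Ends 0 ` {..<k}" by (auto simp: output_centers_def)
  moreover have "output_value ([], r) = (case \<sigma> Answer of 0 \<Rightarrow> \<infinity> | Suc r \<Rightarrow> enat r)"
    by (simp add: output_value_def r_def set_reg_def)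
  ultimately show thesis using that approx by simp
qed

end

section \<open>Running time\<close>

definition log_factor :: "nat \<Rightarrow> real" where
  "log_factor n = 1 + log 2 (real n)"

lemma one_le_log_factor: "1 \<le> n \<Longrightarrow> 1 \<le> log_factor n"
  by (simp add: log_factor_def)

lemma floorlog_le_log_factor: "1 \<le> n \<Longrightarrow> real (floorlog 2 n) \<le> log_factor n"
  by (simp add: floorlog_def log_factor_def)

lemma ln_le_log2: "1 \<le> x \<Longrightarrow> ln x \<le> log 2 x"
proof -
  assume "1 \<le> x"
  moreover have "ln 2 \<le> (1::real)" using ln_le_minus_one[of 2] by simp
  ultimately show ?thesis by (simp add: log_def field_simps mult_left_le)
qed

lemma near_row_length_pred_square: "k \<noteq> 1 \<Longrightarrow> 1 \<le> n \<Longrightarrow> (near_row_length k n - 1) * (near_row_length k n - 1) \<le> n"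
  using near_row_length_le[of k n "near_row_length k n - 1"] near_row_length_bounds(1)[of n k] by force

text \<open>The square root balances the length of the rows against the number of vertices that hit them;
  for \<open>k = 1\<close> no hitting set is needed, and rows of length one are cheapest.\<close>

definition row_scale :: "nat \<Rightarrow> nat \<Rightarrow> real" where
  "row_scale k n = (if k = 1 then real n else sqrt (real n))"

lemma one_le_row_scale: "1 \<le> n \<Longrightarrow> 1 \<le> row_scale k n"
  by (simp add: row_scale_def)

lemma near_row_length_le_scale:
  assumes "1 \<le> n"
  shows "real (near_row_length k n) \<le> 2 * row_scale k n"
proof (cases "k = 1")
  case False
  let ?q = "near_row_length k n"
  have "real (?q - 1) ^ 2 \<le> real n"
    using near_row_length_pred_square[OF False assms] by (metis of_nat_le_iff of_nat_mult power2_eq_square)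
  then have "real (?q - 1) \<le> sqrt (real n)" by (rule real_le_rsqrt)
  moreover have "real (?q - 1) = real ?q - 1" using near_row_length_bounds(1)[OF assms, of k]
    by (simp add: of_nat_diff)
  moreover have "1 \<le> sqrt (real n)" using assms by simp
  ultimately have "real ?q \<le> 2 * sqrt (real n)" by linarith
  then show ?thesis using False by (simp add: row_scale_def)
qed (use assms in \<open>simp add: near_row_length_def row_scale_def\<close>)

lemma le_scale_mult_near_row_length: "real n \<le> row_scale k n * real (near_row_length k n)"
proof (cases "k = 1")
  case False
  have "real n \<le> real (near_row_length k n) ^ 2"
    using le_near_row_length_square[OF False, of n] by (metis of_nat_le_iff of_nat_mult power2_eq_square)
  then have "sqrt (real n) \<le> real (near_row_length k n)" by (intro real_le_lsqrt) auto
  then have "sqrt (real n) * sqrt (real n) \<le> sqrt (real n) * real (near_row_length k n)"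
    by (intro mult_left_mono) auto
  then show ?thesis using False by (simp add: row_scale_def)
qed (simp add: near_row_length_def row_scale_def)

lemma power_row_scale: "1 \<le> n \<Longrightarrow> k \<noteq> 1 \<Longrightarrow> real n * row_scale k n ^ k = real n powr (real k / 2 + 1)"
  by (simp add: row_scale_def powr_add powr_half_sqrt[symmetric] powr_realpow[symmetric] powr_powr)

definition work :: "nat \<Rightarrow> nat \<Rightarrow> nat \<Rightarrow> real" where
  "work k n m = real m * real n + real n powr (real k / 2 + 1)"

lemma square_le_work:
  assumes "1 \<le> n" "n \<le> m + 1"
  shows "real n * real n \<le> work k n m"
proof -
  have "real n * real n \<le> (real m + 1) * real n" using assms(2) by (intro mult_right_mono) auto
  moreover have "real n \<le> real n powr (real k / 2 + 1)"
    using assms(1) powr_mono[of 1 "real k / 2 + 1" "real n"] by simp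
  ultimately show ?thesis by (simp add: work_def algebra_simps)
qed

lemma scale_power_le_work:
  assumes "1 \<le> n" "n \<le> m + 1"
  shows "real n * row_scale k n ^ k \<le> work k n m"
proof (cases "k = 1")
  case True
  then show ?thesis using square_le_work[OF assms, of k] by (simp add: row_scale_def)
next
  case False
  then show ?thesis using power_row_scale[OF assms(1), of k] by (simp add: work_def)
qed

context kcenter_input begin

lemma max_hitters_mult_le: "real (max_hitters n q) * real q \<le> real n * log_factor n"
proof -
  have "real (max_hitters n q) \<le> greedy_potential n q n"
    using greedy_potential_nonneg[of n q n] by (simp add: max_hitters_def)
  also have "\<dots> = real n / real q * (1 + ln (real n))" using n_pos by (simp add: greedy_potential_def)
  also have "\<dots> \<le> real n / real q * log_factor n"
    using n_pos ln_le_log2[of "real n"] by (intro mult_left_mono) (auto simp: log_factor_def)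
  finally show ?thesis using q_pos by (simp add: field_simps)
qed

lemma max_hitters_le_log: "real (max_hitters n q) \<le> real n * log_factor n"
proof -
  have "real (max_hitters n q) * 1 \<le> real (max_hitters n q) * real q" using q_pos by (intro mult_left_mono) auto
  then show ?thesis using max_hitters_mult_le by simp
qed

lemma greedy_time_le:
  "real ((max_hitters n q + 1) * greedy_cost) \<le> 428 * (real n * real n * log_factor n)"
proof -
  define H where "H = real (max_hitters n q)"
  have "n * 1 \<le> n * q" "1 * 1 \<le> n * q" using q_pos n_pos by (intro mult_le_mono; simp)+
  then have "greedy_cost \<le> 214 * (n * q)" unfolding greedy_cost_def distrib_left by linarith
  then have "real greedy_cost \<le> 214 * (real n * real q)" by (metis of_nat_le_iff of_nat_mult of_nat_numeral)
  then have "(H + 1) * real greedy_cost \<le> (H + 1) * (214 * (real n * real q))"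
    by (intro mult_left_mono) (auto simp: H_def)
  also have "\<dots> = 214 * (real n * (H * real q)) + 214 * (real n * real q)" by (simp add: algebra_simps)
  also have "\<dots> \<le> 214 * (real n * (real n * log_factor n)) + 214 * (real n * (real n * log_factor n))"
  proof -
    have "real q * 1 \<le> real n * log_factor n" using q_le one_le_log_factor[OF n_pos] by (intro mult_mono) auto
    then show ?thesis using max_hitters_mult_le by (intro add_mono mult_left_mono) (auto simp: H_def)
  qed
  finally show ?thesis by (simp add: H_def algebra_simps)
qed

lemma nearest_hitters_time_le: "real (n * (max_hitters n q * 60 + 60)) \<le> 120 * (real n * real n * log_factor n)"
proof -
  have "1 * 1 \<le> real n * log_factor n" using n_pos one_le_log_factor[OF n_pos] by (intro mult_mono) auto
  then have "real (max_hitters n q) * 60 + 60 \<le> 120 * (real n * log_factor n)" using max_hitters_le_log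
    by linarith
  then have "real n * (real (max_hitters n q) * 60 + 60) \<le> real n * (120 * (real n * log_factor n))"
    by (rule mult_left_mono) simp
  then show ?thesis by (simp add: algebra_simps)
qed

lemma candidates_le:
  assumes q: "q = near_row_length k n"
  shows "real (2 * (max_hitters n q + q) + 4) \<le> 10 * (row_scale k n * log_factor n)"
proof -
  let ?s = "row_scale k n"
  have s: "1 \<le> ?s" by (rule one_le_row_scale[OF n_pos])
  have "real (max_hitters n q) * real q \<le> ?s * real q * log_factor n"
    using max_hitters_mult_le le_scale_mult_near_row_length[of n k] q one_le_log_factor[OF n_pos]
    by (meson mult_right_mono order_trans le_numeral_extra zero_le_one)
  then have "real (max_hitters n q) \<le> ?s * log_factor n" using q_pos by (simp add: mult.assoc mult.left_commute)
  moreover have "real q \<le> 2 * ?s" unfolding q by (rule near_row_length_le_scale[OF n_pos])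
  moreover have "?s * 1 \<le> ?s * log_factor n" using s one_le_log_factor[OF n_pos] by (intro mult_left_mono) auto
  ultimately show ?thesis using s unfolding of_nat_add of_nat_mult of_nat_numeral distrib_left mult_1_right
    by linarith
qed

lemma search_cost_le:
  assumes q: "q = near_row_length k n"
  shows "real search_cost \<le> ((11 * real k + 100) * 10 ^ k + 40) * (work k n m * log_factor n ^ (k + 1))"
proof -
  let ?B = "real (2 * (max_hitters n q + q) + 4)"
  have "?B ^ k \<le> (10 * (row_scale k n * log_factor n)) ^ k" using candidates_le[OF q] by (intro power_mono) auto
  then have "real n * (11 * real k + 100) * ?B ^ k \<le>
      real n * (11 * real k + 100) * (10 * (row_scale k n * log_factor n)) ^ k"
    by (intro mult_left_mono) auto
  also have "\<dots> = (11 * real k + 100) * 10 ^ k * (real n * row_scale k n ^ k * log_factor n ^ k)"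
    by (simp add: power_mult_distrib algebra_simps)
  also have "\<dots> \<le> (11 * real k + 100) * 10 ^ k * (work k n m * log_factor n ^ k)"
    using scale_power_le_work[OF n_pos n_le, of k] one_le_log_factor[OF n_pos]
    by (intro mult_left_mono mult_right_mono) auto
  finally have tree: "real n * (11 * real k + 100) * ?B ^ k \<le>
      (11 * real k + 100) * 10 ^ k * (work k n m * log_factor n ^ k)" .
  have "1 * 1 \<le> real n * real n" using n_pos by (intro mult_mono) auto
  then have "1 * 1 \<le> work k n m * log_factor n ^ k"
    using square_le_work[OF n_pos n_le, of k] one_le_log_factor[OF n_pos] by (intro mult_mono one_le_power) auto
  then have "real n * (11 * real k + 100) * ?B ^ k + 40 \<le>
      ((11 * real k + 100) * 10 ^ k + 40) * (work k n m * log_factor n ^ k)"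
    using tree by (simp add: distrib_right)
  then have "real search_cost \<le>
      log_factor n * (((11 * real k + 100) * 10 ^ k + 40) * (work k n m * log_factor n ^ k))"
    unfolding search_cost_def using floorlog_le_log_factor[OF n_pos] one_le_log_factor[OF n_pos]
    by (simp only: of_nat_mult of_nat_add of_nat_power of_nat_numeral, intro mult_mono) auto
  then show ?thesis by (simp only: power_add power_one_right mult_ac)
qed

definition cost_factor :: nat where
  "cost_factor = 1300 + (11 * k + 100) * 10 ^ k"

lemma kcenter_cost_le:
  assumes q: "q = near_row_length k n"
  shows "real (kcenter_cost + 7) \<le> real cost_factor * (work k n m * log_factor n ^ (k + 1))"
proof -
  define W where "W = work k n m * log_factor n ^ (k + 1)"
  have log: "1 \<le> log_factor n ^ k" "1 \<le> log_factor n ^ (k + 1)" "log_factor n \<le> log_factor n ^ (k + 1)"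
    using one_le_log_factor[OF n_pos] power_increasing[of 1 "k + 1" "log_factor n"]
    by (auto intro: one_le_power)
  have square: "real n * real n \<le> work k n m" by (rule square_le_work[OF n_pos n_le])
  have "work k n m * 1 \<le> W" unfolding W_def using log(2) by (intro mult_left_mono) (auto simp: work_def)
  then have W: "work k n m \<le> W" by simp
  have "real n * real n * log_factor n \<le> W"
    unfolding W_def using square log(3) one_le_log_factor[OF n_pos] by (intro mult_mono) (auto simp: work_def)
  moreover have "real n * 1 \<le> real n * real n" "real m * 1 \<le> real m * real n"
    using n_pos by (intro mult_left_mono; simp)+
  moreover have "real m * real n \<le> work k n m" by (simp add: work_def)
  moreover have "1 \<le> real n" "real k \<le> real n" using n_pos k_le by simp_all
  moreover have "real search_cost \<le> ((11 * real k + 100) * 10 ^ k + 40) * W" unfolding W_def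
    by (rule search_cost_le[OF q])
  moreover have "real (kcenter_cost + 7) =
      100 * real m + 240 * (real m * real n) + 60 * (real n * real n) + 58 * real n +
      real ((max_hitters n q + 1) * greedy_cost) + real (n * (max_hitters n q * 60 + 60)) +
      real search_cost + 22 * real k + 90 * real n + 87"
    by (simp add: kcenter_cost_def preprocess_cost_def algebra_simps)
  moreover have "real cost_factor * W = 1300 * W + ((11 * real k + 100) * 10 ^ k) * W"
    by (simp add: cost_factor_def distrib_right)
  ultimately show ?thesis
    using W square greedy_time_le nearest_hitters_time_le
    unfolding W_def[symmetric] distrib_right of_nat_add of_nat_numeral by linarith
qed

end

lemma card_edges_le:
  assumes "simple_graph n E"
  shows "card E \<le> n * n"
proof -
  have "E \<subseteq> (\<lambda>(u, v). {u, v}) ` ({..<n} \<times> {..<n})"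
    using assms by (fastforce simp: simple_graph_def)
  then have "card E \<le> card ((\<lambda>(u, v). {u, v}) ` ({..<n} \<times> {..<n}))" by (intro card_mono) auto
  also have "\<dots> \<le> card ({..<n} \<times> {..<n})" by (intro card_image_le) auto
  finally show ?thesis by (simp add: card_cartesian_product)
qed

lemma length_edge_listing: "edge_listing E es \<Longrightarrow> length es = card E"
  using distinct_card[of "map (\<lambda>(u, v). {u, v}) es"] by (simp add: edge_listing_def)

lemma square_le_word_size:
  assumes "1 \<le> n"
  shows "400 * (n * n) \<le> 2 ^ (12 * floorlog 2 n)"
proof -
  define b where "b = (2::nat) ^ floorlog 2 n"
  have "n < b" unfolding b_def using floorlog_bounds[of n 2] assms by simp
  then have "n * n \<le> b ^ 2" "2 \<le> b" using assms by (auto simp: power2_eq_square intro!: mult_le_mono)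
  moreover have "2 ^ 10 \<le> b ^ 10" using \<open>2 \<le> b\<close> by (intro power_mono) auto
  ultimately have "2 ^ 10 * (n * n) \<le> b ^ 10 * b ^ 2" by (intro mult_le_mono)
  also have "\<dots> = 2 ^ (12 * floorlog 2 n)"
    unfolding b_def by (simp add: power_mult[symmetric] power_add[symmetric] mult.commute)
  finally show ?thesis by simp
qed

lemma kcenter_input_of_listing:
  assumes "simple_graph n E" "1 \<le> k" "k \<le> n" "n \<le> card E + 1" "edge_listing E es"
  shows "kcenter_input n E k es (12 * floorlog 2 n) (near_row_length k n)"
proof -
  have n: "1 \<le> n" using assms by simp
  have "card E \<le> n * n" "n \<le> n * n" "1 * 1 \<le> n * n" using card_edges_le[OF assms(1)] n
    by (simp_all only: mult_le_mono) simp
  then have "100 * (n * n + n + card E + 1) \<le> 2 ^ (12 * floorlog 2 n)"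
    using square_le_word_size[OF n] unfolding distrib_left by linarith
  then show ?thesis
    using assms n near_row_length_bounds[OF n, of k] length_edge_listing[OF assms(5)] by unfold_locales auto
qed

definition kcenter_time :: "nat \<Rightarrow> nat \<Rightarrow> nat \<Rightarrow> nat" where
  "kcenter_time k n m = nat \<lfloor>real (kcenter_input.cost_factor k) * (work k n m * log_factor n ^ (k + 1))\<rfloor>"

lemma kcenter_time_in_soft_O: "kcenter_time k \<in> soft_O (\<lambda>n m. real m * real n + real n powr (real k / 2 + 1))"
proof -
  have "real (kcenter_time k n m) \<le>
      real (kcenter_input.cost_factor k) * (real m * real n + real n powr (real k / 2 + 1)) *
      (1 + log 2 (real n)) ^ (k + 1)"
    if "1 \<le> n" for n m
  proof -
    have "0 \<le> real (kcenter_input.cost_factor k) * (work k n m * log_factor n ^ (k + 1))"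
      using that by (intro mult_nonneg_nonneg zero_le_power) (auto simp: work_def log_factor_def)
    then show ?thesis by (simp add: kcenter_time_def work_def log_factor_def mult.assoc)
  qed
  then show ?thesis unfolding soft_O_def by blast
qed

lemma kcenter_program_solves:
  assumes "1 \<le> k"
  shows "solves_k_center_whp (kcenter_program k) 12 (kcenter_time k) 1 k
    (2 - 1 / (2 * real k - 1)) (1 - 1 / (2 * real k - 1))"
  unfolding solves_k_center_whp_def
proof (intro allI impI, elim conjE)
  fix n E es
  assume input: "simple_graph n E" "k \<le> n" "n \<le> card E + 1" "edge_listing E es"
  interpret kcenter_input n E k es "12 * floorlog 2 n" "near_row_length k n"
    using input assms by (intro kcenter_input_of_listing)
  have "kcenter_cost + 7 \<le> kcenter_time k n (card E)"
    unfolding kcenter_time_def using kcenter_cost_le[OF refl] length_edge_listing[OF input(4)]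
    by (intro le_nat_floor) simp
  then obtain r where
    "reaches (12 * floorlog 2 n) (kcenter_time k n (card E)) (kcenter_program k, input_state n es) ([], r)"
    and approx: "good_approx n E k (output_value ([], r)) (output_centers k ([], r))"
    by (rule kcenter_program_reaches[OF refl])
  then have "run (12 * floorlog 2 n) (kcenter_time k n (card E)) (kcenter_program k, input_state n es) =
      return_pmf ([], r)"
    by (simp add: reaches_def)
  then show "let D = run (12 * floorlog 2 n) (kcenter_time k n (card E)) (kcenter_program k, input_state n es) in
      (\<forall>cf\<in>set_pmf D. halted cf) \<and>
      measure_pmf.prob D {cf. good_approx n E k
        (output_value cf) (output_centers k cf)} \<ge> 1 - 1 / real n powr 1"
    using approx by (simp add: halted_def)
qed

theorem mainTheorem9:
  fixes k :: nat
  assumes "k \<ge> 1"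
  shows "\<exists>(P :: instr list) (\<kappa> :: nat) (T :: nat \<Rightarrow> nat \<Rightarrow> nat) (c :: real).
    \<kappa> \<ge> 2 \<and> c > 0 \<and>
    T \<in> soft_O (\<lambda>n m. real m * real n + real n powr (real k / 2 + 1)) \<and>
    solves_k_center_whp P \<kappa> T c k
      (2 - 1 / (2 * real k - 1)) (1 - 1 / (2 * real k - 1))"
proof (intro exI conjI)
  show "kcenter_time k \<in> soft_O (\<lambda>n m. real m * real n + real n powr (real k / 2 + 1))"
    by (rule kcenter_time_in_soft_O)
  show "solves_k_center_whp (kcenter_program k) 12 (kcenter_time k) 1 k
      (2 - 1 / (2 * real k - 1)) (1 - 1 / (2 * real k - 1))"
    using assms by (rule kcenter_program_solves)
qed simp_all

end
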